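(* Let $x,y,z$ be non-negative integers and let $\mathbf a=(a_1,\dots,a_m)$, $\mathbf b=(b_1,\dots,b_n)$ be sequences of non-negative integers. Put $\mu=2\lfloor\frac{m+1}{2}\rfloor$, $\mu'=2\lceil\frac{m-1}{2}\rceil$, $\nu=2\lfloor\frac{n+1}{2}\rfloor$, $\nu'=2\lceil\frac{n-1}{2}\rceil$, and $$\mathbf t^{+}=(0,a_1,\dots,a_{\mu-1},\,a_{\mu}+x+y+b_{\nu},\,b_{\nu-1},\dots,b_1),\qquad \mathbf t^{-}=(a_1,\dots,a_{\mu'},\,a_{\mu'+1}+x+y+b_{\nu'+1},\,b_{\nu'},\dots,b_1,z).$$ Then $$M(W^{(1)}_{x,y,z}(\mathbf a;\mathbf b))=\frac{M(W^{(1)}_{x+y,0,z}(\mathbf a;\mathbf b))\,M(W^{(1)}_{0,y,z}(\mathbf a;\mathbf b))}{M(W^{(1)}_{y,0,z}(\mathbf a;\mathbf b))}\cdot\frac{T(x+1,2a+b+2y+z-1,y)\,V(2x+2a+1,b+2y+z,y)}{T(1,2a+b+2y+z-1,y)\,V(2a+1,b+2y+z,y)}$$ $$=2^{-2y+a_1}\,Q'(\mathbf t^{+})\,Q'(\mathbf t^{-})\cdot\frac{(2a+2y-1)!!}{(2a-1)!!}\cdot\frac{H_2(2o_a+2o_b+1)\,H_2(2e_a+2e_b+2z+1)}{H_2(2o_a+2o_b+2y+1)\,H_2(2e_a+2e_b+2y+2z+1)}\cdot\frac{H(2a+b+2y+z)\,H(b+y+z)}{H(2a+b+y+z)\,H(b+z)}$$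 $$\cdot\frac{T(x+1,2a+b+2y+z-1,y)\,V(2x+2a+1,b+2y+z,y)}{T(1,2a+b+2y+z-1,y)\,V(2a+1,b+2y+z,y)}.$$
   Context: Lattice and tilings. For real $u,k$ let $[u;k]$ be the point of the plane with Cartesian coordinates $(u,\frac{\sqrt3}{2}k)$. The triangular lattice has as vertices all $[u;k]$ with $k\in\mathbb Z$, $u-k/2\in\mathbb Z$; its faces are unit equilateral triangles, up-pointing or down-pointing. A region is a finite union of unit triangles. A lozenge is the union of two unit triangles sharing an edge; it is vertical if that edge is horizontal. A tiling of a region is a covering of it by lozenges contained in it, without gaps or overlaps. $M(R)$ is the sum of the weights of all tilings of $R$, the weight of a tiling being the product of the weights of its lozenges; lozenges have weight $1$ unless stated otherwise; $M(\emptyset)=1$. Sequences. $a=\sum a_i$, $b=\sum b_j$; $o_a,e_a$ are the sums of the $a_i$ with $i$ odd, resp. even; $o_b,e_b$ likewise. $a_i=0$ for $i>m$, $b_j=0$ for $j>n$; an empty sequence is treated as the one-term sequence $(0)$. Functions. $H(n)=\prod_{i=0}^{n-1}i!$; $H_2(n)=\prod_{i=1}^{\lfloor n/2\rfloor}(n-2i)!$; for $n\ge0$, $(x)_n=x(x+1)\cdots(x+n-1)$ and $[x]_n=x(x+2)\cdots(x+2n-2)$ (both $1$ for $n=0$); $T(x,n,m)=\prod_{i=0}^{m-1}(x+i)_{n-2i}$, $V(x,n,m)=\prod_{i=0}^{m-1}[x+2i]_{n-2i}$; $(2n+1)!!=1\cdot3\cdots(2n+1)$, $(-1)!!=1$.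 Empty products are $1$. Quartered hexagons. For a sequence $\mathbf t=(t_1,\dots,t_{2l})$ of non-negative integers let $s_k=t_1+\dots+t_k$, $o_t=\sum_{i\text{ odd}}t_i$, $e_t=\sum_{i\text{ even}}t_i$. Take the region bounded by the base from $[0;0]$ to $[o_t+e_t;0]$, the segment from $[o_t+e_t;0]$ to $[o_t;2e_t]$, the north side from $[o_t;2e_t]$ to $[0;2e_t]$, and the west zigzag through $[0;0],[-\frac12;1],[0;2],[-\frac12;3],\dots,[0;2e_t]$; remove from it, for each $1\le i\le l$, the up-pointing triangle with base from $[s_{2i-1};0]$ to $[s_{2i};0]$. Give weight $\frac12$ to each vertical lozenge whose two western (left) sides both lie on the west zigzag. $Q'(\mathbf t)$ is $M$ of this weighted region. The weighted region $W^{(1)}_{x,y,z}(\mathbf a;\mathbf b)$. Let $L=x+y+a+b$, $A=2(y+o_a+o_b)$, $B=2(y+z+e_a+e_b)$, and let $\ell$ be the line $k=0$. Upper part: bounded by $\ell$ between $[0;0]$ and $[L;0]$, the segment from $[L;0]$ to $[L-\frac A2;A]$, the horizontal north side at height $k=A$, and the west zigzag through the points $[\alpha(k);k]$, $0\le k\le A$, with $\alpha(k)=0$ for $k$ even and $-\frac12$ for $k$ odd. Lower part: bounded by $\ell$ between $[0;0]$ and $[L;0]$, the segments from $[L;0]$ to $[L+\frac z2;-z]$ and from there to $[L+z-\frac B2;-B]$, the horizontal south side at $k=-B$, and the west zigzag through $[\beta(k);-k]$, $0\le k\le B$, with $\beta(k)=0$ for $k$ even and $-\frac12$ for $k$ odd.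 The region is the union of the two parts (lozenges may cross $\ell$) after removing: (i) from the upper part, everything at points $[u;k]$ with $u<a_1-k/2$ (an up-pointing half triangle of side $2a_1$); (ii) for $2\le i\le m$, the triangle of side $a_i$ having a side on $\ell$ from $[a_1+\dots+a_{i-1};0]$ to $[a_1+\dots+a_i;0]$, down-pointing (below $\ell$) if $i$ is even, up-pointing (above $\ell$) if $i$ is odd; (iii) for $1\le j\le n$, the triangle of side $b_j$ having a side on $\ell$ from $[L-b_1-\dots-b_j;0]$ to $[L-b_1-\dots-b_{j-1};0]$, up-pointing (above $\ell$) if $j$ is odd, down-pointing (below $\ell$) if $j$ is even. Each vertical lozenge of the region whose two western (left) sides both lie on the west zigzags has weight $\frac12$. *)

theory Defs
  imports Complex_Main "HOL-Library.Disjoint_Sets"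
begin

text \<open>
  The vertex \<open>(i, k)\<close> of the triangular lattice stands for the point \<open>[i + k/2; k]\<close>, so that every
  pair of integers is a vertex and every vertex arises exactly once.  A unit triangle is
  represented by the set of its three vertices, and a region by the set of its unit triangles.
\<close>

type_synonym vertex = "int \<times> int"
type_synonym triangle = "vertex set"
type_synonym region = "triangle set"
type_synonym lozenge = "triangle set"

definition ucoord :: "vertex \<Rightarrow> real" where
  "ucoord v = real_of_int (fst v) + real_of_int (snd v) / 2"

text \<open>\<open>up_tri i k\<close> has its horizontal side at the bottom, \<open>down_tri i k\<close> has the same segment as
  its top side.\<close>

definition up_tri :: "int \<Rightarrow> int \<Rightarrow> triangle" where
  "up_tri i k = {(i, k), (i + 1, k), (i, k + 1)}"

definition down_tri :: "int \<Rightarrow> int \<Rightarrow> triangle" where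
  "down_tri i k = {(i, k), (i + 1, k), (i + 1, k - 1)}"

definition unit_triangles :: "triangle set" where
  "unit_triangles = {t. \<exists>i k. t = up_tri i k \<or> t = down_tri i k}"

text \<open>Two unit triangles share an edge iff they have exactly two vertices in common.\<close>

definition is_lozenge :: "lozenge \<Rightarrow> bool" where
  "is_lozenge l \<longleftrightarrow>
     (\<exists>s\<in>unit_triangles. \<exists>t\<in>unit_triangles. card (s \<inter> t) = 2 \<and> l = {s, t})"

definition tilings :: "region \<Rightarrow> lozenge set set" where
  "tilings R = {P. partition_on R P \<and> (\<forall>l\<in>P. is_lozenge l)}"

text \<open>\<open>E\<close> is the set of unit edges of the west zigzag.  The vertical lozenge formed by
  \<open>up_tri i k\<close> and \<open>down_tri i k\<close> has the two western sides named below.\<close>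

definition lozenge_weight :: "vertex set set \<Rightarrow> lozenge \<Rightarrow> real" where
  "lozenge_weight E l =
     (if \<exists>i k. l = {up_tri i k, down_tri i k} \<and>
               {(i, k), (i, k + 1)} \<in> E \<and> {(i, k), (i + 1, k - 1)} \<in> E
      then 1 / 2 else 1)"

definition tiling_sum :: "vertex set set \<Rightarrow> region \<Rightarrow> real" where
  "tiling_sum E R = (\<Sum>P\<in>tilings R. \<Prod>l\<in>P. lozenge_weight E l)"

text \<open>\<open>tris_in P\<close> consists of the unit triangles contained in the part of the plane formed by the
  points \<open>[u; k]\<close> with \<open>P u k\<close>.  It suffices to test the vertices, because all the regions below are
  bounded by lattice lines, apart from the zigzag, which is straight between consecutive
  rows of the lattice.\<close>

definition tris_in :: "(real \<Rightarrow> int \<Rightarrow> bool) \<Rightarrow> region" where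
  "tris_in P = {t \<in> unit_triangles. \<forall>v\<in>t. P (ucoord v) (snd v)}"

definition zigzag :: "int \<Rightarrow> real" where
  "zigzag k = (if even k then 0 else - 1 / 2)"

definition zigzag_edges :: "int \<Rightarrow> int \<Rightarrow> vertex set set" where
  "zigzag_edges lo hi = {{v, w} | v w. snd w = snd v + 1 \<and> lo \<le> snd v \<and> snd w \<le> hi \<and>
     ucoord v = zigzag (snd v) \<and> ucoord w = zigzag (snd w)}"

text \<open>Triangles of side \<open>s\<close> with a side from \<open>[p; 0]\<close> to \<open>[p + s; 0]\<close>.\<close>

definition up_triangle :: "nat \<Rightarrow> nat \<Rightarrow> region" where
  "up_triangle p s =
     tris_in (\<lambda>u k. 0 \<le> k \<and> real p + real_of_int k / 2 \<le> u \<and> u \<le> real (p + s) - real_of_int k / 2)"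

definition down_triangle :: "nat \<Rightarrow> nat \<Rightarrow> region" where
  "down_triangle p s =
     tris_in (\<lambda>u k. k \<le> 0 \<and> real p - real_of_int k / 2 \<le> u \<and> u \<le> real (p + s) + real_of_int k / 2)"

text \<open>Sequences are lists; \<open>entry t i\<close> is \<open>t\<^sub>i\<close> with indices starting at 1, and 0 beyond the end.\<close>

definition entry :: "nat list \<Rightarrow> nat \<Rightarrow> nat" where
  "entry t i = (if 1 \<le> i \<and> i \<le> length t then t ! (i - 1) else 0)"

definition psum :: "nat list \<Rightarrow> nat \<Rightarrow> nat" where
  "psum t k = (\<Sum>i = 1..k. entry t i)"

definition odd_sum :: "nat list \<Rightarrow> nat" where
  "odd_sum t = (\<Sum>i | i \<in> {1..length t} \<and> odd i. entry t i)"

definition even_sum :: "nat list \<Rightarrow> nat" where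
  "even_sum t = (\<Sum>i | i \<in> {1..length t} \<and> even i. entry t i)"

text \<open>The length of a sequence, where the empty sequence is read as the one-term sequence \<open>(0)\<close>.\<close>

definition seq_length :: "nat list \<Rightarrow> nat" where
  "seq_length t = max 1 (length t)"

definition Q_region :: "nat list \<Rightarrow> region" where
  "Q_region t =
     tris_in (\<lambda>u k. 0 \<le> k \<and> k \<le> 2 * int (even_sum t) \<and> zigzag k \<le> u \<and>
                   u \<le> real (odd_sum t + even_sum t) - real_of_int k / 2)
     - (\<Union>i\<in>{1..length t div 2}. up_triangle (psum t (2 * i - 1)) (entry t (2 * i)))"

definition Q' :: "nat list \<Rightarrow> real" where
  "Q' t = tiling_sum (zigzag_edges 0 (2 * int (even_sum t))) (Q_region t)"

definition W1_base :: "nat \<Rightarrow> nat \<Rightarrow> nat list \<Rightarrow> nat list \<Rightarrow> nat" where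
  "W1_base x y a b = x + y + sum_list a + sum_list b"

definition W1_north :: "nat \<Rightarrow> nat list \<Rightarrow> nat list \<Rightarrow> nat" where
  "W1_north y a b = 2 * (y + odd_sum a + odd_sum b)"

definition W1_south :: "nat \<Rightarrow> nat \<Rightarrow> nat list \<Rightarrow> nat list \<Rightarrow> nat" where
  "W1_south y z a b = 2 * (y + z + even_sum a + even_sum b)"

text \<open>The half triangle cut off by the line \<open>u = a\<^sub>1 - k/2\<close> is removed here already.\<close>

definition W1_upper :: "nat \<Rightarrow> nat \<Rightarrow> nat list \<Rightarrow> nat list \<Rightarrow> region" where
  "W1_upper x y a b =
     tris_in (\<lambda>u k. 0 \<le> k \<and> k \<le> int (W1_north y a b) \<and> zigzag k \<le> u \<and>
                   u \<le> real (W1_base x y a b) - real_of_int k / 2)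
     - tris_in (\<lambda>u k. u \<le> real (entry a 1) - real_of_int k / 2)"

text \<open>The two bounds \<open>L - k/2\<close> and \<open>L + z + k/2\<close> are the lines through the two eastern segments, which
  meet at \<open>[L + z/2; -z]\<close>.\<close>

definition W1_lower :: "nat \<Rightarrow> nat \<Rightarrow> nat \<Rightarrow> nat list \<Rightarrow> nat list \<Rightarrow> region" where
  "W1_lower x y z a b =
     tris_in (\<lambda>u k. - int (W1_south y z a b) \<le> k \<and> k \<le> 0 \<and> zigzag k \<le> u \<and>
                   u \<le> real (W1_base x y a b) - real_of_int k / 2 \<and>
                   u \<le> real (W1_base x y a b + z) + real_of_int k / 2)"

definition W1_region :: "nat \<Rightarrow> nat \<Rightarrow> nat \<Rightarrow> nat list \<Rightarrow> nat list \<Rightarrow> region" where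
  "W1_region x y z a b =
     (W1_upper x y a b \<union> W1_lower x y z a b)
     - (\<Union>i\<in>{2..length a}. if even i then down_triangle (psum a (i - 1)) (entry a i)
                                    else up_triangle (psum a (i - 1)) (entry a i))
     - (\<Union>j\<in>{1..length b}. if odd j then up_triangle (W1_base x y a b - psum b j) (entry b j)
                                   else down_triangle (W1_base x y a b - psum b j) (entry b j))"

definition M_W1 :: "nat \<Rightarrow> nat \<Rightarrow> nat \<Rightarrow> nat list \<Rightarrow> nat list \<Rightarrow> real" where
  "M_W1 x y z a b =
     tiling_sum (zigzag_edges (- int (W1_south y z a b)) (int (W1_north y a b)))
       (W1_region x y z a b)"

text \<open>For \<open>m \<ge> 0\<close> an integer, \<open>\<lceil>(m - 1) / 2\<rceil> = \<lfloor>m / 2\<rfloor>\<close>; this gives \<open>\<mu>'\<close> and \<open>\<nu>'\<close> in \<open>t_minus\<close>.\<close>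

definition t_plus :: "nat \<Rightarrow> nat \<Rightarrow> nat list \<Rightarrow> nat list \<Rightarrow> nat list" where
  "t_plus x y a b =
     (let \<mu> = 2 * ((seq_length a + 1) div 2); \<nu> = 2 * ((seq_length b + 1) div 2)
      in [0] @ map (entry a) [1..<\<mu>] @ [entry a \<mu> + x + y + entry b \<nu>]
         @ rev (map (entry b) [1..<\<nu>]))"

definition t_minus :: "nat \<Rightarrow> nat \<Rightarrow> nat \<Rightarrow> nat list \<Rightarrow> nat list \<Rightarrow> nat list" where
  "t_minus x y z a b =
     (let \<mu>' = 2 * (seq_length a div 2); \<nu>' = 2 * (seq_length b div 2)
      in map (entry a) [1..<\<mu>' + 1] @ [entry a (\<mu>' + 1) + x + y + entry b (\<nu>' + 1)]
         @ rev (map (entry b) [1..<\<nu>' + 1]) @ [z])"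

definition H_fn :: "nat \<Rightarrow> real" where
  "H_fn n = (\<Prod>i<n. fact i)"

definition H2_fn :: "nat \<Rightarrow> real" where
  "H2_fn n = (\<Prod>i = 1..n div 2. fact (n - 2 * i))"

text \<open>\<open>(x)\<^sub>n\<close> is \<open>pochhammer x n\<close>, and \<open>skip_pochhammer x n\<close> is \<open>[x]\<^sub>n\<close>.\<close>

definition skip_pochhammer :: "real \<Rightarrow> nat \<Rightarrow> real" where
  "skip_pochhammer x n = (\<Prod>i<n. x + 2 * real i)"

text \<open>The subtraction \<open>n - 2 * i\<close> does not truncate where these functions are used: in the theorem
  \<open>m = y\<close> and \<open>n \<ge> 2 * y - 1\<close> for \<open>T_fn\<close> (if \<open>y > 0\<close>), \<open>n \<ge> 2 * y\<close> for \<open>V_fn\<close>.\<close>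

definition T_fn :: "real \<Rightarrow> nat \<Rightarrow> nat \<Rightarrow> real" where
  "T_fn x n m = (\<Prod>i<m. pochhammer (x + real i) (n - 2 * i))"

definition V_fn :: "real \<Rightarrow> nat \<Rightarrow> nat \<Rightarrow> real" where
  "V_fn x n m = (\<Prod>i<m. skip_pochhammer (x + 2 * real i) (n - 2 * i))"

text \<open>\<open>odd_fact n\<close> is \<open>(2n - 1)!!\<close>; in particular \<open>odd_fact 0 = (-1)!! = 1\<close>.\<close>

definition odd_fact :: "nat \<Rightarrow> real" where
  "odd_fact n = (\<Prod>i<n. real (2 * i + 1))"

end

theory Submission
  imports Defs "Jordan_Normal_Form.Determinant" "HOL-Library.Infinite_Set"
begin

text \<open>
  A tiling of a trapezoid with zigzag west side is an array of interlacing rows (the positions of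
  its vertical lozenges), so summing row by row turns its weighted number of tilings into a
  determinant of central factorials.  For dents at the positions \<open>s \<in> S\<close> of the base this is
  \<open>G(S) = \<Prod> (s + 1/2) \<cdot> \<Prod>\<^sub>t\<^sub><\<^sub>s ((s + 1/2)\<^sup>2 - (t + 1/2)\<^sup>2)\<close> up to a constant depending on \<open>|S|\<close> only.
  A removed triangle is equivalent to a row of dents, because the lozenges in it are forced.
  Cutting the region along the line \<open>k = 0\<close> therefore gives \<open>\<Sum>\<^sub>S G(O \<union> S) G(E \<union> S)\<close>, where \<open>O\<close> and \<open>E\<close> are
  the positions of the triangles above and below the line and \<open>S\<close> runs through the \<open>y\<close>-subsets of
  the gap between the two ferns.  Since \<open>O\<close> and \<open>E\<close> together fill the complement of the gap, the summand is
  \<open>G(O) G(E)\<close> times a function of \<open>S\<close> that depends only on the total lengths \<open>a\<close> and \<open>b + z\<close> of the ferns.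
  What remains is a discrete Selberg sum for a Racah-type weight: by Cauchy--Binet it is a
  determinant whose entries are summable in closed form, and it is evaluated by row elimination.
\<close>

section \<open>Determinants of functions\<close>


text \<open>The zigzag with its half weights acts as a mirror in the line \<open>u = 0\<close>; this
  is why squares of half-integers occur. The determinants have even polynomials at integers on odd
  lines and odd polynomials at half-integers on even lines. The weight 1/2 at position 0 is half of
  a symmetric sum, so the telescoping starts there with the value 0.

  The determinant of the Selberg sum becomes accessible in a suitable pair of bases. Newton
  polynomials with zeros at the left end of the gap for one Vandermonde factor, and beyond the right
  fern for the other, merely lengthen the two occupied blocks, so every entry is a one-variable sum
  of the same family.

  Row elimination yields the dependence on the length \<open>x + y\<close> of the gap and leaves a
  recursive constant. Its value is obtained indirectly: for \<open>x = 0\<close> the gap has exactly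
  one subset of size \<open>y\<close>, and this single term is the product of double factorials and
  values of \<open>H\<close>. Hence the shape of the theorem, a value at \<open>x = 0\<close> times
  a ratio of \<open>T\<close> and \<open>V\<close>.\<close>

definition fun_det :: "nat \<Rightarrow> (nat \<Rightarrow> nat \<Rightarrow> real) \<Rightarrow> real" where
  "fun_det n f = det (mat n n (\<lambda>(i, j). f i j))"

lemma fun_det_Leibniz:
  "fun_det n f = (\<Sum>p | p permutes {0..<n}. signof p * (\<Prod>i = 0..<n. f i (p i)))"
proof -
  have "(\<Prod>i = 0..<n. mat n n (\<lambda>(i, j). f i j) $$ (i, p i)) = (\<Prod>i = 0..<n. f i (p i))"
    if "p permutes {0..<n}" for p
  proof (rule prod.cong)
    fix i assume "i \<in> {0..<n}"
    moreover from this have "p i \<in> {0..<n}" using permutes_in_image[OF that] by blast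
    ultimately show "mat n n (\<lambda>(i, j). f i j) $$ (i, p i) = f i (p i)" by simp
  qed simp
  then show ?thesis unfolding fun_det_def det_def by simp
qed

lemma fun_det_cong:
  assumes "\<And>i j. i < n \<Longrightarrow> j < n \<Longrightarrow> f i j = g i j"
  shows "fun_det n f = fun_det n g"
  unfolding fun_det_def by (rule arg_cong[where f = det], rule eq_matI) (use assms in auto)

lemma fun_det_transpose: "fun_det n (\<lambda>i j. f j i) = fun_det n f"
proof -
  have "mat n n (\<lambda>(i, j). f j i) = transpose_mat (mat n n (\<lambda>(i, j). f i j))"
    by (rule eq_matI) auto
  then show ?thesis unfolding fun_det_def using det_transpose[of "mat n n (\<lambda>(i, j). f i j)" n] by simp
qed

lemma fun_det_0 [simp]: "fun_det 0 f = 1"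
  by (simp add: fun_det_Leibniz)

lemma fun_det_scale_rows: "fun_det n (\<lambda>i j. u i * f i j) = (\<Prod>i<n. u i) * fun_det n f"
  by (simp add: fun_det_Leibniz prod.distrib sum_distrib_left mult_ac atLeast0LessThan)

lemma fun_det_scale_cols: "fun_det n (\<lambda>i j. v j * f i j) = (\<Prod>j<n. v j) * fun_det n f"
proof -
  have "fun_det n (\<lambda>i j. v j * f i j) = fun_det n (\<lambda>i j. v i * f j i)"
    by (rule fun_det_transpose[symmetric])
  also have "\<dots> = (\<Prod>j<n. v j) * fun_det n f"
    by (simp add: fun_det_scale_rows fun_det_transpose[of n f])
  finally show ?thesis .
qed

lemma fun_det_scale: "fun_det n (\<lambda>i j. u i * v j * f i j) = (\<Prod>i<n. u i) * (\<Prod>j<n. v j) * fun_det n f"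
proof -
  have "fun_det n (\<lambda>i j. u i * v j * f i j) = fun_det n (\<lambda>i j. u i * (v j * f i j))"
    by (simp add: mult_ac)
  then show ?thesis by (simp add: fun_det_scale_rows fun_det_scale_cols)
qed

lemma fun_det_const: "fun_det n (\<lambda>i j. c * f i j) = c ^ n * fun_det n f"
  using fun_det_scale_rows[of n "\<lambda>_. c" f] by simp

text \<open>This is multiplication from the left by a unit lower bidiagonal matrix: all rows change
  at once, each by a multiple of its original predecessor. The same form serves to undo differences
  of rows and to eliminate a column.\<close>

lemma fun_det_add_previous_rows:
  "fun_det n (\<lambda>i j. if i = 0 then f 0 j else f i j + c i * f (i - 1) j) = fun_det n f"
proof -
  let ?L = "mat n n (\<lambda>(i, k). if k = i then 1 else if i = Suc k then c i else 0)"
  let ?M = "mat n n (\<lambda>(i, j). f i j)"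
  have "mat n n (\<lambda>(i, j). if i = 0 then f 0 j else f i j + c i * f (i - 1) j) = ?L * ?M"
  proof (rule eq_matI)
    fix i j assume "i < dim_row (?L * ?M)" "j < dim_col (?L * ?M)"
    then have i: "i < n" and j: "j < n" by auto
    have "(?L * ?M) $$ (i, j) = (\<Sum>k = 0..<n. (if k = i then 1 else if i = Suc k then c i else 0) * f k j)"
      using i j by (simp add: scalar_prod_def)
    also have "\<dots> = (\<Sum>k = 0..<n. (if k = i then f k j else 0)
                       + (if k = i - 1 then if i = 0 then 0 else c i * f k j else 0))"
      by (rule sum.cong) auto
    also have "\<dots> = (if i = 0 then f 0 j else f i j + c i * f (i - 1) j)"
      using i by (auto simp: sum.distrib)
    finally show "mat n n (\<lambda>(i, j). if i = 0 then f 0 j else f i j + c i * f (i - 1) j) $$ (i, j)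
        = (?L * ?M) $$ (i, j)" using i j by simp
  qed auto
  moreover have "det ?L = 1"
  proof -
    have "det ?L = prod_list (diag_mat ?L)"
      by (rule det_lower_triangular[where n = n]) auto
    also have "diag_mat ?L = map (\<lambda>_. 1) [0..<n]" by (auto simp: diag_mat_def)
    finally show ?thesis by (simp add: prod_list_replicate map_replicate_const)
  qed
  ultimately show ?thesis unfolding fun_det_def using det_mult[of ?L n ?M] by simp
qed

lemma fun_det_first_col:
  assumes "\<And>i. 0 < i \<Longrightarrow> i \<le> n \<Longrightarrow> f i 0 = 0"
  shows "fun_det (Suc n) f = f 0 0 * fun_det n (\<lambda>i j. f (Suc i) (Suc j))"
proof -
  let ?A = "mat (Suc n) (Suc n) (\<lambda>(i, j). f i j)"
  have "det ?A = (\<Sum>i<Suc n. ?A $$ (i, 0) * cofactor ?A i 0)"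
    by (rule laplace_expansion_column) auto
  also have "\<dots> = ?A $$ (0, 0) * cofactor ?A 0 0"
    by (subst sum.lessThan_Suc_shift) (use assms in auto)
  also have "cofactor ?A 0 0 = fun_det n (\<lambda>i j. f (Suc i) (Suc j))"
    unfolding cofactor_def fun_det_def
    by (simp, rule arg_cong[where f = det], rule eq_matI) (auto simp: mat_delete_def)
  finally show ?thesis unfolding fun_det_def by simp
qed

lemma fun_det_first_row:
  assumes "\<And>j. 0 < j \<Longrightarrow> j \<le> n \<Longrightarrow> f 0 j = 0"
  shows "fun_det (Suc n) f = f 0 0 * fun_det n (\<lambda>i j. f (Suc i) (Suc j))"
  using fun_det_first_col[of n "\<lambda>i j. f j i"] assms
  by (simp add: fun_det_transpose[of "Suc n" f] fun_det_transpose[of n "\<lambda>i j. f (Suc i) (Suc j)"])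

lemma fun_det_add_previous_cols:
  "fun_det n (\<lambda>i j. if j = 0 then f i 0 else f i j + c j * f i (j - 1)) = fun_det n f"
  using fun_det_add_previous_rows[of n "\<lambda>i j. f j i" c]
  by (simp add: fun_det_transpose[of n f]
      fun_det_transpose[of n "\<lambda>i j. if j = 0 then f i 0 else f i j + c j * f i (j - 1)"])

text \<open>Multilinearity in the rows. Read from right to left, it turns a sum of determinants over
  interlacing rows into one determinant with summed entries.\<close>

lemma fun_det_sum_rows:
  assumes "\<And>i. i < n \<Longrightarrow> finite (E i)"
  shows "fun_det n (\<lambda>i j. \<Sum>e\<in>E i. f i e j) = (\<Sum>g\<in>PiE {..<n} E. fun_det n (\<lambda>i j. f i (g i) j))"
proof -
  have "(\<Prod>i = 0..<n. \<Sum>e\<in>E i. f i e (p i)) = (\<Sum>g\<in>PiE {..<n} E. \<Prod>i = 0..<n. f i (g i) (p i))" for p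
    using prod_sum_PiE[of "{..<n}" E "\<lambda>i e. f i e (p i)"] assms by (simp add: atLeast0LessThan)
  then show ?thesis
    by (simp add: fun_det_Leibniz sum_distrib_left sum.swap[of _ "PiE {..<n} E"])
qed

text \<open>Replacing the first node \<open>c 0\<close> by \<open>y 0\<close> makes the first row a unit vector.\<close>

lemma fun_det_Newton:
  "fun_det n (\<lambda>i j. \<Prod>k<j. y i - c k) = (\<Prod>i<n. \<Prod>j<i. y i - y j)"
proof (induction n arbitrary: y)
  case 0
  then show ?case by simp
next
  case (Suc n)
  let ?f = "\<lambda>i j. \<Prod>k<j. y i - c k"
  let ?g = "\<lambda>i j. if j = 0 then 1 else (y i - y 0) * (\<Prod>k<j - 1. y i - c k)"
  have "fun_det (Suc n) ?f = fun_det (Suc n) (\<lambda>i j. if j = 0 then ?f i 0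
      else ?f i j + (c (j - 1) - y 0) * ?f i (j - 1))"
    by (rule fun_det_add_previous_cols[symmetric])
  also have "\<dots> = fun_det (Suc n) ?g"
  proof (rule fun_det_cong)
    fix i j
    show "(if j = 0 then ?f i 0 else ?f i j + (c (j - 1) - y 0) * ?f i (j - 1)) = ?g i j"
      by (cases j) (simp_all add: algebra_simps)
  qed
  also have "\<dots> = ?g 0 0 * fun_det n (\<lambda>i j. ?g (Suc i) (Suc j))"
    by (rule fun_det_first_row) simp
  also have "\<dots> = (\<Prod>i<n. y (Suc i) - y 0) * fun_det n (\<lambda>i j. \<Prod>k<j. y (Suc i) - c k)"
    by (simp add: fun_det_scale_rows)
  also have "\<dots> = (\<Prod>i<n. (y (Suc i) - y 0) * (\<Prod>j<i. y (Suc i) - y (Suc j)))"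
    by (simp add: Suc.IH prod.distrib)
  also have "\<dots> = (\<Prod>i<Suc n. \<Prod>j<i. y i - y j)"
    by (subst prod.lessThan_Suc_shift) (simp add: prod.lessThan_Suc_shift del: prod.lessThan_Suc)
  finally show ?case .
qed


section \<open>Permuted rows and the Cauchy-Binet formula\<close>

lemma fun_det_permute_rows:
  assumes "p permutes {..<n}"
  shows "fun_det n (\<lambda>i j. f (p i) j) = signof p * fun_det n f"
proof -
  have p: "p permutes {0..<n}" using assms by (simp add: atLeast0LessThan)
  have lt: "p i < n" if "i < n" for i
    using permutes_in_image[OF assms, of i] that by simp
  have "mat n n (\<lambda>(i, j). f (p i) j) = mat n n (\<lambda>(i, j). mat n n (\<lambda>(i, j). f i j) $$ (p i, j))"
    by (rule eq_matI) (auto simp: lt)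
  then show ?thesis
    unfolding fun_det_def using det_permute_rows[OF _ p, of "mat n n (\<lambda>(i, j). f i j)"] by simp
qed

lemma fun_det_identical_rows:
  assumes "i < n" "k < n" "i \<noteq> k" "\<And>j. f i j = f k j"
  shows "fun_det n f = 0"
proof -
  let ?A = "mat n n (\<lambda>(i, j). f i j)"
  have "row ?A i = row ?A k" by (rule eq_vecI) (simp_all add: assms)
  then show ?thesis
    unfolding fun_det_def using det_identical_rows[of ?A n i k] assms(1-3) by simp
qed

text \<open>An injective choice of \<open>n\<close> elements from a set of size \<open>n\<close> is
  a fixed enumeration composed with a permutation. The \<open>restrict\<close> is there because the
  members of \<open>PiE\<close> are extensional.\<close>

lemma bij_betw_permutations_PiE:
  fixes n :: nat
  assumes e: "bij_betw e {..<n} S"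
  shows "bij_betw (\<lambda>p. restrict (\<lambda>i. e (p i)) {..<n}) {p. p permutes {..<n}}
    {g \<in> PiE {..<n} (\<lambda>_. S). inj_on g {..<n}}"
  unfolding bij_betw_def
proof (intro conjI)
  note inj_e = bij_betw_imp_inj_on[OF e]
  have mem: "p i < n" if "p permutes {..<n}" "i < n" for p i
    using permutes_in_image[OF that(1), of i] that(2) by simp
  show "inj_on (\<lambda>p. restrict (\<lambda>i. e (p i)) {..<n}) {p. p permutes {..<n}}"
  proof (rule inj_onI)
    fix p q assume pq: "p \<in> {p. p permutes {..<n}}" "q \<in> {p. p permutes {..<n}}"
      and eq: "restrict (\<lambda>i. e (p i)) {..<n} = restrict (\<lambda>i. e (q i)) {..<n}"
    show "p = q"
    proof
      fix i
      show "p i = q i"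
      proof (cases "i < n")
        case True
        then have "e (p i) = e (q i)" using fun_cong[OF eq, of i] by simp
        then show ?thesis using inj_onD[OF inj_e] mem pq True by auto
      next
        case False
        then show ?thesis using pq by (auto simp: permutes_def)
      qed
    qed
  qed
  show "(\<lambda>p. restrict (\<lambda>i. e (p i)) {..<n}) ` {p. p permutes {..<n}}
      = {g \<in> PiE {..<n} (\<lambda>_. S). inj_on g {..<n}}" (is "?L = ?R")
  proof
    show "?L \<subseteq> ?R"
    proof
      fix g assume "g \<in> ?L"
      then obtain p where p: "p permutes {..<n}" and g: "g = restrict (\<lambda>i. e (p i)) {..<n}" by auto
      have "inj_on (\<lambda>i. e (p i)) {..<n}"
      proof (rule inj_onI)
        fix i j assume ij: "i \<in> {..<n}" "j \<in> {..<n}" "e (p i) = e (p j)"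
        then have "p i = p j" using inj_onD[OF inj_e] mem[OF p] by auto
        then show "i = j" using permutes_inj[OF p] by (auto dest: injD)
      qed
      moreover have "e (p i) \<in> S" if "i < n" for i
        using bij_betwE[OF e] mem[OF p that] by auto
      ultimately show "g \<in> ?R" by (auto simp: g inj_on_def)
    qed
    show "?R \<subseteq> ?L"
    proof
      fix g assume g: "g \<in> ?R"
      define h where "h = the_inv_into {..<n} e"
      define p where "p = (\<lambda>i. if i < n then h (g i) else i)"
      have gS: "g i \<in> S" if "i < n" for i using g that by auto
      have h: "h s < n" "e (h s) = s" if "s \<in> S" for s
        using that bij_betw_the_inv_into[OF e] f_the_inv_into_f_bij_betw[OF e]
        by (auto simp: h_def dest: bij_betwE)
      have "inj_on p {..<n}"
      proof (rule inj_onI)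
        fix i j assume ij: "i \<in> {..<n}" "j \<in> {..<n}" "p i = p j"
        then have "e (h (g i)) = e (h (g j))" by (simp add: p_def)
        then have "g i = g j" using h(2) gS ij by simp
        then show "i = j" using g ij by (auto dest: inj_onD)
      qed
      moreover have "p ` {..<n} \<subseteq> {..<n}" using h(1) gS by (auto simp: p_def)
      ultimately have "bij_betw p {..<n} {..<n}"
        unfolding bij_betw_def by (intro conjI endo_inj_surj finite_lessThan)
      then have p: "p permutes {..<n}"
        by (rule bij_imp_permutes) (simp add: p_def)
      have "g = restrict (\<lambda>i. e (p i)) {..<n}"
      proof
        fix i show "g i = restrict (\<lambda>i. e (p i)) {..<n} i"
          using g by (cases "i < n") (simp_all add: p_def h(2) gS PiE_def extensional_def)
      qed
      then show "g \<in> ?L" using p by auto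
    qed
  qed
qed

text \<open>Expanding the rows gives a sum over all maps from the rows into \<open>G\<close>. Maps
  with a repeated value produce equal rows and drop out; the others are grouped by their image
  \<open>S\<close>. Within a group, sorting the rows produces the signs of the Leibniz sum of the
  first minor.\<close>

theorem Cauchy_Binet:
  fixes f h :: "nat \<Rightarrow> nat \<Rightarrow> real"
  assumes fin: "finite G"
  shows "fun_det n (\<lambda>i j. \<Sum>s\<in>G. f i s * h j s)
    = (\<Sum>S | S \<subseteq> G \<and> card S = n. fun_det n (\<lambda>i j. f j (enumerate S i)) * fun_det n (\<lambda>i j. h j (enumerate S i)))"
proof -
  let ?P = "PiE {..<n} (\<lambda>_. G)"
  let ?I = "{g \<in> ?P. inj_on g {..<n}}"
  let ?T = "{S. S \<subseteq> G \<and> card S = n}"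
  define \<Phi> where "\<Phi> = (\<lambda>g. (\<Prod>i<n. f i (g i)) * fun_det n (\<lambda>i j. h j (g i)))"
  have finP: "finite ?P" using fin by (simp add: finite_PiE)
  have finT: "finite ?T" using fin by (rule_tac finite_subset[of _ "Pow G"]) auto
  have "fun_det n (\<lambda>i j. \<Sum>s\<in>G. f i s * h j s) = (\<Sum>g\<in>?P. \<Phi> g)"
    unfolding \<Phi>_def by (subst fun_det_sum_rows) (simp_all add: fin fun_det_scale_rows)
  also have "\<dots> = (\<Sum>g\<in>?I. \<Phi> g)"
  proof (rule sum.mono_neutral_right[OF finP])
    show "\<forall>g\<in>?P - ?I. \<Phi> g = 0"
    proof
      fix g assume "g \<in> ?P - ?I"
      then obtain i k where "i < n" "k < n" "i \<noteq> k" "g i = g k" by (auto simp: inj_on_def)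
      then have "fun_det n (\<lambda>i j. h j (g i)) = 0" by (intro fun_det_identical_rows[of i n k]) simp_all
      then show "\<Phi> g = 0" unfolding \<Phi>_def by simp
    qed
  qed auto
  also have "\<dots> = (\<Sum>S\<in>?T. \<Sum>g | g \<in> ?I \<and> g ` {..<n} = S. \<Phi> g)"
  proof (rule sum.group[symmetric])
    show "finite ?I" using finP by simp
    show "finite ?T" by (rule finT)
    show "(\<lambda>g. g ` {..<n}) ` ?I \<subseteq> ?T"
    proof
      fix S assume "S \<in> (\<lambda>g. g ` {..<n}) ` ?I"
      then obtain g where g: "g \<in> ?P" "inj_on g {..<n}" "S = g ` {..<n}" by blast
      then show "S \<in> ?T" using card_image[OF g(2)] by auto
    qed
  qed
  also have "\<dots> = (\<Sum>S\<in>?T. fun_det n (\<lambda>i j. f j (enumerate S i)) * fun_det n (\<lambda>i j. h j (enumerate S i)))"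
  proof (rule sum.cong)
    fix S assume S: "S \<in> ?T"
    let ?e = "enumerate S"
    have finS: "finite S" using S fin finite_subset by auto
    have e: "bij_betw ?e {..<n} S" using finite_bij_enumerate[OF finS] S by simp
    have "{g. g \<in> ?I \<and> g ` {..<n} = S} = {g \<in> PiE {..<n} (\<lambda>_. S). inj_on g {..<n}}" (is "?A = ?B")
    proof
      show "?A \<subseteq> ?B" by (auto simp: PiE_def Pi_def)
      show "?B \<subseteq> ?A"
      proof
        fix g assume g: "g \<in> ?B"
        then have "g ` {..<n} \<subseteq> S" "card (g ` {..<n}) = card S"
          using S by (auto simp: card_image)
        then have "g ` {..<n} = S" using card_subset_eq[OF finS] by blast
        moreover have "g \<in> ?P" using g S by (auto simp: PiE_def Pi_def)
        ultimately show "g \<in> ?A" using g by auto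
      qed
    qed
    then have "(\<Sum>g | g \<in> ?I \<and> g ` {..<n} = S. \<Phi> g)
        = (\<Sum>p | p permutes {..<n}. \<Phi> (restrict (\<lambda>i. ?e (p i)) {..<n}))"
      using sum.reindex_bij_betw[OF bij_betw_permutations_PiE[OF e], of \<Phi>] by simp
    also have "\<dots> = (\<Sum>p | p permutes {..<n}.
        (signof p * (\<Prod>i<n. f i (?e (p i)))) * fun_det n (\<lambda>i j. h j (?e i)))"
    proof (rule sum.cong)
      fix p assume "p \<in> {p. p permutes {..<n}}"
      then have p: "p permutes {..<n}" by simp
      have "fun_det n (\<lambda>i j. h j (restrict (\<lambda>i. ?e (p i)) {..<n} i)) = fun_det n (\<lambda>i j. h j (?e (p i)))"
        by (rule fun_det_cong) simp
      also have "\<dots> = signof p * fun_det n (\<lambda>i j. h j (?e i))"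
        using fun_det_permute_rows[OF p, of "\<lambda>i j. h j (?e i)"] by simp
      finally show "\<Phi> (restrict (\<lambda>i. ?e (p i)) {..<n})
          = (signof p * (\<Prod>i<n. f i (?e (p i)))) * fun_det n (\<lambda>i j. h j (?e i))"
        unfolding \<Phi>_def by simp
    qed simp
    also have "\<dots> = fun_det n (\<lambda>i j. f i (?e j)) * fun_det n (\<lambda>i j. h j (?e i))"
      by (simp add: fun_det_Leibniz[of n "\<lambda>i j. f i (?e j)"] sum_distrib_right atLeast0LessThan)
    also have "fun_det n (\<lambda>i j. f i (?e j)) = fun_det n (\<lambda>i j. f j (?e i))"
      by (rule fun_det_transpose[symmetric])
    finally show "(\<Sum>g | g \<in> ?I \<and> g ` {..<n} = S. \<Phi> g)
        = fun_det n (\<lambda>i j. f j (?e i)) * fun_det n (\<lambda>i j. h j (?e i))" .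
  qed simp
  finally show ?thesis .
qed


section \<open>A discrete Selberg sum on a quadratic lattice\<close>


text \<open>A dent over the segment from \<open>s\<close> to \<open>s + 1\<close> has its middle at
  \<open>s + 1/2\<close>; the square identifies it with its mirror image in the line
  \<open>u = 0\<close>.\<close>

definition sqc :: "nat \<Rightarrow> real" where
  "sqc s = (real s + 1 / 2)\<^sup>2"

lemma sqc_diff: "sqc s - sqc t = (real s - real t) * (real s + real t + 1)"
  by (simp add: sqc_def power2_eq_square algebra_simps)

text \<open>The factor contributed by a vertical lozenge at position \<open>s\<close> of a gap of
  length \<open>N\<close> with \<open>a\<close> occupied positions on its left and \<open>c\<close>
  on its right. \<open>sqc s\<close> consists of two factors \<open>s + 1/2\<close>, one from either
  side of the cut; the differences are oriented so as to be positive on the gap.\<close>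

definition gap_weight :: "nat \<Rightarrow> nat \<Rightarrow> nat \<Rightarrow> nat \<Rightarrow> real" where
  "gap_weight a N c s = sqc s * (\<Prod>t\<in>{..<a}. sqc s - sqc t)
     * (\<Prod>t\<in>{a + N..<a + N + c}. sqc t - sqc s)"

text \<open>Each difference splits as \<open>(s - t) * (s + t + 1)\<close>, and for
  \<open>t < a\<close> the two families of factors join to the run of integers from
  \<open>s - a + 1\<close> to \<open>s + a\<close>.\<close>

lemma prod_sqc_diff: "(\<Prod>t\<in>{..<a}. sqc s - sqc t) = pochhammer (real s - real a + 1) (2 * a)"
proof (induction a)
  case (Suc a)
  have "pochhammer (real s - real (Suc a) + 1) (2 * Suc a)
      = (real s - real a) * pochhammer (real s - real a + 1) (2 * a) * (real s + real a + 1)"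
    using pochhammer_rec[of "real s - real a" "Suc (2 * a)"]
      pochhammer_Suc[of "real s - real a + 1" "2 * a"]
    by (simp add: algebra_simps)
  then show ?case using Suc by (simp add: sqc_diff algebra_simps)
qed simp

text \<open>With no occupied position on the right the summand does not change with
  \<open>N\<close>, so it is enough that the right side, as a function of \<open>N\<close>, has the
  last summand as its difference.\<close>

lemma sum_gap_weight_0:
  "(\<Sum>s\<in>{a..<a + N}. gap_weight a N 0 s)
     = ((real a + real N)\<^sup>2 - 1 / 4) * pochhammer (real N) (2 * a + 1) / (2 * real a + 3)"
proof (induction N)
  case 0
  then show ?case by (simp add: pochhammer_0_left)
next
  case (Suc N)
  let ?P = "pochhammer (real N + 1) (2 * a)"
  have "(\<Sum>s\<in>{a..<a + Suc N}. gap_weight a (Suc N) 0 s)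
      = (\<Sum>s\<in>{a..<a + N}. gap_weight a N 0 s) + sqc (a + N) * ?P"
    by (simp add: gap_weight_def prod_sqc_diff)
  also have "\<dots> = ((real a + real N)\<^sup>2 - 1 / 4) * (real N * ?P) / (2 * real a + 3) + sqc (a + N) * ?P"
    by (simp add: Suc pochhammer_rec)
  also have "\<dots> = (((real a + real N)\<^sup>2 - 1 / 4) * real N / (2 * real a + 3) + sqc (a + N)) * ?P"
    by (simp add: algebra_simps)
  also have "((real a + real N)\<^sup>2 - 1 / 4) * real N / (2 * real a + 3) + sqc (a + N)
      = ((real a + real N + 1)\<^sup>2 - 1 / 4) * (real N + 1 + 2 * real a) / (2 * real a + 3)"
  proof -
    have "((real a + real N)\<^sup>2 - 1 / 4) * real N + sqc (a + N) * (2 * real a + 3)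
        = ((real a + real N + 1)\<^sup>2 - 1 / 4) * (real N + 1 + 2 * real a)"
      by (simp add: sqc_def power2_eq_square field_simps)
    moreover have "u / d + v = w / d" if "u + v * d = w" "d \<noteq> 0" for u v w d :: real
      using that by (simp add: field_simps)
    moreover have "2 * real a + 3 \<noteq> 0" by linarith
    ultimately show ?thesis by blast
  qed
  also have "\<dots> * ?P = ((real a + real (Suc N))\<^sup>2 - 1 / 4) * pochhammer (real (Suc N)) (2 * a + 1)
      / (2 * real a + 3)"
    by (simp add: pochhammer_Suc algebra_simps)
  finally show ?case .
qed

text \<open>A position added on the right is traded for one added on the left: the new right factor
  is \<open>(sqc (a + Suc N + c) - sqc a) - (sqc s - sqc a)\<close>, and
  \<open>sqc s - sqc a\<close> is what occupying the position \<open>a\<close> would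
  contribute.\<close>

lemma sum_gap_weight_Suc:
  "(\<Sum>s\<in>{a..<a + Suc N}. gap_weight a (Suc N) (Suc c) s)
     = (sqc (a + Suc N + c) - sqc a) * (\<Sum>s\<in>{a..<a + Suc N}. gap_weight a (Suc N) c s)
       - (\<Sum>s\<in>{Suc a..<Suc a + N}. gap_weight (Suc a) N c s)"
proof -
  have 1: "gap_weight a (Suc N) (Suc c) s
      = (sqc (a + Suc N + c) - sqc s) * gap_weight a (Suc N) c s" for s
    by (simp add: gap_weight_def)
  have 2: "gap_weight (Suc a) N c s = (sqc s - sqc a) * gap_weight a (Suc N) c s" for s
    by (simp add: gap_weight_def)
  \<comment> \<open>The position \<open>s = a\<close> may be included on the right because the
    factor \<open>sqc s - sqc a\<close> vanishes there.\<close>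
  have "(\<Sum>s\<in>{Suc a..<Suc a + N}. gap_weight (Suc a) N c s)
      = (\<Sum>s\<in>{a..<a + Suc N}. (sqc s - sqc a) * gap_weight a (Suc N) c s)"
  proof -
    have "{a..<a + Suc N} = insert a {Suc a..<Suc a + N}" by auto
    then show ?thesis by (simp add: 2)
  qed
  moreover have "(\<Sum>s\<in>{a..<a + Suc N}. gap_weight a (Suc N) (Suc c) s)
      + (\<Sum>s\<in>{a..<a + Suc N}. (sqc s - sqc a) * gap_weight a (Suc N) c s)
      = (\<Sum>s\<in>{a..<a + Suc N}. (sqc (a + Suc N + c) - sqc a) * gap_weight a (Suc N) c s)"
    unfolding sum.distrib[symmetric] 1 by (rule sum.cong) (simp_all add: algebra_simps)
  ultimately show ?thesis by (simp only: sum_distrib_left[symmetric])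
qed

text \<open>A terminating very-well-poised \<open>\<^sub>5F\<^sub>4\<close>.\<close>

lemma sum_gap_weight:
  "(\<Sum>s\<in>{a..<a + N}. gap_weight a N c s)
     = pochhammer (real N) (2 * a + c + 1) * fact c * pochhammer (real a + real N - 1 / 2) (c + 2)
       / (2 * pochhammer (real a + 3 / 2) (c + 1))"
proof (induction c arbitrary: a N)
  case 0
  have "pochhammer (real a + real N - 1 / 2) (0 + 2) = (real a + real N)\<^sup>2 - 1 / 4"
    by (simp add: numeral_2_eq_2 pochhammer_Suc field_simps)
  moreover have "2 * pochhammer (real a + 3 / 2) (0 + 1) = 2 * real a + 3" by simp
  ultimately show ?case by (simp only: sum_gap_weight_0) simp
next
  case (Suc c)
  show ?case
  proof (cases N)
    case 0
    then show ?thesis by (simp add: pochhammer_0_left)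
  next
    case (Suc M)
    \<comment> \<open>Both closed forms in the recursion, the second one for \<open>Suc a\<close>
      and \<open>M\<close>, are written with the common factors \<open>?p\<close>,
      \<open>?P\<close>, \<open>?D\<close>; what remains is a rational identity in \<open>a\<close>,
      \<open>N\<close> and \<open>c\<close>.\<close>
    let ?p = "pochhammer (real N) (2 * a + c + 1)"
    let ?P = "pochhammer (real a + real N - 1 / 2) (c + 2)"
    let ?D = "pochhammer (real a + 3 / 2) (c + 1)"
    let ?x = "real N + 2 * real a + real c + 1"
    let ?y = "real a + real c + 5 / 2"
    have D: "?D > 0" by (rule pochhammer_pos) simp
    have p1: "pochhammer (real N) (2 * a + Suc c + 1) = ?p * ?x"
      by (simp add: pochhammer_Suc algebra_simps)
    have p2: "pochhammer (real M) (2 * Suc a + c + 1) = real M * (?p * ?x)"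
      using pochhammer_rec[of "real M" "2 * a + c + 2"] p1 Suc by (simp add: algebra_simps)
    have P1: "pochhammer (real a + real N - 1 / 2) (Suc c + 2) = ?P * (real a + real N + real c + 3 / 2)"
      using pochhammer_Suc[of "real a + real N - 1 / 2" "c + 2"] by (simp add: algebra_simps)
    have P2: "pochhammer (real (Suc a) + real M - 1 / 2) (c + 2) = ?P"
      using Suc by (simp add: algebra_simps)
    have D1: "pochhammer (real a + 3 / 2) (Suc c + 1) = ?D * ?y"
      using pochhammer_Suc[of "real a + 3 / 2" "c + 1"] by (simp add: algebra_simps)
    have D2: "pochhammer (real (Suc a) + 3 / 2) (c + 1) = ?D * ?y / (real a + 3 / 2)"
      using pochhammer_rec[of "real a + 3 / 2" "c + 1"] D1 by (simp add: field_simps)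
    have a: "real a + 3 / 2 \<noteq> 0" by linarith
    have "(\<Sum>s\<in>{a..<a + N}. gap_weight a N (Suc c) s)
        = (sqc (a + N + c) - sqc a) * (?p * fact c * ?P / (2 * ?D))
          - real M * (?p * ?x) * fact c * ?P / (2 * (?D * ?y / (real a + 3 / 2)))"
      using sum_gap_weight_Suc[of a M c] Suc.IH[of a N] Suc.IH[of "Suc a" M] p2 P2 D2
      unfolding Suc by simp
    also have "\<dots> = ?p * fact c * ?P / (2 * ?D)
        * ((sqc (a + N + c) - sqc a) - real M * ?x * (real a + 3 / 2) / ?y)"
    proof -
      have "d * (p * f * P / (2 * D)) - m * (p * x) * f * P / (2 * (D * y / h))
          = p * f * P / (2 * D) * (d - m * x * h / y)"
        if "D \<noteq> 0" "y \<noteq> 0" "h \<noteq> 0" for d p f P D m x y h :: real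
        using that by (simp add: field_simps)
      moreover have "?y \<noteq> 0" by linarith
      ultimately show ?thesis using D a by simp
    qed
    also have "(sqc (a + N + c) - sqc a) - real M * ?x * (real a + 3 / 2) / ?y
        = ?x * (real c + 1) * (real a + real N + real c + 3 / 2) / ?y"
    proof -
      have "?y \<noteq> 0" by linarith
      have M: "real M = real N - 1" using Suc by simp
      have "((sqc (a + N + c) - sqc a) * ?y - real M * ?x * (real a + 3 / 2))
        = ?x * (real c + 1) * (real a + real N + real c + 3 / 2)"
        unfolding sqc_diff M by (simp add: algebra_simps)
      then show ?thesis using \<open>?y \<noteq> 0\<close> by (simp add: field_simps)
    qed
    also have "?p * fact c * ?P / (2 * ?D) * \<dots>
        = ?p * ?x * fact (Suc c) * (?P * (real a + real N + real c + 3 / 2)) / (2 * (?D * ?y))"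
    proof -
      have "p * f * P / (2 * D) * (x * r * w / y) = p * x * (r * f) * (P * w) / (2 * (D * y))"
        for p f P D x r w y :: real by (simp add: mult_ac)
      moreover have "fact (Suc c) = (real c + 1) * fact c" by (simp add: add.commute)
      ultimately show ?thesis by metis
    qed
    finally show ?thesis unfolding p1 P1 D1 .
  qed
qed


section \<open>Hankel determinants of Pochhammer ratios\<close>

fun hankel_const :: "nat \<Rightarrow> real \<Rightarrow> real" where
  "hankel_const 0 \<beta> = 1"
| "hankel_const (Suc n) \<beta> =
     (\<Prod>i<n. real (Suc i) / (\<beta> + real i)) * (1 / (\<beta> * (\<beta> + 1))) ^ n * hankel_const n (\<beta> + 2)"

text \<open>The combination of two consecutive rows that clears the first column: \<open>(\<alpha> +
  i + j) * (\<beta> + i) - (\<alpha> + i) * (\<beta> + i + j)\<close> collapses to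
  \<open>j * (\<beta> - \<alpha>)\<close>, which is 0 for \<open>j = 0\<close>.\<close>

lemma pochhammer_step:
  fixes \<alpha> \<beta> :: real
  assumes "\<beta> > 0"
  shows "pochhammer \<alpha> (Suc (i + j)) / pochhammer \<beta> (Suc (i + j))
      - (\<alpha> + real i) / (\<beta> + real i) * (pochhammer \<alpha> (i + j) / pochhammer \<beta> (i + j))
     = pochhammer \<alpha> (i + j) / pochhammer \<beta> (i + j)
       * (real j * (\<beta> - \<alpha>) / ((\<beta> + real (i + j)) * (\<beta> + real i)))"
proof -
  have pos: "\<beta> + real (i + j) > 0" "\<beta> + real i > 0" "pochhammer \<beta> (i + j) > 0"
    using assms pochhammer_pos by auto
  have "p * x / (q * y) - z / w * (p / q) = p / q * ((x * w - z * y) / (y * w))"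
    if "q > 0" "y > 0" "w > 0" for p q x y z w :: real
    using that by (simp add: field_simps)
  note this[OF pos(3,1,2)]
  moreover have "(\<alpha> + real (i + j)) * (\<beta> + real i) - (\<alpha> + real i) * (\<beta> + real (i + j)) = real j * (\<beta> - \<alpha>)"
    by (simp add: algebra_simps)
  ultimately show ?thesis by (simp add: pochhammer_Suc)
qed

text \<open>Clearing the first column leaves row and column factors times a determinant of the same
  kind with \<open>\<alpha> + 1\<close> and \<open>\<beta> + 2\<close>, so that
  \<open>\<beta> - \<alpha>\<close> also grows by one. What depends on \<open>\<beta>\<close> alone
  goes into \<open>hankel_const\<close>; it can stay recursive because in the application the length
  of the gap enters only through \<open>\<alpha>\<close>.\<close>

lemma fun_det_pochhammer_ratio:
  assumes "\<beta> > 0"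
  shows "fun_det n (\<lambda>i j. pochhammer \<alpha> (i + j) / pochhammer \<beta> (i + j))
    = hankel_const n \<beta> * (\<Prod>i<n. pochhammer \<alpha> i * pochhammer (\<beta> - \<alpha>) i)"
  using assms
proof (induction n arbitrary: \<alpha> \<beta>)
  case 0
  then show ?case by simp
next
  case (Suc n)
  let ?h = "\<lambda>k. pochhammer \<alpha> k / pochhammer \<beta> k"
  let ?c = "\<lambda>i. - ((\<alpha> + real (i - 1)) / (\<beta> + real (i - 1)))"
  let ?g = "\<lambda>i j. if i = 0 then ?h j else ?h (i + j) + ?c i * ?h (i - 1 + j)"
  let ?u = "\<lambda>i. (\<beta> - \<alpha>) / (\<beta> + real i)"
  have "fun_det (Suc n) (\<lambda>i j. ?h (i + j)) = fun_det (Suc n) ?g"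
    using fun_det_add_previous_rows[of "Suc n" "\<lambda>i j. ?h (i + j)" ?c, symmetric]
    by (simp only: add_0)
  also have "\<dots> = ?g 0 0 * fun_det n (\<lambda>i j. ?g (Suc i) (Suc j))"
  proof (rule fun_det_first_col)
    fix i :: nat assume "0 < i"
    then obtain i' where "i = Suc i'" by (cases i) auto
    then show "?g i 0 = 0"
      using pochhammer_step[OF Suc.prems, of \<alpha> i' 0] by simp
  qed
  also have "\<dots> = fun_det n (\<lambda>i j. ?u i * real (Suc j)
      * (\<alpha> / (\<beta> * (\<beta> + 1)) * (pochhammer (\<alpha> + 1) (i + j) / pochhammer (\<beta> + 2) (i + j))))"
  proof -
    have "?g (Suc i) (Suc j) = ?u i * real (Suc j)
      * (\<alpha> / (\<beta> * (\<beta> + 1)) * (pochhammer (\<alpha> + 1) (i + j) / pochhammer (\<beta> + 2) (i + j)))" for i j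
    proof -
      have "?g (Suc i) (Suc j) = ?h (Suc (i + j))
          * (real (Suc j) * (\<beta> - \<alpha>) / ((\<beta> + real (Suc (i + j))) * (\<beta> + real i)))"
        using pochhammer_step[OF Suc.prems, of \<alpha> i "Suc j"] by simp
      also have "\<dots> = pochhammer \<alpha> (Suc (i + j)) / (pochhammer \<beta> (Suc (i + j)) * (\<beta> + real (Suc (i + j))))
          * (real (Suc j) * ?u i)" by simp
      \<comment> \<open>Splitting off the two lowest factors instead of the highest one produces the
        parameter \<open>\<beta> + 2\<close>.\<close>
      also have "pochhammer \<beta> (Suc (i + j)) * (\<beta> + real (Suc (i + j))) = \<beta> * (\<beta> + 1) * pochhammer (\<beta> + 2) (i + j)"
        using pochhammer_rec[of \<beta> "Suc (i + j)"] pochhammer_rec[of "\<beta> + 1" "i + j"]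
          pochhammer_Suc[of \<beta> "Suc (i + j)"] by (simp add: add.assoc)
      also have "pochhammer \<alpha> (Suc (i + j)) = \<alpha> * pochhammer (\<alpha> + 1) (i + j)" by (rule pochhammer_rec)
      finally show ?thesis by (simp add: mult_ac)
    qed
    then show ?thesis by simp
  qed
  also have "\<dots> = (\<Prod>i<n. ?u i) * (\<Prod>j<n. real (Suc j)) * ((\<alpha> / (\<beta> * (\<beta> + 1))) ^ n
      * fun_det n (\<lambda>i j. pochhammer (\<alpha> + 1) (i + j) / pochhammer (\<beta> + 2) (i + j)))"
    by (simp only: fun_det_scale fun_det_const)
  also have "fun_det n (\<lambda>i j. pochhammer (\<alpha> + 1) (i + j) / pochhammer (\<beta> + 2) (i + j))
      = hankel_const n (\<beta> + 2) * (\<Prod>i<n. pochhammer (\<alpha> + 1) i * pochhammer (\<beta> - \<alpha> + 1) i)"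
    using Suc.IH[of "\<beta> + 2" "\<alpha> + 1"] Suc.prems by (simp add: algebra_simps)
  also have "(\<Prod>i<n. ?u i) * (\<Prod>j<n. real (Suc j)) * ((\<alpha> / (\<beta> * (\<beta> + 1))) ^ n
      * (hankel_const n (\<beta> + 2) * (\<Prod>i<n. pochhammer (\<alpha> + 1) i * pochhammer (\<beta> - \<alpha> + 1) i)))
      = hankel_const (Suc n) \<beta> * (\<Prod>i<n. (\<alpha> * pochhammer (\<alpha> + 1) i) * ((\<beta> - \<alpha>) * pochhammer (\<beta> - \<alpha> + 1) i))"
    by (simp add: prod.distrib prod_dividef power_divide power_mult_distrib)
  also have "(\<Prod>i<n. (\<alpha> * pochhammer (\<alpha> + 1) i) * ((\<beta> - \<alpha>) * pochhammer (\<beta> - \<alpha> + 1) i))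
      = (\<Prod>i<Suc n. pochhammer \<alpha> i * pochhammer (\<beta> - \<alpha>) i)"
    by (subst prod.lessThan_Suc_shift) (simp add: pochhammer_rec)
  finally show ?case .
qed

section \<open>The Vandermonde product and the sum over subsets of the gap\<close>

definition vdm :: "nat set \<Rightarrow> real" where
  "vdm S = (\<Prod>s\<in>S. \<Prod>t | t \<in> S \<and> t < s. sqc s - sqc t)"

lemma vdm_image:
  fixes e :: "nat \<Rightarrow> nat"
  assumes "strict_mono_on {..<n} e"
  shows "vdm (e ` {..<n}) = (\<Prod>i<n. \<Prod>j<i. sqc (e i) - sqc (e j))"
proof -
  have inj: "inj_on e {..<n}" using assms by (rule strict_mono_on_imp_inj_on)
  have "(\<Prod>t | t \<in> e ` {..<n} \<and> t < e i. sqc (e i) - sqc t) = (\<Prod>j<i. sqc (e i) - sqc (e j))"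
    if i: "i < n" for i
  proof -
    have "{t. t \<in> e ` {..<n} \<and> t < e i} = e ` {..<i}"
    proof safe
      fix j assume "j < n" "e j < e i"
      then show "e j \<in> e ` {..<i}"
        using strict_mono_on_leD[OF assms, of i j] i by (cases "j < i") auto
    next
      fix j assume "j < i"
      then show "e j \<in> e ` {..<n}" "e j < e i"
        using i strict_mono_onD[OF assms, of j i] by auto
    qed
    moreover have "inj_on e {..<i}" using inj by (rule inj_on_subset) (use i in auto)
    ultimately show ?thesis by (simp add: prod.reindex)
  qed
  then show ?thesis unfolding vdm_def by (simp add: prod.reindex[OF inj])
qed

definition selberg_sum :: "nat \<Rightarrow> nat \<Rightarrow> nat \<Rightarrow> nat \<Rightarrow> real" where
  "selberg_sum n a N c =
     (\<Sum>S | S \<subseteq> {a..<a + N} \<and> card S = n. (\<Prod>s\<in>S. gap_weight a N c s) * (vdm S)\<^sup>2)"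

text \<open>The two Vandermonde factors are written as Newton determinants with different nodes, one
  starting at the left end \<open>a\<close> of the gap and one at \<open>a + N + c\<close>, just
  beyond the right block. Multiplied into the weight they lengthen the two occupied blocks by
  \<open>i\<close> and \<open>j\<close>, so each entry is again a sum of gap weights.\<close>

lemma selberg_sum_eq_det:
  assumes "n \<le> N"
  shows "selberg_sum n a N c = fun_det n (\<lambda>i j. (- 1) ^ j *
    (\<Sum>s\<in>{a + i..<a + i + (N - i)}. gap_weight (a + i) (N - i) (c + j) s))"
proof -
  let ?G = "{a..<a + N}"
  let ?f = "\<lambda>i s. gap_weight a N c s * (\<Prod>k<i. sqc s - sqc (a + k))"
  let ?h = "\<lambda>j s. \<Prod>k<j. sqc s - sqc (a + N + c + k)"
  have "selberg_sum n a N c = fun_det n (\<lambda>i j. \<Sum>s\<in>?G. ?f i s * ?h j s)"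
    unfolding selberg_sum_def Cauchy_Binet[OF finite_atLeastLessThan]
  proof (rule sum.cong)
    fix S assume S: "S \<in> {S. S \<subseteq> ?G \<and> card S = n}"
    let ?e = "enumerate S"
    have finS: "finite S" using S finite_subset by auto
    have e: "bij_betw ?e {..<n} S" using finite_bij_enumerate[OF finS] S by simp
    have mono: "strict_mono_on {..<n} ?e"
      using finS S by (auto simp: strict_mono_on_def finite_enumerate_mono)
    have "fun_det n (\<lambda>i j. ?f j (?e i)) = (\<Prod>s\<in>S. gap_weight a N c s) * vdm S"
      using vdm_image[OF mono] prod.reindex_bij_betw[OF e, of "gap_weight a N c"] e
        fun_det_Newton[of n "\<lambda>i. sqc (?e i)" "\<lambda>k. sqc (a + k)"]
      by (simp add: fun_det_scale_rows bij_betw_imp_surj_on)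
    moreover have "fun_det n (\<lambda>i j. ?h j (?e i)) = vdm S"
      using vdm_image[OF mono] e fun_det_Newton[of n "\<lambda>i. sqc (?e i)" "\<lambda>k. sqc (a + N + c + k)"]
      by (simp add: bij_betw_imp_surj_on)
    ultimately show "(\<Prod>s\<in>S. gap_weight a N c s) * (vdm S)\<^sup>2
        = fun_det n (\<lambda>i j. ?f j (?e i)) * fun_det n (\<lambda>i j. ?h j (?e i))"
      by (simp add: power2_eq_square)
  qed simp
  also have "\<dots> = fun_det n (\<lambda>i j. (- 1) ^ j *
    (\<Sum>s\<in>{a + i..<a + i + (N - i)}. gap_weight (a + i) (N - i) (c + j) s))"
  proof (rule fun_det_cong)
    fix i j assume "i < n" "j < n"
    with assms have i: "i \<le> N" by simp
    have lower: "(\<Prod>t\<in>{..<a}. x - sqc t) * (\<Prod>k<i. x - sqc (a + k)) = (\<Prod>t\<in>{..<a + i}. x - sqc t)" for x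
      by (induction i) (simp_all add: mult.assoc[symmetric])
    \<comment> \<open>The Newton factors have the opposite orientation to the right factors of the
      weight, whence the sign.\<close>
    have upper: "(\<Prod>t\<in>{a + N..<a + N + c}. sqc t - x) * (\<Prod>k<j. x - sqc (a + N + c + k))
        = (- 1) ^ j * (\<Prod>t\<in>{a + N..<a + N + (c + j)}. sqc t - x)" for x
      by (induction j) (simp_all add: algebra_simps)
    have fh: "?f i s * ?h j s = (- 1) ^ j * gap_weight (a + i) (N - i) (c + j) s" for s
      using lower[of "sqc s"] upper[of "sqc s"] i unfolding gap_weight_def
      by (simp add: mult_ac) 
    have "(\<Sum>s\<in>?G. ?f i s * ?h j s) = (\<Sum>s\<in>?G. (- 1) ^ j * gap_weight (a + i) (N - i) (c + j) s)"
      by (simp only: fh)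
    also have "\<dots> = (\<Sum>s\<in>{a + i..<a + i + (N - i)}. (- 1) ^ j * gap_weight (a + i) (N - i) (c + j) s)"
    \<comment> \<open>The first \<open>i\<close> positions of the gap are zeros of the left Newton
      factor.\<close>
    proof (rule sum.mono_neutral_right)
      show "\<forall>s\<in>?G - {a + i..<a + i + (N - i)}. (- 1) ^ j * gap_weight (a + i) (N - i) (c + j) s = 0"
        using i by (auto simp: gap_weight_def)
    qed (use i in auto)
    finally show "(\<Sum>s\<in>?G. ?f i s * ?h j s)
        = (- 1) ^ j * (\<Sum>s\<in>{a + i..<a + i + (N - i)}. gap_weight (a + i) (N - i) (c + j) s)"
      by (simp add: sum_distrib_left)
  qed
  finally show ?thesis .
qed

text \<open>Everything in the evaluation that is independent of \<open>N\<close>; it cancels when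
  two gap lengths are compared.\<close>

definition selberg_const :: "nat \<Rightarrow> nat \<Rightarrow> nat \<Rightarrow> real" where
  "selberg_const n a c = hankel_const n (real a + real c + 5 / 2)
     * (\<Prod>i<n. pochhammer (real a + 3 / 2) i * fact (c + i) / (2 * pochhammer (real a + 3 / 2) (c + 1)))"

text \<open>In the closed form of the entries, the dependence on \<open>i + j\<close> is a quotient
  of Pochhammer symbols and gives the Hankel determinant above; the remaining factors depend on the
  row or on the column only and are taken out as \<open>?u\<close> and \<open>?v\<close>.\<close>

lemma selberg_sum_eq:
  assumes "n \<le> N"
  shows "selberg_sum n a N c = selberg_const n a c *
    (\<Prod>i<n. pochhammer (real N - real i) (2 * a + c + 1 + 2 * i)
         * pochhammer (real a + real N - 1 / 2 - real i) (c + 2 + 2 * i))"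
proof -
  let ?\<alpha> = "real N + real (2 * a + c + 1)" and ?\<beta> = "real a + real c + 5 / 2"
  let ?N = "pochhammer (real N) (2 * a + c + 1)" and ?P = "pochhammer (real a + real N - 1 / 2) (c + 2)"
  let ?D = "pochhammer (real a + 3 / 2) (c + 1)"
  let ?u = "\<lambda>i. pochhammer (real N - real i) i * pochhammer (real a + 3 / 2) i"
  let ?v = "\<lambda>j. (- 1) ^ j * fact (c + j) * pochhammer (real a + real N + real c + 3 / 2) j"
  have D: "pochhammer (real a + 3 / 2) k > 0" for k by (rule pochhammer_pos) simp
  have "selberg_sum n a N c = fun_det n (\<lambda>i j. ?u i * ?v j
      * (?N * ?P / (2 * ?D) * (pochhammer ?\<alpha> (i + j) / pochhammer ?\<beta> (i + j))))"
    unfolding selberg_sum_eq_det[OF assms]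
  proof (rule fun_det_cong)
    fix i j assume "i < n" "j < n"
    with assms have i: "i \<le> N" by simp
    have 1: "pochhammer (real (N - i)) (2 * (a + i) + (c + j) + 1)
        = pochhammer (real N - real i) i * (?N * pochhammer ?\<alpha> (i + j))"
      using pochhammer_product'[of "real N - real i" i "(2 * a + c + 1) + (i + j)"]
        pochhammer_product'[of "real N" "2 * a + c + 1" "i + j"] i
      by (simp add: of_nat_diff algebra_simps)
    have 2: "pochhammer (real (a + i) + real (N - i) - 1 / 2) (c + j + 2)
        = ?P * pochhammer (real a + real N + real c + 3 / 2) j"
      using pochhammer_product'[of "real a + real N - 1 / 2" "c + 2" j] i
      by (simp add: of_nat_diff algebra_simps)
    have 3: "pochhammer (real (a + i) + 3 / 2) (c + j + 1)
        = ?D * pochhammer ?\<beta> (i + j) / pochhammer (real a + 3 / 2) i"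
      using pochhammer_product'[of "real a + 3 / 2" i "c + j + 1"] D[of i]
        pochhammer_product'[of "real a + 3 / 2" "c + 1" "i + j"]
      by (simp add: field_simps)
    show "(- 1) ^ j * (\<Sum>s\<in>{a + i..<a + i + (N - i)}. gap_weight (a + i) (N - i) (c + j) s)
      = ?u i * ?v j * (?N * ?P / (2 * ?D) * (pochhammer ?\<alpha> (i + j) / pochhammer ?\<beta> (i + j)))"
      unfolding sum_gap_weight 1 2 3 by (simp add: mult_ac)
  qed
  also have "\<dots> = (\<Prod>i<n. ?u i) * (\<Prod>j<n. ?v j) * ((?N * ?P / (2 * ?D)) ^ n
      * (hankel_const n ?\<beta> * (\<Prod>i<n. pochhammer ?\<alpha> i * pochhammer (?\<beta> - ?\<alpha>) i)))"
  proof -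
    have "?\<beta> > 0" by linarith
    note * = fun_det_pochhammer_ratio[OF this]
    show ?thesis unfolding fun_det_scale fun_det_const * ..
  qed
  also have "\<dots> = hankel_const n ?\<beta> * (\<Prod>i<n. ?u i * ?v i * (?N * ?P / (2 * ?D))
      * (pochhammer ?\<alpha> i * pochhammer (?\<beta> - ?\<alpha>) i))"
    by (simp only: prod.distrib prod_constant card_lessThan mult_ac)
  also have "(\<Prod>i<n. ?u i * ?v i * (?N * ?P / (2 * ?D)) * (pochhammer ?\<alpha> i * pochhammer (?\<beta> - ?\<alpha>) i))
     = (\<Prod>i<n. (pochhammer (real a + 3 / 2) i * fact (c + i) / (2 * ?D))
         * (pochhammer (real N - real i) (2 * a + c + 1 + 2 * i)
         * pochhammer (real a + real N - 1 / 2 - real i) (c + 2 + 2 * i)))"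
  proof (rule prod.cong)
    fix i
    have 1: "pochhammer (real N - real i) i * ?N * pochhammer ?\<alpha> i
        = pochhammer (real N - real i) (2 * a + c + 1 + 2 * i)"
      using pochhammer_product'[of "real N - real i" i "(2 * a + c + 1) + i"]
        pochhammer_product'[of "real N" "2 * a + c + 1" i]
      by (simp add: algebra_simps)
    let ?b = "real a + real N - 3 / 2"
    \<comment> \<open>A Pochhammer symbol with negated base is a reversed run up to the sign
      \<open>(- 1) ^ i\<close>, which cancels the sign of the columns in \<open>?v\<close>. The
      reversed run then continues \<open>?P\<close> downwards.\<close>
    have "?\<beta> - ?\<alpha> = - ?b" by simp
    then have 2: "(- 1) ^ i * pochhammer (?\<beta> - ?\<alpha>) i = pochhammer (real a + real N - 1 / 2 - real i) i"
      using pochhammer_minus[of ?b i] by (simp add: algebra_simps power_mult_distrib[symmetric])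
    have shift: "i + (c + 2 + i) = c + 2 + 2 * i" by simp
    have 3: "pochhammer (real a + real N - 1 / 2 - real i) i * ?P * pochhammer (real a + real N + real c + 3 / 2) i
        = pochhammer (real a + real N - 1 / 2 - real i) (c + 2 + 2 * i)"
      using pochhammer_product'[of "real a + real N - 1 / 2 - real i" i "(c + 2) + i"]
        pochhammer_product'[of "real a + real N - 1 / 2" "c + 2" i]
      unfolding shift by (simp add: algebra_simps)
    show "?u i * ?v i * (?N * ?P / (2 * ?D)) * (pochhammer ?\<alpha> i * pochhammer (?\<beta> - ?\<alpha>) i)
      = (pochhammer (real a + 3 / 2) i * fact (c + i) / (2 * ?D))
         * (pochhammer (real N - real i) (2 * a + c + 1 + 2 * i)
         * pochhammer (real a + real N - 1 / 2 - real i) (c + 2 + 2 * i))"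
      unfolding 1[symmetric] 3[symmetric] 2[symmetric] by (simp only: times_divide_eq_left times_divide_eq_right mult_ac)
  qed simp
  finally show ?thesis unfolding selberg_const_def by (simp only: prod.distrib mult_ac)
qed

lemma skip_pochhammer_eq: "skip_pochhammer (2 * u) n = 2 ^ n * pochhammer u n"
  by (induction n) (simp_all add: skip_pochhammer_def pochhammer_Suc algebra_simps)

text \<open>The closed form is used for \<open>x\<close> and for 0. \<open>selberg_const\<close> and
  the powers of two that come from the steps of length two in \<open>V_fn\<close> are the same in
  both cases.\<close>

lemma selberg_sum_ratio:
  "selberg_sum n a (x + n) c
     * (T_fn 1 (2 * a + c + 2 * n - 1) n * V_fn (real (2 * a + 1)) (c + 2 * n) n)
   = selberg_sum n a n c
     * (T_fn (real (x + 1)) (2 * a + c + 2 * n - 1) n * V_fn (real (2 * x + 2 * a + 1)) (c + 2 * n) n)"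
proof -
  have *: "selberg_sum n a (x + n) c = selberg_const n a c / (\<Prod>i<n. 2 ^ (c + 2 * n - 2 * i))
     * (T_fn (real (x + 1)) (2 * a + c + 2 * n - 1) n * V_fn (real (2 * x + 2 * a + 1)) (c + 2 * n) n)" for x
  proof -
    have "selberg_sum n a (x + n) c = selberg_const n a c *
      (\<Prod>i<n. pochhammer (real (x + n) - real i) (2 * a + c + 1 + 2 * i)
         * pochhammer (real a + real (x + n) - 1 / 2 - real i) (c + 2 + 2 * i))"
      by (rule selberg_sum_eq) simp
    \<comment> \<open>Taken in reverse order, the runs that grow with \<open>i\<close> become the
      nested runs, shorter by two at each step, of \<open>T_fn\<close> and
      \<open>V_fn\<close>.\<close>
    also have "(\<Prod>i<n. pochhammer (real (x + n) - real i) (2 * a + c + 1 + 2 * i)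
         * pochhammer (real a + real (x + n) - 1 / 2 - real i) (c + 2 + 2 * i))
      = (\<Prod>i<n. pochhammer (real (x + n) - real (n - Suc i)) (2 * a + c + 1 + 2 * (n - Suc i))
         * pochhammer (real a + real (x + n) - 1 / 2 - real (n - Suc i)) (c + 2 + 2 * (n - Suc i)))"
      by (rule prod.nat_diff_reindex[symmetric])
    also have "\<dots> = (\<Prod>i<n. pochhammer (real (x + 1) + real i) (2 * a + c + 2 * n - 1 - 2 * i)
         * (skip_pochhammer (real (2 * x + 2 * a + 1) + 2 * real i) (c + 2 * n - 2 * i) / 2 ^ (c + 2 * n - 2 * i)))"
    proof (rule prod.cong)
      fix i assume "i \<in> {..<n}"
      then have i: "i < n" by simp
      have u: "real (2 * x + 2 * a + 1) + 2 * real i = 2 * (real a + real x + 1 / 2 + real i)" by simp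
      have eqs: "real a + real (x + n) - 1 / 2 - real (n - Suc i) = real a + real x + 1 / 2 + real i"
        "real (x + n) - real (n - Suc i) = real (x + 1) + real i"
        "2 * a + c + 1 + 2 * (n - Suc i) = 2 * a + c + 2 * n - 1 - 2 * i"
        "c + 2 + 2 * (n - Suc i) = c + 2 * n - 2 * i"
        using i by (auto simp: of_nat_diff)
      show "pochhammer (real (x + n) - real (n - Suc i)) (2 * a + c + 1 + 2 * (n - Suc i))
         * pochhammer (real a + real (x + n) - 1 / 2 - real (n - Suc i)) (c + 2 + 2 * (n - Suc i))
        = pochhammer (real (x + 1) + real i) (2 * a + c + 2 * n - 1 - 2 * i)
         * (skip_pochhammer (real (2 * x + 2 * a + 1) + 2 * real i) (c + 2 * n - 2 * i) / 2 ^ (c + 2 * n - 2 * i))"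
        unfolding eqs u skip_pochhammer_eq by simp
    qed simp
    finally show ?thesis unfolding T_fn_def V_fn_def by (simp add: prod.distrib prod_dividef)
  qed
  show ?thesis using *[of x] *[of 0] by simp
qed

lemma T_V_pos: "T_fn (real (x + 1)) k n * V_fn (real (2 * x + 2 * a + 1)) l n > 0"
  unfolding T_fn_def V_fn_def skip_pochhammer_def
  by (intro mult_pos_pos prod_pos pochhammer_pos) (auto intro!: add_pos_nonneg)


section \<open>Tilings by lozenges\<close>


lemma up_tri_vertices: "(i, k) \<in> up_tri i k" "(i + 1, k) \<in> up_tri i k" "(i, k + 1) \<in> up_tri i k"
  by (simp_all add: up_tri_def)

lemma down_tri_vertices: "(i, k) \<in> down_tri i k" "(i + 1, k) \<in> down_tri i k" "(i + 1, k - 1) \<in> down_tri i k"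
  by (simp_all add: down_tri_def)

lemma up_tri_eq_iff [simp]: "up_tri i k = up_tri j l \<longleftrightarrow> i = j \<and> k = l"
proof
  assume "up_tri i k = up_tri j l"
  from up_tri_vertices[of i k, unfolded this] show "i = j \<and> k = l" by (auto simp: up_tri_def)
qed simp

lemma down_tri_eq_iff [simp]: "down_tri i k = down_tri j l \<longleftrightarrow> i = j \<and> k = l"
proof
  assume "down_tri i k = down_tri j l"
  from down_tri_vertices[of i k, unfolded this] show "i = j \<and> k = l" by (auto simp: down_tri_def)
qed simp

lemma up_neq_down [simp]: "up_tri i k \<noteq> down_tri j l" "down_tri j l \<noteq> up_tri i k"
proof -
  show "up_tri i k \<noteq> down_tri j l"
  proof
    assume "up_tri i k = down_tri j l"
    from up_tri_vertices[of i k, unfolded this] show False by (auto simp: down_tri_def)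
  qed
  then show "down_tri j l \<noteq> up_tri i k" by metis
qed

lemma up_down_adjacent_iff:
  "card (up_tri i k \<inter> down_tri j l) = 2 \<longleftrightarrow> (l = k \<and> j = i) \<or> (l = k + 1 \<and> (j = i \<or> j = i - 1))"
proof
  assume "card (up_tri i k \<inter> down_tri j l) = 2"
  then obtain v w where vw: "v \<noteq> w" "up_tri i k \<inter> down_tri j l = {v, w}" by (auto simp: card_2_iff)
  then have "v \<in> up_tri i k" "w \<in> up_tri i k" "v \<in> down_tri j l" "w \<in> down_tri j l" by auto
  with vw(1) show "(l = k \<and> j = i) \<or> (l = k + 1 \<and> (j = i \<or> j = i - 1))"
    by (auto simp: up_tri_def down_tri_def)
next
  assume "(l = k \<and> j = i) \<or> (l = k + 1 \<and> (j = i \<or> j = i - 1))"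
  then consider "l = k" "j = i" | "l = k + 1" "j = i" | "l = k + 1" "j = i - 1" by auto
  then show "card (up_tri i k \<inter> down_tri j l) = 2"
  proof cases
    case 1
    then have "up_tri i k \<inter> down_tri j l = {(i, k), (i + 1, k)}" by (auto simp: up_tri_def down_tri_def)
    then show ?thesis by simp
  next
    case 2
    then have "up_tri i k \<inter> down_tri j l = {(i, k + 1), (i + 1, k)}" by (auto simp: up_tri_def down_tri_def)
    then show ?thesis by simp
  next
    case 3
    then have "up_tri i k \<inter> down_tri j l = {(i, k + 1), (i, k)}" by (auto simp: up_tri_def down_tri_def)
    then show ?thesis by simp
  qed
qed

lemma same_orientation_not_adjacent:
  "card (up_tri i k \<inter> up_tri j l) \<noteq> 2" "card (down_tri i k \<inter> down_tri j l) \<noteq> 2"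
proof -
  show "card (up_tri i k \<inter> up_tri j l) \<noteq> 2"
  proof
    assume *: "card (up_tri i k \<inter> up_tri j l) = 2"
    then obtain v w where vw: "v \<noteq> w" "up_tri i k \<inter> up_tri j l = {v, w}" by (auto simp: card_2_iff)
    then have "v \<in> up_tri i k" "w \<in> up_tri i k" "v \<in> up_tri j l" "w \<in> up_tri j l" by auto
    with vw(1) have "i = j \<and> k = l" by (auto simp: up_tri_def)
    with * show False by (simp add: up_tri_def)
  qed
  show "card (down_tri i k \<inter> down_tri j l) \<noteq> 2"
  proof
    assume *: "card (down_tri i k \<inter> down_tri j l) = 2"
    then obtain v w where vw: "v \<noteq> w" "down_tri i k \<inter> down_tri j l = {v, w}" by (auto simp: card_2_iff)
    then have "v \<in> down_tri i k" "w \<in> down_tri i k" "v \<in> down_tri j l" "w \<in> down_tri j l" by auto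
    with vw(1) have "i = j \<and> k = l" by (auto simp: down_tri_def)
    with * show False by (simp add: down_tri_def)
  qed
qed

lemma is_lozenge_iff:
  "is_lozenge l \<longleftrightarrow> (\<exists>i k j h. l = {up_tri i k, down_tri j h} \<and>
     ((h = k \<and> j = i) \<or> (h = k + 1 \<and> (j = i \<or> j = i - 1))))"
proof
  assume "is_lozenge l"
  then obtain s t where st: "s \<in> unit_triangles" "t \<in> unit_triangles" "card (s \<inter> t) = 2" "l = {s, t}"
    by (auto simp: is_lozenge_def)
  obtain i k where s: "s = up_tri i k \<or> s = down_tri i k" using st(1) by (auto simp: unit_triangles_def)
  obtain j h where t: "t = up_tri j h \<or> t = down_tri j h" using st(2) by (auto simp: unit_triangles_def)
  consider "s = up_tri i k" "t = down_tri j h" | "s = down_tri i k" "t = up_tri j h"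
    using s t st(3) same_orientation_not_adjacent by auto
  then show "\<exists>i k j h. l = {up_tri i k, down_tri j h} \<and>
     ((h = k \<and> j = i) \<or> (h = k + 1 \<and> (j = i \<or> j = i - 1)))"
  proof cases
    case 1
    then show ?thesis using st(3,4) up_down_adjacent_iff[of i k j h] by blast
  next
    case 2
    then have "card (up_tri j h \<inter> down_tri i k) = 2" "l = {up_tri j h, down_tri i k}"
      using st(3,4) by (auto simp: Int_commute)
    then show ?thesis using up_down_adjacent_iff[of j h i k] by blast
  qed
next
  assume "\<exists>i k j h. l = {up_tri i k, down_tri j h} \<and>
     ((h = k \<and> j = i) \<or> (h = k + 1 \<and> (j = i \<or> j = i - 1)))"
  then obtain i k j h where "l = {up_tri i k, down_tri j h}" "card (up_tri i k \<inter> down_tri j h) = 2"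
    using up_down_adjacent_iff by blast
  then show "is_lozenge l" unfolding is_lozenge_def unit_triangles_def by blast
qed

lemma is_lozenge_pair_iff:
  "is_lozenge {up_tri i k, down_tri j h} \<longleftrightarrow> (h = k \<and> j = i) \<or> (h = k + 1 \<and> (j = i \<or> j = i - 1))"
  by (auto simp: is_lozenge_iff doubleton_eq_iff)

section \<open>Weighted tilings: forced lozenges, cuts and symmetries\<close>

definition weighted_tilings :: "(lozenge \<Rightarrow> real) \<Rightarrow> region \<Rightarrow> real" where
  "weighted_tilings w R = (\<Sum>P\<in>tilings R. \<Prod>l\<in>P. w l)"

lemma tiling_sum_eq: "tiling_sum E R = weighted_tilings (lozenge_weight E) R"
  by (simp add: tiling_sum_def weighted_tilings_def)

lemma tilingsD:
  assumes "P \<in> tilings R"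
  shows "\<Union>P = R" "disjoint P" "\<And>l. l \<in> P \<Longrightarrow> is_lozenge l" "\<And>l. l \<in> P \<Longrightarrow> l \<subseteq> R"
  using assms by (auto simp: tilings_def partition_on_def)

lemma lozenge_nonempty: "is_lozenge l \<Longrightarrow> l \<noteq> {}"
  by (auto simp: is_lozenge_def)

lemma tilingsI:
  assumes "\<Union>P = R" "disjoint P" "\<And>l. l \<in> P \<Longrightarrow> is_lozenge l"
  shows "P \<in> tilings R"
  using assms lozenge_nonempty by (auto simp: tilings_def partition_on_def)

lemma finite_tilings: "finite R \<Longrightarrow> finite (tilings R)"
  by (rule finite_subset[of _ "Pow (Pow R)"]) (auto simp: tilings_def partition_on_def)

lemma finite_tiling: "finite R \<Longrightarrow> P \<in> tilings R \<Longrightarrow> finite P"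
  by (rule finite_subset[of _ "Pow R"]) (auto simp: tilings_def partition_on_def)

lemma weighted_tilings_empty [simp]: "weighted_tilings w {} = 1"
proof -
  have "tilings {} = {{}}" by (auto simp: tilings_def partition_on_empty)
  then show ?thesis by (simp add: weighted_tilings_def)
qed

lemma weighted_tilings_cong:
  assumes "\<And>l. is_lozenge l \<Longrightarrow> l \<subseteq> R \<Longrightarrow> w l = w' l"
  shows "weighted_tilings w R = weighted_tilings w' R"
  unfolding weighted_tilings_def
  by (intro sum.cong prod.cong refl assms) (auto dest: tilingsD)

lemma weighted_tilings_zero:
  assumes "t \<in> R" "\<And>l. is_lozenge l \<Longrightarrow> l \<subseteq> R \<Longrightarrow> t \<notin> l"
  shows "weighted_tilings w R = 0"
proof -
  have "tilings R = {}"
  proof (rule equals0I)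
    fix P assume P: "P \<in> tilings R"
    with assms(1) obtain l where "l \<in> P" "t \<in> l" using tilingsD(1) by blast
    then show False using assms(2) tilingsD[OF P] by blast
  qed
  then show ?thesis by (simp add: weighted_tilings_def)
qed

text \<open>Every tiling has to cover \<open>t\<close> and can do so only by \<open>l\<close>;
  deleting \<open>l\<close> is therefore a bijection onto the tilings of the rest.\<close>

lemma weighted_tilings_forced:
  assumes fin: "finite R" and l: "is_lozenge l" "l \<subseteq> R" "t \<in> l"
    and unique: "\<And>l'. is_lozenge l' \<Longrightarrow> l' \<subseteq> R \<Longrightarrow> t \<in> l' \<Longrightarrow> l' = l"
  shows "weighted_tilings w R = w l * weighted_tilings w (R - l)"
proof -
  have mem: "l \<in> P" if P: "P \<in> tilings R" for P
  proof -
    obtain l' where "l' \<in> P" "t \<in> l'" using tilingsD(1)[OF P] l by blast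
    then show ?thesis using unique tilingsD[OF P] by metis
  qed
  have "weighted_tilings w R = (\<Sum>P\<in>tilings (R - l). w l * (\<Prod>l\<in>P. w l))"
    unfolding weighted_tilings_def
  proof (rule sum.reindex_bij_witness[where i = "insert l" and j = "\<lambda>P. P - {l}"])
    fix P assume P: "P \<in> tilings R"
    show "insert l (P - {l}) = P" using mem[OF P] by auto
    show "P - {l} \<in> tilings (R - l)"
    proof (rule tilingsI)
      have "l' \<inter> l = {}" if "l' \<in> P" "l' \<noteq> l" for l'
        using disjointD[OF tilingsD(2)[OF P]] that mem[OF P] by blast
      then show "\<Union>(P - {l}) = R - l" using tilingsD(1)[OF P] by blast
      show "disjoint (P - {l})" using tilingsD(2)[OF P] by (rule pairwise_subset) auto
    qed (use tilingsD[OF P] in auto)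
    show "w l * (\<Prod>l\<in>P - {l}. w l) = (\<Prod>l\<in>P. w l)"
      using prod.remove[OF finite_tiling[OF fin P] mem[OF P], of w] by simp
  next
    fix P assume P: "P \<in> tilings (R - l)"
    have "l \<notin> P" using tilingsD(1)[OF P] l by blast
    then show "insert l P - {l} = P" by auto
    show "insert l P \<in> tilings R"
    proof (rule tilingsI)
      show "\<Union>(insert l P) = R" using tilingsD(1)[OF P] l by auto
      have "disjnt l l'" if "l' \<in> P" for l'
        using tilingsD(1)[OF P] that by (auto simp: disjnt_def)
      then show "disjoint (insert l P)"
        using tilingsD(2)[OF P] by (auto simp: pairwise_insert disjnt_sym)
    qed (use tilingsD[OF P] l in auto)
  qed
  then show ?thesis by (simp add: weighted_tilings_def sum_distrib_left)
qed

definition crossings :: "region \<Rightarrow> region \<Rightarrow> lozenge set set" where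
  "crossings R1 R2 = {C. disjoint C \<and>
     (\<forall>l\<in>C. is_lozenge l \<and> l \<subseteq> R1 \<union> R2 \<and> l \<inter> R1 \<noteq> {} \<and> l \<inter> R2 \<noteq> {})}"

text \<open>A tiling amounts to the family of its lozenges meeting both parts together with a tiling
  of what this family leaves of each part.\<close>

lemma weighted_tilings_split:
  assumes fin: "finite R1" "finite R2" and disj: "R1 \<inter> R2 = {}"
  shows "weighted_tilings w (R1 \<union> R2) = (\<Sum>C\<in>crossings R1 R2.
     (\<Prod>l\<in>C. w l) * weighted_tilings w (R1 - \<Union>C) * weighted_tilings w (R2 - \<Union>C))"
proof -
  have finC: "finite (crossings R1 R2)"
    by (rule finite_subset[of _ "Pow (Pow (R1 \<union> R2))"]) (use fin in \<open>auto simp: crossings_def\<close>)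
  let ?T = "\<lambda>C. tilings (R1 - \<Union>C) \<times> tilings (R2 - \<Union>C)"
  define c where "c = (\<lambda>P::lozenge set. {l \<in> P. l \<inter> R1 \<noteq> {} \<and> l \<inter> R2 \<noteq> {}})"
  define p where "p = (\<lambda>(R::region) (P::lozenge set). {l \<in> P. l \<subseteq> R})"
  have "(\<Sum>C\<in>crossings R1 R2. (\<Prod>l\<in>C. w l) * weighted_tilings w (R1 - \<Union>C) * weighted_tilings w (R2 - \<Union>C))
     = (\<Sum>C\<in>crossings R1 R2. \<Sum>(P1, P2)\<in>?T C. (\<Prod>l\<in>C. w l) * (\<Prod>l\<in>P1. w l) * (\<Prod>l\<in>P2. w l))"
    unfolding weighted_tilings_def
    by (simp add: sum_distrib_left sum_distrib_right sum.cartesian_product[symmetric] mult.assoc)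
      (rule sum.cong[OF refl], rule sum.swap)
  also have "\<dots> = (\<Sum>(C, P1, P2)\<in>Sigma (crossings R1 R2) ?T. (\<Prod>l\<in>C. w l) * (\<Prod>l\<in>P1. w l) * (\<Prod>l\<in>P2. w l))"
    using fin by (subst sum.Sigma[OF finC]) (auto intro!: finite_cartesian_product finite_tilings sum.cong)
  also have "\<dots> = (\<Sum>P\<in>tilings (R1 \<union> R2). \<Prod>l\<in>P. w l)"
  proof (rule sum.reindex_bij_witness[where i = "\<lambda>P. (c P, p R1 P, p R2 P)" and j = "\<lambda>(C, P1, P2). C \<union> P1 \<union> P2"])
    fix P assume P: "P \<in> tilings (R1 \<union> R2)"
    note PD = tilingsD[OF P]
    have cases: "l \<in> c P \<or> l \<in> p R1 P \<or> l \<in> p R2 P" if "l \<in> P" for l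
      using PD(4)[OF that] that unfolding c_def p_def by blast
    show "(case (c P, p R1 P, p R2 P) of (C, P1, P2) \<Rightarrow> C \<union> P1 \<union> P2) = P"
      using cases by (auto simp: c_def p_def)
    have sub: "c P \<subseteq> P" "p R P \<subseteq> P" for R by (auto simp: c_def p_def)
    have "c P \<in> crossings R1 R2"
      unfolding crossings_def using PD pairwise_subset[OF PD(2) sub(1)] by (auto simp: c_def)
    moreover have "p R P \<in> tilings (R - \<Union>(c P))" if R: "R = R1 \<or> R = R2" for R
    proof (rule tilingsI)
      show "disjoint (p R P)" using PD(2) sub(2) by (rule pairwise_subset)
      have "l \<inter> l' = {}" if "l \<in> p R P" "l' \<in> c P" for l l'
      proof -
        have "l \<noteq> l'" using that R disj by (auto simp: c_def p_def)
        then show ?thesis using that sub disjointD[OF PD(2)] by blast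
      qed
      then have "\<Union>(p R P) \<subseteq> R - \<Union>(c P)" by (auto simp: p_def)
      moreover have "R - \<Union>(c P) \<subseteq> \<Union>(p R P)"
      proof
        fix t assume t: "t \<in> R - \<Union>(c P)"
        then have "t \<in> R1 \<union> R2" using R by auto
        then obtain l where l: "l \<in> P" "t \<in> l" using PD(1) by blast
        then have "l \<in> p R1 P \<or> l \<in> p R2 P" using cases[OF l(1)] t by auto
        then have "l \<in> p R P" using t l(2) R disj by (auto simp: p_def)
        then show "t \<in> \<Union>(p R P)" using l(2) by auto
      qed
      ultimately show "\<Union>(p R P) = R - \<Union>(c P)" by auto
    qed (use PD(3) sub in auto)
    ultimately show "(c P, p R1 P, p R2 P) \<in> Sigma (crossings R1 R2) ?T" by auto
  next
    fix x assume "x \<in> Sigma (crossings R1 R2) ?T"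
    then obtain C P1 P2 where x: "x = (C, P1, P2)" and C: "C \<in> crossings R1 R2"
      and P1: "P1 \<in> tilings (R1 - \<Union>C)" and P2: "P2 \<in> tilings (R2 - \<Union>C)" by auto
    note D1 = tilingsD[OF P1] and D2 = tilingsD[OF P2]
    have CD: "is_lozenge l" "l \<subseteq> R1 \<union> R2" "l \<inter> R1 \<noteq> {}" "l \<inter> R2 \<noteq> {}" if "l \<in> C" for l
      using C that by (auto simp: crossings_def)
    have dC: "disjoint C" using C by (simp add: crossings_def)
    have ne: "l \<noteq> {}" if "l \<in> P1 \<or> l \<in> P2" for l using that D1(3) D2(3) lozenge_nonempty by auto
    have sub1: "l \<subseteq> R1" if "l \<in> P1" for l using D1(4)[OF that] by auto
    have sub2: "l \<subseteq> R2" if "l \<in> P2" for l using D2(4)[OF that] by auto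
    have not1: "\<not> l \<subseteq> R1" "l \<inter> R1 = {}" if "l \<in> P2" for l
      using ne[of l] sub2[OF that] that disj by auto
    have not2: "\<not> l \<subseteq> R2" "l \<inter> R2 = {}" if "l \<in> P1" for l
      using ne[of l] sub1[OF that] that disj by auto
    have notC: "\<not> l \<subseteq> R1" "\<not> l \<subseteq> R2" if "l \<in> C" for l
      using CD(3,4)[OF that] disj by auto
    have in1: "l \<notin> C" "l \<notin> P2" if "l \<in> P1" for l
      using notC(1)[of l] not1(1)[of l] sub1[OF that] by auto
    have in2: "l \<notin> C" if "l \<in> P2" for l
      using notC(2)[of l] sub2[OF that] by auto
    have "c (C \<union> P1 \<union> P2) = C"
      unfolding c_def by (auto dest: CD(3,4) not1(2) not2(2))
    moreover have "p R1 (C \<union> P1 \<union> P2) = P1"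
      unfolding p_def using sub1 not1(1) notC(1) by auto
    moreover have "p R2 (C \<union> P1 \<union> P2) = P2"
      unfolding p_def using sub2 not2(1) notC(2) by auto
    ultimately show "(c (case x of (C, P1, P2) \<Rightarrow> C \<union> P1 \<union> P2), p R1 (case x of (C, P1, P2) \<Rightarrow> C \<union> P1 \<union> P2),
        p R2 (case x of (C, P1, P2) \<Rightarrow> C \<union> P1 \<union> P2)) = x" by (simp add: x)
    show "(case x of (C, P1, P2) \<Rightarrow> C \<union> P1 \<union> P2) \<in> tilings (R1 \<union> R2)"
      unfolding x prod.case
    proof (rule tilingsI)
      have "\<Union>C \<subseteq> R1 \<union> R2" using CD(2) by blast
      then show "\<Union>(C \<union> P1 \<union> P2) = R1 \<union> R2" using D1(1) D2(1) by auto
      have "disjoint (C \<union> P1)" by (rule disjoint_union[OF dC D1(2)]) (use D1(1) in auto)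
      moreover have "\<Union>(C \<union> P1) \<inter> \<Union>P2 = {}"
        unfolding Union_Un_distrib D1(1) D2(1) using disj by auto
      ultimately show "disjoint (C \<union> P1 \<union> P2)" using disjoint_union D2(2) by blast
    qed (use CD(1) D1(3) D2(3) in auto)
    have finite: "finite C" "finite P1" "finite P2"
      using finite_subset[of C "Pow (R1 \<union> R2)"] CD(2) fin finite_tiling[OF _ P1] finite_tiling[OF _ P2] by auto
    have "(\<Prod>l\<in>C \<union> P1 \<union> P2. w l) = (\<Prod>l\<in>C. w l) * (\<Prod>l\<in>P1. w l) * (\<Prod>l\<in>P2. w l)"
    proof -
      have "(C \<union> P1) \<inter> P2 = {}" "C \<inter> P1 = {}" using in1 in2 by auto
      then show ?thesis using finite by (simp add: prod.union_disjoint)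
    qed
    then show "(\<Prod>l\<in>(case x of (C, P1, P2) \<Rightarrow> C \<union> P1 \<union> P2). w l)
      = (case x of (C, P1, P2) \<Rightarrow> (\<Prod>l\<in>C. w l) * (\<Prod>l\<in>P1. w l) * (\<Prod>l\<in>P2. w l))" by (simp add: x)
  qed
  finally show ?thesis by (simp add: weighted_tilings_def)
qed

text \<open>When the lozenges across the cut are exactly the mutually disjoint pairs
  \<open>{U j, D j}\<close>, every subset of \<open>A\<close> is an admissible crossing family. This
  form serves both for the line between two strips and for the axis of the region.\<close>

lemma weighted_tilings_cut:
  fixes U D :: "'a \<Rightarrow> triangle"
  assumes fin: "finite R1" "finite R2" and disj: "R1 \<inter> R2 = {}"
    and inj: "inj_on U A" "inj_on D A"
    and UD: "\<And>j. j \<in> A \<Longrightarrow> D j \<in> R1 \<and> U j \<in> R2 \<and> is_lozenge {U j, D j}"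
    and cross: "\<And>l. is_lozenge l \<Longrightarrow> l \<subseteq> R1 \<union> R2 \<Longrightarrow> l \<inter> R1 \<noteq> {} \<Longrightarrow> l \<inter> R2 \<noteq> {} \<Longrightarrow> \<exists>j\<in>A. l = {U j, D j}"
  shows "weighted_tilings w (R1 \<union> R2) = (\<Sum>S\<in>Pow A.
     (\<Prod>j\<in>S. w {U j, D j}) * weighted_tilings w (R1 - D ` S) * weighted_tilings w (R2 - U ` S))"
proof -
  let ?v = "\<lambda>j. {U j, D j}"
  have neq: "U j \<noteq> D j'" if "j \<in> A" "j' \<in> A" for j j' using UD that disj by (metis disjoint_iff)
  have inj_v: "inj_on ?v A"
    by (rule inj_onI) (use neq inj in \<open>auto simp: doubleton_eq_iff dest: inj_onD\<close>)
  have C: "crossings R1 R2 = (\<lambda>S. ?v ` S) ` Pow A"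
  proof
    show "crossings R1 R2 \<subseteq> (\<lambda>S. ?v ` S) ` Pow A"
    proof
      fix C assume "C \<in> crossings R1 R2"
      then have "C \<subseteq> ?v ` A" using cross by (fastforce simp: crossings_def)
      then obtain S where "S \<subseteq> A" "C = ?v ` S" unfolding subset_image_iff by blast
      then show "C \<in> (\<lambda>S. ?v ` S) ` Pow A" by (intro image_eqI) auto
    qed
    show "(\<lambda>S. ?v ` S) ` Pow A \<subseteq> crossings R1 R2"
    proof
      fix C assume "C \<in> (\<lambda>S. ?v ` S) ` Pow A"
      then obtain S where S: "S \<subseteq> A" "C = ?v ` S" by auto
      have "disjoint (?v ` S)"
      proof (rule disjointI)
        fix l l' assume "l \<in> ?v ` S" "l' \<in> ?v ` S" "l \<noteq> l'"
        then obtain j j' where "j \<in> A" "j' \<in> A" "l = ?v j" "l' = ?v j'" "j \<noteq> j'" using S by auto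
        then show "l \<inter> l' = {}" using neq inj by (auto dest: inj_onD)
      qed
      then show "C \<in> crossings R1 R2" using S UD by (auto simp: crossings_def)
    qed
  qed
  have inj2: "inj_on (\<lambda>S. ?v ` S) (Pow A)" using inj_v by (rule inj_on_image_Pow)
  have U: "\<Union>(?v ` S) = U ` S \<union> D ` S" for S by auto
  have sub: "U ` S \<inter> R1 = {}" "D ` S \<inter> R2 = {}" if "S \<subseteq> A" for S using UD that disj by auto
  show ?thesis unfolding weighted_tilings_split[OF fin disj] C
  proof (subst sum.reindex[OF inj2], rule sum.cong)
    fix S assume "S \<in> Pow A"
    then have S: "S \<subseteq> A" by simp
    have "R1 - \<Union>(?v ` S) = R1 - D ` S" "R2 - \<Union>(?v ` S) = R2 - U ` S" using sub[OF S] by auto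
    then show "((\<lambda>C. (\<Prod>l\<in>C. w l) * weighted_tilings w (R1 - \<Union> C) * weighted_tilings w (R2 - \<Union> C)) \<circ> (\<lambda>S. ?v ` S)) S
      = (\<Prod>j\<in>S. w {U j, D j}) * weighted_tilings w (R1 - D ` S) * weighted_tilings w (R2 - U ` S)"
      using inj_on_subset[OF inj_v S] by (simp add: prod.reindex)
  qed simp
qed

lemma weighted_tilings_map:
  assumes fin: "finite R" and inv: "\<And>t. \<sigma> (\<sigma> t) = t"
    and loz: "\<And>l. is_lozenge l \<Longrightarrow> is_lozenge (\<sigma> ` l)" and w: "\<And>l. is_lozenge l \<Longrightarrow> w (\<sigma> ` l) = w l"
  shows "weighted_tilings w (\<sigma> ` R) = weighted_tilings w R"
proof -
  have inj: "inj \<sigma>" by (rule injI) (metis inv)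
  have inv2: "(`) \<sigma> ` (`) \<sigma> ` P = P" for P :: "lozenge set" by (simp add: image_image inv)
  have mem: "(`) \<sigma> ` P \<in> tilings (\<sigma> ` R)" if P: "P \<in> tilings R" for P R
  proof (rule tilingsI)
    show "\<Union>((`) \<sigma> ` P) = \<sigma> ` R" using tilingsD(1)[OF P] by auto
    show "disjoint ((`) \<sigma> ` P)"
    proof (rule disjointI)
      fix l l' assume "l \<in> (`) \<sigma> ` P" "l' \<in> (`) \<sigma> ` P" "l \<noteq> l'"
      then obtain m m' where m: "m \<in> P" "m' \<in> P" "l = \<sigma> ` m" "l' = \<sigma> ` m'" "m \<noteq> m'" by auto
      then have "m \<inter> m' = {}" using disjointD[OF tilingsD(2)[OF P]] by blast
      then show "l \<inter> l' = {}" using m image_Int[OF inj, of m m'] by simp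
    qed
  qed (use tilingsD(3)[OF P] loz in auto)
  have RR: "\<sigma> ` \<sigma> ` R = R" by (simp add: image_image inv)
  show ?thesis unfolding weighted_tilings_def
  proof (rule sum.reindex_bij_witness[where i = "(`) ((`) \<sigma>)" and j = "(`) ((`) \<sigma>)"])
    fix P assume P: "P \<in> tilings (\<sigma> ` R)"
    show "(`) \<sigma> ` (`) \<sigma> ` P = P" by (rule inv2)
    show "(`) \<sigma> ` P \<in> tilings R" using mem[OF P] RR by simp
    have "inj_on ((`) \<sigma>) P" using inj by (meson inj_image_eq_iff inj_onI)
    then show "(\<Prod>l\<in>(`) \<sigma> ` P. w l) = (\<Prod>l\<in>P. w l)"
      using tilingsD(3)[OF P] by (simp add: prod.reindex w)
  next
    fix P assume P: "P \<in> tilings R"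
    show "(`) \<sigma> ` (`) \<sigma> ` P = P" by (rule inv2)
    show "(`) \<sigma> ` P \<in> tilings (\<sigma> ` R)" using mem[OF P] .
  qed
qed


section \<open>Interlacing of consecutive rows\<close>


text \<open>The last two assumptions say that an up-pointing triangle of \<open>R\<close> touching a
  prescribed down-pointing triangle from below belongs itself to a prescribed lozenge one line
  lower. So a lozenge of \<open>P\<close> on the lowest line is forced, and the assumptions survive
  its removal.\<close>

lemma weighted_tilings_forced_vertical:
  assumes "finite R" "finite P"
    and "\<And>i k. (i, k) \<in> P \<Longrightarrow> up_tri i k \<in> R \<and> down_tri i k \<in> R"
    and "\<And>i k. (i, k) \<in> P \<Longrightarrow> up_tri i (k - 1) \<in> R \<Longrightarrow> (i, k - 1) \<in> P"
    and "\<And>i k. (i, k) \<in> P \<Longrightarrow> up_tri (i + 1) (k - 1) \<in> R \<Longrightarrow> (i + 1, k - 1) \<in> P"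
  shows "weighted_tilings w R = (\<Prod>(i, k)\<in>P. w {up_tri i k, down_tri i k})
     * weighted_tilings w (R - (\<Union>(i, k)\<in>P. {up_tri i k, down_tri i k}))"
  using assms
proof (induction "card P" arbitrary: P R)
  case 0
  then show ?case by simp
next
  case (Suc c)
  note P = Suc.prems
  define m where "m = Min (snd ` P)"
  have ne: "P \<noteq> {}" using Suc.hyps(2) by auto
  then have "m \<in> snd ` P" unfolding m_def using P(2) by (intro Min_in) auto
  then obtain i where ik: "(i, m) \<in> P" by auto
  have min: "m \<le> k" if "(j, k) \<in> P" for j k
    unfolding m_def using P(2) that by (intro Min_le) force+
  let ?l = "{up_tri i m, down_tri i m}"
  have no: "up_tri i (m - 1) \<notin> R" "up_tri (i + 1) (m - 1) \<notin> R"
    using P(4,5)[OF ik] min[of i "m - 1"] min[of "i + 1" "m - 1"] by auto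
  have forced: "weighted_tilings w R = w ?l * weighted_tilings w (R - ?l)"
  proof (rule weighted_tilings_forced[where t = "down_tri i m", OF P(1)])
    show "is_lozenge ?l" by (simp add: is_lozenge_pair_iff)
    show "?l \<subseteq> R" using P(3)[OF ik] by auto
    show "down_tri i m \<in> ?l" by simp
    fix l assume l: "is_lozenge l" "l \<subseteq> R" "down_tri i m \<in> l"
    from l(1) obtain i' k' j h where eq: "l = {up_tri i' k', down_tri j h}"
      and adj: "(h = k' \<and> j = i') \<or> (h = k' + 1 \<and> (j = i' \<or> j = i' - 1))" unfolding is_lozenge_iff by blast
    have jh: "j = i" "h = m" using l(3) eq by auto
    have "up_tri i' k' \<in> R" using l(2) eq by auto
    then have "\<not> (k' = m - 1 \<and> (i' = i \<or> i' = i + 1))" using no by auto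
    then have "k' = m \<and> i' = i" using adj jh by auto
    then show "l = ?l" using eq jh by simp
  qed
  let ?P = "P - {(i, m)}"
  have "weighted_tilings w (R - ?l) = (\<Prod>(i, k)\<in>?P. w {up_tri i k, down_tri i k})
     * weighted_tilings w (R - ?l - (\<Union>(i, k)\<in>?P. {up_tri i k, down_tri i k}))"
  proof (rule Suc.hyps(1))
    show "c = card ?P" using Suc.hyps(2) P(2) ik by simp
    show "finite (R - ?l)" "finite ?P" using P by auto
    fix j k assume jk: "(j, k) \<in> ?P"
    then show "up_tri j k \<in> R - ?l \<and> down_tri j k \<in> R - ?l" using P(3)[of j k] by auto
    show "(j, k - 1) \<in> ?P" if "up_tri j (k - 1) \<in> R - ?l" using P(4)[of j k] jk that by auto
    show "(j + 1, k - 1) \<in> ?P" if "up_tri (j + 1) (k - 1) \<in> R - ?l" using P(5)[of j k] jk that by auto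
  qed
  moreover have "R - ?l - (\<Union>(i, k)\<in>?P. {up_tri i k, down_tri i k})
      = R - (\<Union>(i, k)\<in>P. {up_tri i k, down_tri i k})" using ik by blast
  moreover have "(\<Prod>(i, k)\<in>P. w {up_tri i k, down_tri i k})
      = w ?l * (\<Prod>(i, k)\<in>?P. w {up_tri i k, down_tri i k})"
    using prod.remove[OF P(2) ik, of "\<lambda>(i, k). w {up_tri i k, down_tri i k}"] by simp
  ultimately show ?case using forced by simp
qed

definition rank_below :: "nat set \<Rightarrow> nat \<Rightarrow> nat" where
  "rank_below Y y = card {y' \<in> Y. y' < y}"

text \<open>The nodes form a path, and a path with the nodes \<open>Y\<close> removed has at most
  one perfect matching. It exists iff all remaining segments have even length, that is, iff the
  number of remaining nodes below each \<open>y\<close> in \<open>Y\<close>, and below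
  \<open>hi\<close>, is even.\<close>

lemma weighted_tilings_chain:
  fixes \<nu> :: "nat \<Rightarrow> triangle"
  assumes inj: "inj \<nu>" and loz: "\<And>m n. is_lozenge {\<nu> m, \<nu> n} \<longleftrightarrow> m = Suc n \<or> n = Suc m"
    and w: "\<And>n. w {\<nu> n, \<nu> (Suc n)} = 1"
    and "Y \<subseteq> {lo..<hi}" "lo \<le> hi"
  shows "weighted_tilings w (\<nu> ` ({lo..<hi} - Y))
    = (if (\<forall>y\<in>Y. even (lo + y + rank_below Y y)) \<and> even (lo + hi + card Y) then 1 else 0)"
  using assms(4,5)
proof (induction "hi - lo" arbitrary: lo Y rule: less_induct)
  case less
  have finY: "finite Y" using less.prems finite_subset by blast
  have containing: "l = {\<nu> lo, \<nu> (Suc lo)} \<and> Suc lo < hi \<and> Suc lo \<notin> Y"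
    if l: "is_lozenge l" "l \<subseteq> \<nu> ` ({lo..<hi} - Y)" "\<nu> lo \<in> l" for l
  proof -
    from l(1) obtain s t where "l = {s, t}" by (auto simp: is_lozenge_def)
    with l(2,3) obtain t where "l = {\<nu> lo, t}" "t \<in> \<nu> ` ({lo..<hi} - Y)" by auto
    then obtain n where n: "l = {\<nu> lo, \<nu> n}" "lo \<le> n" "n < hi" "n \<notin> Y" by auto
    then have "n = Suc lo" using loz[of lo n] l(1) by auto
    then show ?thesis using n by simp
  qed
  consider "lo = hi" | "lo < hi" "lo \<in> Y" | "lo < hi" "lo \<notin> Y" "Suc lo = hi \<or> Suc lo \<in> Y"
    | "Suc lo < hi" "lo \<notin> Y" "Suc lo \<notin> Y"
    using less.prems(2) by fastforce
  then show ?case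
  proof cases
    case 1
    then have "Y = {}" using less.prems by auto
    then show ?thesis using 1 by simp
  next
    case 2
    \<comment> \<open>Passing from \<open>lo\<close> to \<open>Suc lo\<close> changes the parity of
      the left end and lowers every rank by one, so all parities in the condition stay the
      same.\<close>
    let ?Y = "Y - {lo}"
    have Y: "Y = insert lo ?Y" using 2 by auto
    have gt: "lo < y" if "y \<in> ?Y" for y using that less.prems by force
    have ball_rank: "(\<forall>y\<in>Y. even (lo + y + rank_below Y y)) \<longleftrightarrow>
        even (lo + lo + rank_below Y lo) \<and> (\<forall>y\<in>?Y. even (lo + y + rank_below Y y))" using 2 by auto
    have "rank_below Y lo = 0" using less.prems by (force simp: rank_below_def)
    moreover have "rank_below Y y = Suc (rank_below ?Y y)" if "y \<in> ?Y" for y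
    proof -
      have "{y' \<in> Y. y' < y} = insert lo {y' \<in> ?Y. y' < y}" using gt[OF that] 2 by auto
      then show ?thesis using finY by (simp add: rank_below_def)
    qed
    moreover have "card Y = Suc (card ?Y)" using card_Suc_Diff1[OF finY 2(2)] by simp
    ultimately have "(\<forall>y\<in>Y. even (lo + y + rank_below Y y)) \<and> even (lo + hi + card Y) \<longleftrightarrow>
        (\<forall>y\<in>?Y. even (Suc lo + y + rank_below ?Y y)) \<and> even (Suc lo + hi + card ?Y)"
      unfolding ball_rank by auto
    moreover have "{lo..<hi} - Y = {Suc lo..<hi} - ?Y"
    proof -
      have "{lo..<hi} = insert lo {Suc lo..<hi}" using 2 by auto
      then show ?thesis using 2 by auto
    qed
    moreover have "?Y \<subseteq> {Suc lo..<hi}" using less.prems gt by force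
    ultimately show ?thesis using less.hyps[of "Suc lo" ?Y] 2 by simp
  next
    case 3
    have "weighted_tilings w (\<nu> ` ({lo..<hi} - Y)) = 0"
      by (rule weighted_tilings_zero[of "\<nu> lo"]) (use 3 containing in auto)
    moreover have "\<not> ((\<forall>y\<in>Y. even (lo + y + rank_below Y y)) \<and> even (lo + hi + card Y))"
    proof (cases "Suc lo = hi")
      case True
      then have "{lo..<hi} = {lo}" by auto
      then have "Y = {}" using less.prems 3 by auto
      then show ?thesis using True by auto
    next
      case False
      then have "Suc lo \<in> Y" using 3 by auto
      moreover have "\<not> y' < Suc lo" if "y' \<in> Y" for y'
      proof -
        have "lo \<le> y'" "y' \<noteq> lo" using less.prems 3(2) that by auto
        then show ?thesis by simp
      qed
      then have "{y' \<in> Y. y' < Suc lo} = {}" by blast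
      then have "rank_below Y (Suc lo) = 0" by (simp add: rank_below_def)
      ultimately show ?thesis by force
    qed
    ultimately show ?thesis by simp
  next
    case 4
    let ?l = "{\<nu> lo, \<nu> (Suc lo)}"
    have "weighted_tilings w (\<nu> ` ({lo..<hi} - Y))
      = w ?l * weighted_tilings w (\<nu> ` ({lo..<hi} - Y) - ?l)"
      by (rule weighted_tilings_forced[where t = "\<nu> lo"]) (use 4 containing loz in auto)
    also have "\<nu> ` ({lo..<hi} - Y) - ?l = \<nu> ` ({Suc (Suc lo)..<hi} - Y)"
    proof -
      have "{Suc (Suc lo)..<hi} - Y = ({lo..<hi} - Y) - {lo, Suc lo}" by auto
      then show ?thesis using inj by (simp add: image_set_diff)
    qed
    also have "weighted_tilings w (\<nu> ` ({Suc (Suc lo)..<hi} - Y))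
      = (if (\<forall>y\<in>Y. even (lo + y + rank_below Y y)) \<and> even (lo + hi + card Y) then 1 else 0)"
    proof -
      have "Suc (Suc lo) \<le> y" if "y \<in> Y" for y
      proof -
        have "lo \<le> y" "y \<noteq> lo" "y \<noteq> Suc lo" using less.prems 4 that by auto
        then show ?thesis by simp
      qed
      then have "Y \<subseteq> {Suc (Suc lo)..<hi}" using less.prems by force
      then show ?thesis using less.hyps[of "Suc (Suc lo)" Y] 4 by simp
    qed
    finally show ?thesis by (simp add: w)
  qed
qed

text \<open>The condition of the previous lemma for \<open>lo = 0\<close> and odd \<open>hi\<close>: the removed nodes alternate in parity,
  starting and ending with an even one.\<close>

definition row_holes :: "nat set \<Rightarrow> nat set \<Rightarrow> nat set" where
  "row_holes E F = (\<lambda>e. 2 * e) ` E \<union> (\<lambda>f. 2 * f + 1) ` F"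

definition alternating :: "nat set \<Rightarrow> bool" where
  "alternating Y \<longleftrightarrow> (\<forall>y\<in>Y. even (y + rank_below Y y)) \<and> odd (card Y)"

lemma alternating_consecutive:
  assumes "alternating Y" "finite Y" "y \<in> Y" "z \<in> Y" "y < z" "\<And>u. u \<in> Y \<Longrightarrow> y < u \<Longrightarrow> z \<le> u"
  shows "even y \<longleftrightarrow> odd z"
proof -
  have "{u \<in> Y. u < z} = insert y {u \<in> Y. u < y}" using assms(3-6) by force
  then have "rank_below Y z = Suc (rank_below Y y)" using assms(2) by (simp add: rank_below_def)
  moreover have "even (y + rank_below Y y)" "even (z + rank_below Y z)"
    using assms by (auto simp: alternating_def)
  ultimately show ?thesis by auto
qed

lemma alternating_Min:
  assumes "alternating Y" "finite Y" "y \<in> Y" "\<And>u. u \<in> Y \<Longrightarrow> y \<le> u"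
  shows "even y"
proof -
  have "{u \<in> Y. u < y} = {}" using assms(4) by force
  then have "rank_below Y y = 0" by (simp add: rank_below_def)
  then show ?thesis using assms by (force simp: alternating_def)
qed

lemma alternating_Max:
  assumes "alternating Y" "finite Y" "y \<in> Y" "\<And>u. u \<in> Y \<Longrightarrow> u \<le> y"
  shows "even y"
proof -
  have "{u \<in> Y. u < y} = Y - {y}" using assms(3,4) by force
  then have "Suc (rank_below Y y) = card Y"
    unfolding rank_below_def using card_Suc_Diff1[OF assms(2,3)] by simp
  moreover have "even (y + rank_below Y y)" "odd (card Y)" using assms by (auto simp: alternating_def)
  ultimately show ?thesis by presburger
qed

lemma ex_enclosing_index:
  fixes e :: "nat \<Rightarrow> nat"
  shows "e 0 \<le> f \<Longrightarrow> f < e m \<Longrightarrow> \<exists>i<m. e i \<le> f \<and> f < e (Suc i)"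
proof (induction m)
  case (Suc m)
  then show ?case by (cases "f < e m") (auto simp: less_Suc_eq not_less)
qed auto

text \<open>The smallest and the largest hole are even, and consecutive holes differ in parity.
  Since \<open>2 * e < 2 * f + 1\<close> means \<open>e \<le> f\<close> and
  \<open>2 * f + 1 < 2 * e'\<close> means \<open>f < e'\<close>, exactly one element of
  \<open>F\<close> lies in each half-open interval between consecutive values of
  \<open>e\<close>.\<close>

lemma alternating_imp_interlacing:
  assumes mono: "strict_mono_on {..<Suc m} e" and finF: "finite F"
    and holes: "alternating (row_holes (e ` {..<Suc m}) F)"
  shows "\<exists>g\<in>PiE {..<m} (\<lambda>i. {e i..<e (Suc i)}). F = g ` {..<m}"
proof -
  let ?Y = "row_holes (e ` {..<Suc m}) F"
  have finY: "finite ?Y" using finF by (simp add: row_holes_def)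
  have Ye: "2 * e i \<in> ?Y" if "i \<le> m" for i using that by (auto simp: row_holes_def)
  have Yf: "2 * f + 1 \<in> ?Y" if "f \<in> F" for f using that by (auto simp: row_holes_def)
  have evenY: "\<exists>i\<le>m. y = 2 * e i" if "y \<in> ?Y" "even y" for y
    using that by (fastforce simp: row_holes_def less_Suc_eq_le)
  have oddY: "\<exists>f\<in>F. y = 2 * f + 1" if "y \<in> ?Y" "odd y" for y
    using that by (auto simp: row_holes_def)
  have e_le: "e i \<le> e j" if "i \<le> j" "j \<le> m" for i j
    using strict_mono_on_leD[OF mono, of i j] that by auto
  have low: "e 0 \<le> f" if "f \<in> F" for f
  proof (rule ccontr)
    assume "\<not> e 0 \<le> f"
    have M: "Min ?Y \<in> ?Y" "\<And>u. u \<in> ?Y \<Longrightarrow> Min ?Y \<le> u" using finY Yf[OF that] by (auto intro: Min_in)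
    then have "even (Min ?Y)" by (rule alternating_Min[OF holes finY])
    then obtain i where "i \<le> m" "Min ?Y = 2 * e i" using evenY M(1) by blast
    then show False using M(2)[OF Yf[OF that]] e_le[of 0 i] \<open>\<not> e 0 \<le> f\<close> by auto
  qed
  have high: "f < e m" if "f \<in> F" for f
  proof (rule ccontr)
    assume "\<not> f < e m"
    have M: "Max ?Y \<in> ?Y" "\<And>u. u \<in> ?Y \<Longrightarrow> u \<le> Max ?Y" using finY Yf[OF that] by (auto intro: Max_in)
    then have "even (Max ?Y)" by (rule alternating_Max[OF holes finY])
    then obtain i where "i \<le> m" "Max ?Y = 2 * e i" using evenY M(1) by blast
    then show False using M(2)[OF Yf[OF that]] e_le[of i m] \<open>\<not> f < e m\<close> by auto
  qed
  have not_between: "i = j" if "i \<le> m" "Suc i \<le> m" "e i \<le> e j" "e j < e (Suc i)" "j \<le> m" for i j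
  proof (cases i j rule: linorder_cases)
    case less
    then show ?thesis using e_le[of "Suc i" j] that by simp
  next
    case greater
    then show ?thesis using strict_mono_onD[OF mono, of j i] that by simp
  qed
  have one: "\<exists>!f. f \<in> F \<and> e i \<le> f \<and> f < e (Suc i)" if i: "i < m" for i
  proof -
    have lt: "e i < e (Suc i)" using strict_mono_onD[OF mono, of i "Suc i"] i by auto
    have "\<exists>f. f \<in> F \<and> e i \<le> f \<and> f < e (Suc i)"
    proof (rule ccontr)
      assume none: "\<nexists>f. f \<in> F \<and> e i \<le> f \<and> f < e (Suc i)"
      have "even (2 * e i) \<longleftrightarrow> odd (2 * e (Suc i))"
      proof (rule alternating_consecutive[OF holes finY])
        fix u assume u: "u \<in> ?Y" "2 * e i < u"
        show "2 * e (Suc i) \<le> u"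
        proof (cases "even u")
          case True
          then obtain j where "j \<le> m" "u = 2 * e j" using evenY u by blast
          then show ?thesis using not_between[of i j] u i by (cases "e j < e (Suc i)") auto
        next
          case False
          then obtain f where f: "f \<in> F" "u = 2 * f + 1" using oddY u by blast
          then have "e i \<le> f" using u by simp
          then have "\<not> f < e (Suc i)" using none f by blast
          then show ?thesis using f by simp
        qed
      qed (use Ye i lt in auto)
      then show False by simp
    qed
    moreover have False if fh: "f \<in> F" "h \<in> F" "e i \<le> f" "f < h" "h < e (Suc i)" for f h
    proof -
      \<comment> \<open>\<open>?h\<close> is the next element of \<open>F\<close> after
        \<open>f\<close>. No even hole separates the two, so they would be consecutive holes of the
        same parity.\<close>
      let ?H = "{h \<in> F. f < h}"
      let ?h = "Min ?H"
      have H: "?h \<in> ?H" using finF fh by (intro Min_in) auto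
      have hle: "?h \<le> u" if "u \<in> ?H" for u using finF that by (intro Min_le) auto
      have "even (2 * f + 1) \<longleftrightarrow> odd (2 * ?h + 1)"
      proof (rule alternating_consecutive[OF holes finY])
        fix u assume u: "u \<in> ?Y" "2 * f + 1 < u"
        show "2 * ?h + 1 \<le> u"
        proof (cases "even u")
          case True
          then obtain j where j: "j \<le> m" "u = 2 * e j" using evenY u by blast
          have "\<not> e j < e (Suc i)"
          proof
            assume "e j < e (Suc i)"
            then have "i = j" using not_between[of i j] j u fh i by auto
            then show False using j u fh by auto
          qed
          then show ?thesis using j hle[of h] fh by auto
        next
          case False
          then obtain f' where "f' \<in> F" "u = 2 * f' + 1" using oddY u by blast
          then show ?thesis using hle[of f'] u by auto
        qed
      qed (use Yf fh H in auto)
      then show False by simp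
    qed
    ultimately show ?thesis by (meson linorder_neqE_nat)
  qed
  define g where "g = (\<lambda>i\<in>{..<m}. THE f. f \<in> F \<and> e i \<le> f \<and> f < e (Suc i))"
  have g: "g i \<in> F \<and> e i \<le> g i \<and> g i < e (Suc i)" if "i < m" for i
    using theI'[OF one[OF that]] that by (simp add: g_def)
  have "F \<subseteq> g ` {..<m}"
  proof
    fix f assume f: "f \<in> F"
    obtain i where i: "i < m" "e i \<le> f" "f < e (Suc i)"
      using ex_enclosing_index[OF low[OF f] high[OF f]] by blast
    then have "f = g i" using one[OF i(1)] g[OF i(1)] f by blast
    then show "f \<in> g ` {..<m}" using i by auto
  qed
  then have "F = g ` {..<m}" using g by auto
  moreover have "g \<in> PiE {..<m} (\<lambda>i. {e i..<e (Suc i)})" using g by (auto simp: g_def)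
  ultimately show ?thesis by blast
qed

text \<open>Merging the two sequences into one increasing sequence \<open>y\<close> puts even holes
  at even ranks and odd holes at odd ranks, because the rank of \<open>y t\<close> is
  \<open>t\<close>.\<close>

lemma interlacing_imp_alternating:
  assumes mono: "strict_mono_on {..<Suc m} e" and g: "g \<in> PiE {..<m} (\<lambda>i. {e i..<e (Suc i)})"
  shows "alternating (row_holes (e ` {..<Suc m}) (g ` {..<m}))" and "strict_mono_on {..<m} g"
proof -
  have gi: "e i \<le> g i" "g i < e (Suc i)" if "i < m" for i using PiE_mem[OF g, of i] that by auto
  have e_le: "e i \<le> e j" if "i \<le> j" "j \<le> m" for i j
    using strict_mono_on_leD[OF mono, of i j] that by auto
  have e_lt: "e i < e j" if "i < j" "j \<le> m" for i j
    using strict_mono_onD[OF mono, of i j] that by auto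
  show mono_g: "strict_mono_on {..<m} g"
  proof (rule strict_mono_onI)
    fix i j assume "i \<in> {..<m}" "j \<in> {..<m}" "i < j"
    then show "g i < g j" using gi(2)[of i] gi(1)[of j] e_le[of "Suc i" j] by auto
  qed
  define y where "y = (\<lambda>t. if even t then 2 * e (t div 2) else 2 * g (t div 2) + 1)"
  have y_even: "y (2 * s) = 2 * e s" and y_odd: "y (2 * s + 1) = 2 * g s + 1" for s
    by (simp_all add: y_def)
  let ?Y = "row_holes (e ` {..<Suc m}) (g ` {..<m})"
  have y_Suc: "y t < y (Suc t)" if "Suc t < 2 * m + 1" for t
  proof (cases "even t")
    case True
    then obtain s where "t = 2 * s" by blast
    then show ?thesis using gi[of s] that y_even[of s] y_odd[of s] by simp
  next
    case False
    then obtain s where "t = 2 * s + 1" by (elim oddE)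
    then show ?thesis using gi[of s] that y_even[of "Suc s"] y_odd[of s] by simp
  qed
  have y_mono: "y t < y u" if "t < u" "u < 2 * m + 1" for t u
    using that
  proof (induction u)
    case (Suc u)
    then show ?case using y_Suc[of u] by (cases "t = u") auto
  qed simp
  have Y: "?Y = y ` {..<2 * m + 1}"
  proof
    show "?Y \<subseteq> y ` {..<2 * m + 1}"
    proof
      fix z assume "z \<in> ?Y"
      then consider i where "i < Suc m" "z = 2 * e i" | i where "i < m" "z = 2 * g i + 1"
        by (auto simp: row_holes_def)
      then show "z \<in> y ` {..<2 * m + 1}"
      proof cases
        case 1
        then show ?thesis by (intro image_eqI[of _ _ "2 * i"]) (auto simp: y_even)
      next
        case 2
        then show ?thesis using y_odd[of i] by (intro image_eqI[of _ _ "2 * i + 1"]) auto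
      qed
    qed
    show "y ` {..<2 * m + 1} \<subseteq> ?Y"
    proof
      fix z assume "z \<in> y ` {..<2 * m + 1}"
      then obtain t where t: "t < 2 * m + 1" "z = y t" by auto
      show "z \<in> ?Y"
      proof (cases "even t")
        case True
        then obtain s where "t = 2 * s" by blast
        then show ?thesis using t y_even[of s] by (auto simp: row_holes_def)
      next
        case False
        then obtain s where "t = 2 * s + 1" by (elim oddE)
        then show ?thesis using t y_odd[of s] by (auto simp: row_holes_def)
      qed
    qed
  qed
  have inj: "inj_on y {..<2 * m + 1}"
  proof (rule inj_onI)
    fix t u assume tu: "t \<in> {..<2 * m + 1}" "u \<in> {..<2 * m + 1}" "y t = y u"
    show "t = u"
    proof (rule linorder_cases[of t u])
      assume "t < u"
      then show ?thesis using y_mono[of t u] tu by simp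
    next
      assume "u < t"
      then show ?thesis using y_mono[of u t] tu by simp
    qed simp
  qed
  have rank: "rank_below ?Y (y t) = t" if t: "t < 2 * m + 1" for t
  proof -
    have "{y' \<in> ?Y. y' < y t} = y ` {..<t}"
    proof
      show "y ` {..<t} \<subseteq> {y' \<in> ?Y. y' < y t}" using y_mono t unfolding Y by fastforce
      show "{y' \<in> ?Y. y' < y t} \<subseteq> y ` {..<t}"
      proof
        fix y' assume "y' \<in> {y' \<in> ?Y. y' < y t}"
        then obtain u where u: "u < 2 * m + 1" "y' = y u" "y u < y t" unfolding Y by auto
        have "u < t"
        proof (rule ccontr)
          assume "\<not> u < t"
          then have "y t \<le> y u" using y_mono[of t u] u(1) by (cases "t = u") auto
          then show False using u(3) by simp
        qed
        then show "y' \<in> y ` {..<t}" using u(2) by auto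
      qed
    qed
    moreover have "inj_on y {..<t}" using inj by (rule inj_on_subset) (use t in auto)
    ultimately show ?thesis by (simp add: rank_below_def card_image)
  qed
  have "even (y t + rank_below ?Y (y t))" if "t < 2 * m + 1" for t
    unfolding rank[OF that] by (simp add: y_def)
  moreover have "card ?Y = 2 * m + 1" unfolding Y using inj by (simp add: card_image)
  ultimately show "alternating ?Y" unfolding alternating_def using Y by fastforce
qed

lemma alternating_no_even:
  assumes "finite F" shows "\<not> alternating (row_holes {} F)"
proof
  assume a: "alternating (row_holes {} F)"
  let ?Y = "row_holes {} F"
  have fin: "finite ?Y" using assms by (simp add: row_holes_def)
  have "odd (card ?Y)" using a by (simp add: alternating_def)
  then have "?Y \<noteq> {}" by (metis card.empty even_zero)
  then have "Min ?Y \<in> ?Y" "even (Min ?Y)"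
    using alternating_Min[OF a fin, of "Min ?Y"] fin by auto
  then show False by (auto simp: row_holes_def)
qed

text \<open>A sum over sets becomes a sum over a product of intervals, one interval for each row of
  a determinant, as \<open>fun_det_sum_rows\<close> wants it. The intervals are disjoint, so a set
  determines its function.\<close>

lemma sum_alternating:
  fixes \<Phi> :: "nat set \<Rightarrow> real"
  assumes mono: "strict_mono_on {..<Suc m} e" and e: "e ` {..<Suc m} \<subseteq> {..<Suc W}"
  shows "(\<Sum>F\<in>Pow {..<W}. (if alternating (row_holes (e ` {..<Suc m}) F) then 1 else 0) * \<Phi> F)
    = (\<Sum>g\<in>PiE {..<m} (\<lambda>i. {e i..<e (Suc i)}). \<Phi> (g ` {..<m}))"
proof -
  let ?G = "PiE {..<m} (\<lambda>i. {e i..<e (Suc i)})"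
  let ?A = "{F \<in> Pow {..<W}. alternating (row_holes (e ` {..<Suc m}) F)}"
  have e_le: "e i \<le> e j" if "i \<le> j" "j \<le> m" for i j
    using strict_mono_on_leD[OF mono, of i j] that by auto
  have "(\<Sum>F\<in>Pow {..<W}. (if alternating (row_holes (e ` {..<Suc m}) F) then 1 else 0) * \<Phi> F) = (\<Sum>F\<in>?A. \<Phi> F)"
    by (subst sum.inter_filter) (auto intro!: sum.cong)
  also have "?A = (\<lambda>g. g ` {..<m}) ` ?G"
  proof
    show "?A \<subseteq> (\<lambda>g. g ` {..<m}) ` ?G"
    proof
      fix F assume "F \<in> ?A"
      then have F: "F \<subseteq> {..<W}" "alternating (row_holes (e ` {..<Suc m}) F)" by auto
      then have "finite F" using finite_subset by blast
      then show "F \<in> (\<lambda>g. g ` {..<m}) ` ?G"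
        using alternating_imp_interlacing[OF mono _ F(2)] by blast
    qed
    show "(\<lambda>g. g ` {..<m}) ` ?G \<subseteq> ?A"
    proof
      fix F assume "F \<in> (\<lambda>g. g ` {..<m}) ` ?G"
      then obtain g where g: "g \<in> ?G" "F = g ` {..<m}" by auto
      have "g i < W" if "i < m" for i
      proof -
        have "g i < e (Suc i)" using PiE_mem[OF g(1), of i] that by simp
        moreover have "e (Suc i) < Suc W" using e that by auto
        ultimately show ?thesis by simp
      qed
      then show "F \<in> ?A" using interlacing_imp_alternating(1)[OF mono g(1)] g(2) by auto
    qed
  qed
  also have "(\<Sum>F\<in>(\<lambda>g. g ` {..<m}) ` ?G. \<Phi> F) = (\<Sum>g\<in>?G. \<Phi> (g ` {..<m}))"
  proof (rule sum.reindex_cong[where l = "\<lambda>g. g ` {..<m}"])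
    show "inj_on (\<lambda>g. g ` {..<m}) ?G"
    proof (rule inj_onI)
      fix g h assume g: "g \<in> ?G" and h: "h \<in> ?G" and eq: "g ` {..<m} = h ` {..<m}"
      show "g = h"
      proof (rule PiE_ext[OF g h])
        fix i assume i: "i \<in> {..<m}"
        then obtain j where j: "j < m" "g i = h j" using eq by blast
        have bounds: "e i \<le> g i" "g i < e (Suc i)" "e j \<le> h j" "h j < e (Suc j)"
          using PiE_mem[OF g, of i] PiE_mem[OF h, of j] i j by auto
        have "i = j"
        proof (cases i j rule: linorder_cases)
          case less
          then show ?thesis using e_le[of "Suc i" j] bounds j by simp
        next
          case greater
          then show ?thesis using e_le[of "Suc j" i] bounds i j by simp
        qed
        then show "g i = h i" using j by simp
      qed
    qed
  qed auto
  finally show ?thesis .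
qed


section \<open>Trapezoids with a zigzag side and dents\<close>


text \<open>The half weights of a zigzag that runs through all lines: on the odd line
  \<open>k\<close> its western tip is the vertex with \<open>2 * i = - (k + 1)\<close>. Without
  bounds on the height the weight is invariant under reflection in the axis and common to all
  regions that occur.\<close>

definition zig_weight :: "lozenge \<Rightarrow> real" where
  "zig_weight l = (if \<exists>i k. l = {up_tri i k, down_tri i k} \<and> odd k \<and> 2 * i = - (k + 1) then 1 / 2 else 1)"

lemma zig_weight_pair:
  "zig_weight {up_tri i k, down_tri j h} = (if j = i \<and> h = k \<and> odd k \<and> 2 * i = - (k + 1) then 1 / 2 else 1)"
  unfolding zig_weight_def by (auto simp: doubleton_eq_iff)

text \<open>Strip \<open>k\<close> lies between the lines \<open>k\<close> and \<open>k + 1\<close>.  The even nodes of \<open>strip k\<close> are the up-pointing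
  triangles on line \<open>k\<close>, the odd nodes the down-pointing ones below line \<open>k + 1\<close>.  If \<open>k\<close> is even, the
  zigzag recedes and node 0 lies outside of the region; it is treated as a dent, so that
  the strips of both kinds start and end with an up-pointing triangle.\<close>

definition strip :: "nat \<Rightarrow> nat \<Rightarrow> triangle" where
  "strip k n = (if even n then up_tri (int (n div 2) - int (k div 2) - 1) (int k)
              else down_tri (int (n div 2) - int (k div 2) - 1) (int k + 1))"

lemma strip_even: "strip k (2 * j) = up_tri (int j - int (k div 2) - 1) (int k)"
  and strip_odd: "strip k (2 * j + 1) = down_tri (int j - int (k div 2) - 1) (int k + 1)"
  by (simp_all add: strip_def)

lemma strip_eq_iff: "strip k m = strip l n \<longleftrightarrow> k = l \<and> m = n"
proof
  assume eq: "strip k m = strip l n"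
  then have par: "even m \<longleftrightarrow> even n" by (auto simp: strip_def split: if_splits)
  show "k = l \<and> m = n"
  proof (cases "even m")
    case True
    with par obtain a b where "m = 2 * a" "n = 2 * b" by (auto elim!: evenE)
    then show ?thesis using eq by (auto simp: strip_even)
  next
    case False
    with par obtain a b where "m = 2 * a + 1" "n = 2 * b + 1" by (auto elim!: oddE)
    then show ?thesis using eq by (simp only: strip_odd) auto
  qed
qed simp

lemma inj_strip: "inj (strip k)"
  by (rule injI) (simp add: strip_eq_iff)

lemma not_lozenge: "\<not> is_lozenge {up_tri i k, up_tri j h}" "\<not> is_lozenge {down_tri i k, down_tri j h}"
  by (auto simp: is_lozenge_iff doubleton_eq_iff)

lemma is_lozenge_strip: "is_lozenge {strip k m, strip k n} \<longleftrightarrow> m = Suc n \<or> n = Suc m"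
proof -
  have *: "is_lozenge {strip k (2 * a), strip k (2 * b + 1)} \<longleftrightarrow> 2 * a = Suc (2 * b + 1) \<or> 2 * b + 1 = Suc (2 * a)" for a b
    unfolding strip_even strip_odd is_lozenge_pair_iff by auto
  consider "even m" "even n" | "even m" "odd n" | "odd m" "even n" | "odd m" "odd n" by auto
  then show ?thesis
  proof cases
    case 1
    then obtain a b where "m = 2 * a" "n = 2 * b" by (auto elim!: evenE)
    then show ?thesis by (simp add: strip_even not_lozenge) presburger
  next
    case 2
    then obtain a b where "m = 2 * a" "n = 2 * b + 1" by (auto elim!: evenE oddE)
    then show ?thesis using *[of a b] by auto
  next
    case 3
    then obtain a b where "m = 2 * b + 1" "n = 2 * a" by (auto elim!: evenE oddE)
    then show ?thesis using *[of a b] by (auto simp: insert_commute)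
  next
    case 4
    then obtain a b where "m = 2 * a + 1" "n = 2 * b + 1" by (auto elim!: oddE)
    then show ?thesis by (simp only: strip_odd not_lozenge) presburger
  qed
qed

lemma zig_weight_strip: "zig_weight {strip k n, strip k (Suc n)} = 1"
proof (cases "even n")
  case True
  then obtain a where "n = 2 * a" by blast
  then show ?thesis using strip_odd[of k a] by (simp add: strip_even zig_weight_pair)
next
  case False
  then obtain a where a: "n = 2 * a + 1" by (elim oddE)
  have "strip k (Suc n) = strip k (2 * (a + 1))" using a by simp
  then show ?thesis unfolding a using strip_odd[of k a] strip_even[of k "a + 1"]
    by (simp add: insert_commute zig_weight_pair)
qed

text \<open>The number of even nodes of strip \<open>k\<close>, counting node 0 outside the region
  when \<open>k\<close> is even. A strip that starts and ends with an up-pointing triangle has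
  \<open>2 * width k L - 1\<close> nodes.\<close>

definition width :: "nat \<Rightarrow> nat \<Rightarrow> nat" where
  "width k L = (if even k then L - k div 2 + 1 else L - k div 2)"

definition full_strip :: "nat \<Rightarrow> nat \<Rightarrow> region" where
  "full_strip k L = strip k ` ({0..<2 * width k L - 1} - (if even k then {0} else {}))"

definition upper_strips :: "nat \<Rightarrow> nat \<Rightarrow> nat \<Rightarrow> region" where
  "upper_strips k n L = (\<Union>r\<in>{k..<2 * n}. full_strip r L)"

text \<open>\<open>E\<close> consists of halved node numbers of the strip on line \<open>k\<close>;
  for even \<open>k\<close> it is meant to contain the artificial dent 0.\<close>

definition dented :: "nat \<Rightarrow> nat \<Rightarrow> nat \<Rightarrow> nat set \<Rightarrow> region" where
  "dented k n L E = strip k ` ({0..<2 * width k L - 1} - (\<lambda>e. 2 * e) ` E) \<union> upper_strips (Suc k) n L"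

text \<open>The vertical lozenges across line \<open>k\<close> are indexed by the down-pointing
  triangles below it and become dents of the part above. On an even line the artificial dent takes
  the number 0 and moves the others up by one.\<close>

definition dents_of :: "nat \<Rightarrow> nat set \<Rightarrow> nat set" where
  "dents_of k F = (if even k then insert 0 (Suc ` F) else F)"

lemma upper_strips_Suc:
  assumes "k < 2 * n"
  shows "upper_strips k n L = full_strip k L \<union> upper_strips (Suc k) n L"
proof -
  have "{k..<2 * n} = insert k {Suc k..<2 * n}" using assms by auto
  then show ?thesis by (simp add: upper_strips_def)
qed

lemma upper_strips_mem: "t \<in> upper_strips k n L \<Longrightarrow> \<exists>r m. k \<le> r \<and> r < 2 * n \<and> t = strip r m"
  by (auto simp: upper_strips_def full_strip_def)

text \<open>The region is cut along line \<open>k + 1\<close>, and \<open>F\<close> records the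
  vertical lozenges across it. The bottom strip with the holes from \<open>E\<close> and
  \<open>F\<close> is a path and contributes 0 or 1. Weight 1/2 occurs only at a tip of the zigzag,
  which needs \<open>k + 1\<close> odd and position 0.\<close>

lemma dented_step:
  assumes nL: "n \<le> L" and k: "Suc k < 2 * n" and E: "E \<subseteq> {..<width k L}" "finite E"
  shows "weighted_tilings zig_weight (dented k n L E)
    = (\<Sum>F\<in>Pow {..<width k L - 1}. (if alternating (row_holes E F) then 1 else 0)
        * ((\<Prod>j\<in>F. if even k \<and> j = 0 then 1 / 2 else 1)
           * weighted_tilings zig_weight (dented (Suc k) n L (dents_of (Suc k) F))))"
proof -
  let ?w = "width k L"
  define v where "v = (\<lambda>j. if even (Suc k) then 2 * j + 2 else 2 * j :: nat)"
  let ?R1 = "strip k ` ({0..<2 * ?w - 1} - (\<lambda>e. 2 * e) ` E)"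
  let ?R2 = "upper_strips (Suc k) n L"
  let ?A = "{..<?w - 1}"
  let ?U = "\<lambda>j. strip (Suc k) (v j)" and ?D = "\<lambda>j. strip k (2 * j + 1)"
  have kL: "k div 2 < L" "Suc k div 2 < L" using nL k by auto
  have w: "?w \<ge> 1" using kL by (auto simp: width_def)
  have vbound: "v j < 2 * width (Suc k) L - 1 \<and> (even (Suc k) \<longrightarrow> v j \<noteq> 0) \<longleftrightarrow> j < ?w - 1" for j
    using kL by (auto simp: v_def width_def)
  have U: "?U j = up_tri (int j - int (k div 2) - 1) (int k + 1)" for j
  proof (cases "even k")
    case True
    then have "Suc k div 2 = k div 2" "v j = 2 * j" by (auto simp: v_def)
    then show ?thesis by (simp add: strip_even add.commute)
  next
    case False
    then have "Suc k div 2 = k div 2 + 1" "v j = 2 * (j + 1)" by (auto simp: v_def)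
    then show ?thesis by (simp only: strip_even) simp
  qed
  have D: "?D j = down_tri (int j - int (k div 2) - 1) (int k + 1)" for j by (rule strip_odd)
  have fin: "finite ?R1" "finite ?R2" by (auto simp: upper_strips_def full_strip_def)
  have disj: "?R1 \<inter> ?R2 = {}" using upper_strips_mem[of _ "Suc k" n L] by (fastforce simp: strip_eq_iff)
  have "weighted_tilings zig_weight (?R1 \<union> ?R2) = (\<Sum>F\<in>Pow ?A.
     (\<Prod>j\<in>F. zig_weight {?U j, ?D j}) * weighted_tilings zig_weight (?R1 - ?D ` F)
       * weighted_tilings zig_weight (?R2 - ?U ` F))"
  proof (rule weighted_tilings_cut[OF fin disj])
    show "inj_on ?U ?A" "inj_on ?D ?A" by (auto simp: inj_on_def strip_eq_iff v_def split: if_splits)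
    fix j assume j: "j \<in> ?A"
    have "2 * j + 1 < 2 * ?w - 1" "2 * j + 1 \<noteq> 2 * e" for e using j by (auto, presburger)
    then have "?D j \<in> ?R1" by (intro imageI) auto
    moreover have "?U j \<in> full_strip (Suc k) L" using vbound[of j] j by (auto simp: full_strip_def)
    then have "?U j \<in> ?R2" using k by (simp add: upper_strips_Suc)
    moreover have "is_lozenge {?U j, ?D j}" unfolding U D by (simp add: is_lozenge_pair_iff)
    ultimately show "?D j \<in> ?R1 \<and> ?U j \<in> ?R2 \<and> is_lozenge {?U j, ?D j}" by blast
  next
    fix l assume l: "is_lozenge l" "l \<subseteq> ?R1 \<union> ?R2" "l \<inter> ?R1 \<noteq> {}" "l \<inter> ?R2 \<noteq> {}"
    from l(1) obtain i k' j h where eq: "l = {up_tri i k', down_tri j h}"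
      and adj: "(h = k' \<and> j = i) \<or> (h = k' + 1 \<and> (j = i \<or> j = i - 1))" unfolding is_lozenge_iff by blast
    have strip_up: "int r = k' \<and> even m" if "up_tri i k' = strip r m" for r m
      using that by (auto simp: strip_def split: if_splits)
    have strip_down: "int r + 1 = h \<and> odd m" if "down_tri j h = strip r m" for r m
      using that by (auto simp: strip_def split: if_splits)
    have R1_up: "k' = int k" if "up_tri i k' \<in> ?R1" using that strip_up by force
    have R1_down: "h = int k + 1" if "down_tri j h \<in> ?R1" using that strip_down by force
    have R2_up: "k' \<ge> int k + 1" if "up_tri i k' \<in> ?R2"
      using upper_strips_mem[OF that] strip_up by force
    have R2_down: "h \<ge> int k + 2" if "down_tri j h \<in> ?R2"
      using upper_strips_mem[OF that] strip_down by force
    have "up_tri i k' \<in> ?R2 \<and> down_tri j h \<in> ?R1"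
    proof (rule ccontr)
      assume "\<not> (up_tri i k' \<in> ?R2 \<and> down_tri j h \<in> ?R1)"
      then have "up_tri i k' \<in> ?R1 \<and> down_tri j h \<in> ?R2" using l(2-4) eq disj by auto
      then show False using R1_up R2_down adj by auto
    qed
    then have *: "up_tri i k' \<in> ?R2" "down_tri j h \<in> ?R1" by auto
    then have eqs: "k' = int k + 1" "h = int k + 1" "j = i" using R2_up R1_down adj by auto
    obtain m where m: "down_tri j h = strip k m" "m < 2 * ?w - 1" using *(2) by auto
    then have "odd m" using strip_down by blast
    then obtain s where s: "m = 2 * s + 1" by (elim oddE)
    then have Ds: "down_tri j h = ?D s" and "s \<in> ?A" using m by auto
    moreover have "j = int s - int (k div 2) - 1" using Ds unfolding D by simp
    then have "up_tri i k' = ?U s" using eqs by (simp add: U)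
    ultimately show "\<exists>j\<in>?A. l = {?U j, ?D j}" using eq by blast
  qed
  also have "\<dots> = (\<Sum>F\<in>Pow {..<width k L - 1}. (if alternating (row_holes E F) then 1 else 0)
        * ((\<Prod>j\<in>F. if even k \<and> j = 0 then 1 / 2 else 1)
           * weighted_tilings zig_weight (dented (Suc k) n L (dents_of (Suc k) F))))"
  proof (rule sum.cong)
    fix F assume F: "F \<in> Pow ?A"
    then have finF: "finite F" using finite_subset by blast
    have "zig_weight {?U j, ?D j} = (if even k \<and> j = 0 then 1 / 2 else 1)" for j
      unfolding U D zig_weight_pair by (auto elim!: evenE oddE)
    then have 1: "(\<Prod>j\<in>F. zig_weight {?U j, ?D j}) = (\<Prod>j\<in>F. if even k \<and> j = 0 then 1 / 2 else 1)" by simp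
    let ?Y = "row_holes E F"
    have "?R1 - ?D ` F = strip k ` ({0..<2 * ?w - 1} - ?Y)"
      using inj_strip[of k] by (auto simp: row_holes_def strip_eq_iff image_iff)
    moreover have "?Y \<subseteq> {0..<2 * ?w - 1}" using E(1) F w by (fastforce simp: row_holes_def)
    ultimately have 2: "weighted_tilings zig_weight (?R1 - ?D ` F) = (if alternating ?Y then 1 else 0)"
      using weighted_tilings_chain[where \<nu> = "strip k" and w = zig_weight, OF inj_strip is_lozenge_strip zig_weight_strip, of ?Y 0 "2 * ?w - 1"] w
      by (auto simp: alternating_def)
    have "full_strip (Suc k) L - ?U ` F
        = strip (Suc k) ` ({0..<2 * width (Suc k) L - 1} - (\<lambda>e. 2 * e) ` dents_of (Suc k) F)"
      by (auto simp: full_strip_def dents_of_def v_def strip_eq_iff image_iff)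
    moreover have "upper_strips (Suc (Suc k)) n L \<inter> ?U ` F = {}"
      using upper_strips_mem[of _ "Suc (Suc k)" n L] by (fastforce simp: strip_eq_iff)
    ultimately have "?R2 - ?U ` F = dented (Suc k) n L (dents_of (Suc k) F)"
      unfolding dented_def upper_strips_Suc[OF k] by auto
    then show "(\<Prod>j\<in>F. zig_weight {?U j, ?D j}) * weighted_tilings zig_weight (?R1 - ?D ` F)
       * weighted_tilings zig_weight (?R2 - ?U ` F)
      = (if alternating ?Y then 1 else 0) * ((\<Prod>j\<in>F. if even k \<and> j = 0 then 1 / 2 else 1)
           * weighted_tilings zig_weight (dented (Suc k) n L (dents_of (Suc k) F)))"
      unfolding 1 2 by (simp add: mult_ac)
  qed simp
  finally show ?thesis by (simp add: dented_def)
qed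

text \<open>No lozenge leaves through the north side, so the top strip has no odd holes.\<close>

lemma dented_last:
  assumes nL: "n \<le> L" and k: "Suc k = 2 * n" and E: "E \<subseteq> {..<width k L}"
  shows "weighted_tilings zig_weight (dented k n L E) = (if alternating (row_holes E {}) then 1 else 0)"
proof -
  let ?w = "width k L"
  have "k div 2 < L" using nL k by auto
  then have w: "?w \<ge> 1" by (auto simp: width_def)
  have "row_holes E {} \<subseteq> {0..<2 * ?w - 1}" using E w by (fastforce simp: row_holes_def)
  moreover have "dented k n L E = strip k ` ({0..<2 * ?w - 1} - row_holes E {})"
    using k by (simp add: dented_def upper_strips_def row_holes_def)
  ultimately show ?thesis
    using weighted_tilings_chain[where \<nu> = "strip k" and w = zig_weight, OF inj_strip is_lozenge_strip zig_weight_strip, of "row_holes E {}" 0 "2 * ?w - 1"] w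
    by (auto simp: alternating_def)
qed

lemma dented_step_enum:
  assumes "n \<le> L" "Suc k < 2 * n" "strict_mono_on {..<Suc m} e" "e ` {..<Suc m} \<subseteq> {..<width k L}"
  shows "weighted_tilings zig_weight (dented k n L (e ` {..<Suc m}))
    = (\<Sum>g\<in>PiE {..<m} (\<lambda>i. {e i..<e (Suc i)}). (\<Prod>i<m. if even k \<and> g i = 0 then 1 / 2 else 1)
           * weighted_tilings zig_weight (dented (Suc k) n L (dents_of (Suc k) (g ` {..<m}))))"
proof -
  have "0 < width k L" using assms(4) by auto
  then have W: "e ` {..<Suc m} \<subseteq> {..<Suc (width k L - 1)}" using assms(4) by simp
  have "(\<Prod>j\<in>g ` {..<m}. if even k \<and> j = 0 then 1 / 2 else 1 :: real) = (\<Prod>i<m. if even k \<and> g i = 0 then 1 / 2 else 1)"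
    if "g \<in> PiE {..<m} (\<lambda>i. {e i..<e (Suc i)})" for g
    using strict_mono_on_imp_inj_on[OF interlacing_imp_alternating(2)[OF assms(3) that]]
    by (simp add: prod.reindex)
  then show ?thesis
    unfolding dented_step[OF assms(1,2,4) finite_imageI[OF finite_lessThan]] sum_alternating[OF assms(3) W]
    by (intro sum.cong) auto
qed

text \<open>Interlacing is formulated for at least one dent. Without dents the bottom strip has no
  even hole, and the number of its odd holes cannot repair this.\<close>

lemma dented_no_dent:
  assumes "n \<le> L" "Suc k \<le> 2 * n"
  shows "weighted_tilings zig_weight (dented k n L {}) = 0"
proof (cases "Suc k = 2 * n")
  case True
  then show ?thesis using dented_last[OF assms(1) True] alternating_no_even[of "{}"] by simp
next
  case False
  then have "Suc k < 2 * n" using assms by simp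
  then have "weighted_tilings zig_weight (dented k n L {})
    = (\<Sum>F\<in>Pow {..<width k L - 1}. (if alternating (row_holes {} F) then 1 else 0)
        * ((\<Prod>j\<in>F. if even k \<and> j = 0 then 1 / 2 else 1)
           * weighted_tilings zig_weight (dented (Suc k) n L (dents_of (Suc k) F))))"
    using dented_step[OF assms(1), of k "{}"] by simp
  also have "\<dots> = 0"
  proof (rule sum.neutral, rule ballI)
    fix F assume "F \<in> Pow {..<width k L - 1}"
    then have "finite F" using finite_subset by blast
    then show "(if alternating (row_holes {} F) then 1 else 0)
        * ((\<Prod>j\<in>F. if even k \<and> j = 0 then 1 / 2 else 1)
           * weighted_tilings zig_weight (dented (Suc k) n L (dents_of (Suc k) F))) = 0"
      using alternating_no_even by simp
  qed
  finally show ?thesis .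
qed


section \<open>Central factorials and their differences\<close>

definition even_basis :: "nat \<Rightarrow> real \<Rightarrow> real" where
  "even_basis j x = (\<Prod>t<j. x\<^sup>2 - (real t)\<^sup>2)"

definition odd_basis :: "nat \<Rightarrow> real \<Rightarrow> real" where
  "odd_basis j x = x * (\<Prod>t<j. x\<^sup>2 - (real t + 1 / 2)\<^sup>2)"

text \<open>Up to normalisation these are central factorials, so that the central difference
  of one is a multiple of the other.\<close>

lemma even_basis_shift:
  "even_basis (Suc j) (x + 1 / 2) = (x + 1 / 2) * (x + 1 / 2 + real j) * (\<Prod>t<j. x\<^sup>2 - (real t + 1 / 2)\<^sup>2)"
proof (induction j)
  case 0
  then show ?case by (simp add: even_basis_def power2_eq_square)
next
  case (Suc j)
  let ?C = "\<Prod>t<j. x\<^sup>2 - (real t + 1 / 2)\<^sup>2"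
  have "even_basis (Suc (Suc j)) (x + 1 / 2)
      = (x + 1 / 2) * (x + 1 / 2 + real j) * ?C * ((x + 1 / 2)\<^sup>2 - (real (Suc j))\<^sup>2)"
    using Suc by (simp add: even_basis_def)
  also have "\<dots> = (x + 1 / 2) * ((x + 1 / 2 + real j) * ((x + 1 / 2)\<^sup>2 - (real (Suc j))\<^sup>2)) * ?C"
    by (simp only: mult_ac)
  also have "(x + 1 / 2 + real j) * ((x + 1 / 2)\<^sup>2 - (real (Suc j))\<^sup>2)
      = (x + 1 / 2 + real (Suc j)) * (x\<^sup>2 - (real j + 1 / 2)\<^sup>2)"
    by (simp add: power2_eq_square field_simps)
  also have "(x + 1 / 2) * \<dots> * ?C
      = (x + 1 / 2) * (x + 1 / 2 + real (Suc j)) * (?C * (x\<^sup>2 - (real j + 1 / 2)\<^sup>2))"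
    by (simp only: mult_ac)
  finally show ?case by simp
qed

text \<open>\<open>even_basis\<close> is an even function, so the shift formula at \<open>x\<close>
  and at \<open>- x\<close> yields both values; the two prefactors differ by
  \<open>(2 * real j + 2) * x\<close>.\<close>

lemma even_basis_diff:
  "even_basis (Suc j) (x + 1 / 2) - even_basis (Suc j) (x - 1 / 2) = (2 * real j + 2) * odd_basis j x"
proof -
  have "even_basis (Suc j) (x - 1 / 2) = even_basis (Suc j) (- x + 1 / 2)"
  proof -
    have "(x - 1 / 2)\<^sup>2 = (- x + 1 / 2)\<^sup>2" by (simp add: power2_eq_square algebra_simps)
    then show ?thesis by (simp add: even_basis_def)
  qed
  then show ?thesis unfolding even_basis_shift odd_basis_def by (simp add: field_simps)
qed

lemma odd_basis_shift: "x * odd_basis j (x + 1 / 2) = (x + 1 / 2) * (x + real j) * even_basis j x"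
proof (induction j)
  case (Suc j)
  have 1: "odd_basis (Suc j) (x + 1 / 2) = odd_basis j (x + 1 / 2) * ((x - real j) * (x + real j + 1))"
  proof -
    have "(x + 1 / 2)\<^sup>2 - (real j + 1 / 2)\<^sup>2 = (x - real j) * (x + real j + 1)"
      by (simp add: power2_eq_square field_simps)
    then show ?thesis unfolding odd_basis_def by simp
  qed
  have 2: "even_basis (Suc j) x = even_basis j x * ((x - real j) * (x + real j))"
  proof -
    have "x\<^sup>2 - (real j)\<^sup>2 = (x - real j) * (x + real j)"
      by (simp add: power2_eq_square field_simps)
    then show ?thesis unfolding even_basis_def by simp
  qed
  have "x * odd_basis (Suc j) (x + 1 / 2) = (x * odd_basis j (x + 1 / 2)) * ((x - real j) * (x + real j + 1))"
    unfolding 1 by simp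
  then show ?case unfolding Suc 2 by (simp add: mult_ac)
qed (simp add: odd_basis_def even_basis_def)

text \<open>As before, now with the oddness of \<open>odd_basis\<close>. The shift formula carries a
  factor \<open>x\<close>, and cancelling it at the end uses \<open>x \<noteq> 0\<close>; the
  summation treats position 0 separately.\<close>

lemma odd_basis_diff:
  assumes "x \<noteq> 0"
  shows "odd_basis j (x + 1 / 2) - odd_basis j (x - 1 / 2) = (2 * real j + 1) * even_basis j x"
proof -
  have "odd_basis j (x - 1 / 2) = - odd_basis j (- x + 1 / 2)"
  proof -
    have "(x - 1 / 2)\<^sup>2 = (- x + 1 / 2)\<^sup>2" by (simp add: power2_eq_square algebra_simps)
    then show ?thesis by (simp add: odd_basis_def algebra_simps)
  qed
  then have "x * (odd_basis j (x + 1 / 2) - odd_basis j (x - 1 / 2))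
      = x * odd_basis j (x + 1 / 2) - (- x) * odd_basis j (- x + 1 / 2)" by (simp add: algebra_simps)
  also have "even_basis j (- x) = even_basis j x" by (simp add: even_basis_def)
  then have "x * odd_basis j (x + 1 / 2) - (- x) * odd_basis j (- x + 1 / 2)
      = (x + 1 / 2) * (x + real j) * even_basis j x - (- x + 1 / 2) * (- x + real j) * even_basis j x"
    by (simp only: odd_basis_shift)
  also have "\<dots> = x * ((2 * real j + 1) * even_basis j x)" by (simp add: field_simps)
  finally have "x * (odd_basis j (x + 1 / 2) - odd_basis j (x - 1 / 2))
      = x * ((2 * real j + 1) * even_basis j x)" .
  then show ?thesis using assms by simp
qed

text \<open>A discrete antiderivative of \<open>even_basis\<close> with half weight at 0. By
  oddness, \<open>odd_basis j (1/2) - odd_basis j (- 1/2)\<close> is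
  \<open>2 * odd_basis j (1/2)\<close>; starting with 0 instead of the value at \<open>- 1/2\<close>
  keeps exactly half of it.\<close>

definition cumulated_even :: "nat \<Rightarrow> nat \<Rightarrow> real" where
  "cumulated_even j x = (if x = 0 then 0 else odd_basis j (real x - 1 / 2) / (2 * real j + 1))"

lemma cumulated_even_diff:
  "(if f = 0 then 1 / 2 else 1) * even_basis j (real f) = cumulated_even j (Suc f) - cumulated_even j f"
proof (cases "f = 0")
  case True
  have "odd_basis j (1 / 2) = (if j = 0 then 1 / 2 else 0)"
    by (cases j) (simp_all add: odd_basis_def prod.lessThan_Suc_shift del: prod.lessThan_Suc)
  moreover have "even_basis j 0 = (if j = 0 then 1 else 0)"
    by (cases j) (simp_all add: even_basis_def prod.lessThan_Suc_shift del: prod.lessThan_Suc)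
  ultimately show ?thesis using True by (simp add: cumulated_even_def)
next
  case False
  have "2 * real j + 1 \<noteq> 0" by linarith
  then have "even_basis j (real f)
      = (odd_basis j (real f + 1 / 2) - odd_basis j (real f - 1 / 2)) / (2 * real j + 1)"
    using odd_basis_diff[of "real f" j] False by simp
  moreover have "real (Suc f) - 1 / 2 = real f + 1 / 2" by simp
  ultimately show ?thesis unfolding cumulated_even_def using False by (simp add: diff_divide_distrib add.commute)
qed

lemma sum_even_basis:
  "a \<le> b \<Longrightarrow> (\<Sum>f\<in>{a..<b}. (if f = 0 then 1 / 2 else 1) * even_basis j (real f))
     = cumulated_even j b - cumulated_even j a"
  unfolding cumulated_even_diff using sum_Suc_diff'[of a b "cumulated_even j"] by simp

lemma sum_odd_basis:
  "a \<le> b \<Longrightarrow> (\<Sum>f\<in>{a..<b}. odd_basis j (real f + 1 / 2))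
     = (even_basis (Suc j) (real b) - even_basis (Suc j) (real a)) / (2 * real j + 2)"
proof -
  assume ab: "a \<le> b"
  have "odd_basis j (real f + 1 / 2)
      = even_basis (Suc j) (real (Suc f)) / (2 * real j + 2) - even_basis (Suc j) (real f) / (2 * real j + 2)" for f
  proof -
    have "real f + 1 / 2 + 1 / 2 = real (Suc f)" "real f + 1 / 2 - 1 / 2 = real f" "2 * real j + 2 \<noteq> 0"
      by simp_all
    then show ?thesis using even_basis_diff[of j "real f + 1 / 2"]
      by (simp only: diff_divide_distrib[symmetric]) simp
  qed
  then have "(\<Sum>f\<in>{a..<b}. odd_basis j (real f + 1 / 2))
      = (\<Sum>f\<in>{a..<b}. even_basis (Suc j) (real (Suc f)) / (2 * real j + 2) - even_basis (Suc j) (real f) / (2 * real j + 2))"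
    by simp
  also have "\<dots> = even_basis (Suc j) (real b) / (2 * real j + 2) - even_basis (Suc j) (real a) / (2 * real j + 2)"
    using sum_Suc_diff'[OF ab, of "\<lambda>f. even_basis (Suc j) (real f) / (2 * real j + 2)"] by simp
  finally show ?thesis by (simp add: diff_divide_distrib)
qed

section \<open>The determinant formula, one strip at a time\<close>

definition trap_const :: "nat \<Rightarrow> real" where
  "trap_const r = (\<Prod>i<r. 1 / fact (2 * i + 1))"

text \<open>A strip with even bottom line divides column \<open>j\<close> of the determinant by
  \<open>2 * j + 1\<close>, one with odd bottom line by \<open>2 * j + 2\<close>. Two consecutive
  strips thus combine to one factor of \<open>trap_const\<close>.\<close>

lemma fact_odd_split: "fact (2 * r + 1) = (\<Prod>j<r. 2 * real j + 2) * (\<Prod>j<Suc r. 2 * real j + 1)"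
proof (induction r)
  case (Suc r)
  have "fact (2 * Suc r + 1) = (2 * real r + 3) * (2 * real r + 2) * (fact (2 * r + 1) :: real)"
    by (simp add: algebra_simps)
  then show ?case unfolding Suc by (simp add: algebra_simps)
qed simp

text \<open>There are \<open>2 * r + 1\<close> strips above the odd line \<open>k\<close>. The
  arguments \<open>real (e i)\<close>, and \<open>real (e (Suc i)) - 1 / 2\<close> on even lines,
  are the \<open>u\<close>-coordinates of the middles of the dents. Quantifying over all other
  parameters lets either formula be proved from the other, one strip higher.\<close>

definition odd_line_formula :: "nat \<Rightarrow> bool" where
  "odd_line_formula r \<longleftrightarrow> (\<forall>n L k m e. n \<le> L \<longrightarrow> k + 2 * r + 1 = 2 * n \<longrightarrow> strict_mono_on {..<m} e \<longrightarrow>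
     e ` {..<m} \<subseteq> {..<width k L} \<longrightarrow>
     weighted_tilings zig_weight (dented k n L (e ` {..<m}))
       = (if m = Suc r then trap_const r / (\<Prod>j<r. 2 * real j + 2) * fun_det (Suc r) (\<lambda>i j. even_basis j (real (e i)))
          else 0))"

definition even_line_formula :: "nat \<Rightarrow> bool" where
  "even_line_formula r \<longleftrightarrow> (\<forall>n L k m e. n \<le> L \<longrightarrow> k + 2 * r = 2 * n \<longrightarrow> strict_mono_on {..<Suc m} e \<longrightarrow>
     e ` {..<Suc m} \<subseteq> {..<width k L} \<longrightarrow> e 0 = 0 \<longrightarrow>
     weighted_tilings zig_weight (dented k n L (e ` {..<Suc m}))
       = (if m = r then trap_const r * fun_det r (\<lambda>i j. odd_basis j (real (e (Suc i)) - 1 / 2)) else 0))"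

lemma odd_line_formula_0: "odd_line_formula 0"
  unfolding odd_line_formula_def
proof (intro allI impI)
  fix n L k m :: nat and e :: "nat \<Rightarrow> nat"
  assume n: "n \<le> L" "k + 2 * 0 + 1 = 2 * n" and e: "strict_mono_on {..<m} e" "e ` {..<m} \<subseteq> {..<width k L}"
  have last: "weighted_tilings zig_weight (dented k n L (e ` {..<m}))
      = (if alternating (row_holes (e ` {..<m}) {}) then 1 else 0)"
    by (rule dented_last) (use n e in auto)
  have "alternating (row_holes (e ` {..<m}) {}) \<longleftrightarrow> m = 1"
  proof
    assume a: "alternating (row_holes (e ` {..<m}) {})"
    show "m = 1"
    proof (cases m)
      case 0
      then show ?thesis using a alternating_no_even[of "{}"] by simp
    next
      case (Suc m')
      then obtain g where "g \<in> PiE {..<m'} (\<lambda>i. {e i..<e (Suc i)})" "{} = g ` {..<m'}"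
        using alternating_imp_interlacing[of m' e "{}"] a e(1) by auto
      then show ?thesis using Suc by auto
    qed
  next
    assume "m = 1"
    then show "alternating (row_holes (e ` {..<m}) {})"
      using interlacing_imp_alternating(1)[of 0 e "\<lambda>_. undefined"] e(1) by simp
  qed
  then show "weighted_tilings zig_weight (dented k n L (e ` {..<m}))
       = (if m = Suc 0 then trap_const 0 / (\<Prod>j<0. 2 * real j + 2) * fun_det (Suc 0) (\<lambda>i j. even_basis j (real (e i)))
          else 0)"
    using last by (simp add: trap_const_def fun_det_first_col even_basis_def)
qed

text \<open>Summation over the interlacing row turns the entries \<open>even_basis\<close> into
  differences of antiderivatives. Since \<open>e 0 = 0\<close> has antiderivative 0, the first row
  is already a value and row operations reduce the others to values; these are multiples of
  \<open>odd_basis\<close>.\<close>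

lemma even_line_formula_Suc:
  assumes IH: "odd_line_formula r"
  shows "even_line_formula (Suc r)"
  unfolding even_line_formula_def
proof (intro allI impI)
  fix n L k m :: nat and e :: "nat \<Rightarrow> nat"
  assume n: "n \<le> L" "k + 2 * Suc r = 2 * n" and e: "strict_mono_on {..<Suc m} e" "e ` {..<Suc m} \<subseteq> {..<width k L}"
    and e0: "e 0 = 0"
  have k: "even k" "Suc k < 2 * n" "Suc k + 2 * r + 1 = 2 * n" using n by presburger+
  let ?G = "PiE {..<m} (\<lambda>i. {e i..<e (Suc i)})"
  let ?c = "trap_const r / (\<Prod>j<r. 2 * real j + 2)"
  have le: "e i \<le> e (Suc i)" if "i < m" for i
    using strict_mono_on_leD[OF e(1), of i "Suc i"] that by auto
  have IHg: "weighted_tilings zig_weight (dented (Suc k) n L (dents_of (Suc k) (g ` {..<m})))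
      = (if m = Suc r then ?c * fun_det (Suc r) (\<lambda>i j. even_basis j (real (g i))) else 0)" if g: "g \<in> ?G" for g
  proof -
    have "g i < width (Suc k) L" if "i < m" for i
    proof -
      have "g i < e (Suc i)" using PiE_mem[OF g, of i] that by simp
      moreover have "e (Suc i) < width k L" using e(2) that by auto
      moreover have "width k L \<le> Suc (width (Suc k) L)" using k(1) by (simp add: width_def)
      ultimately show ?thesis by simp
    qed
    then have "g ` {..<m} \<subseteq> {..<width (Suc k) L}" by auto
    then show ?thesis
      using IH[unfolded odd_line_formula_def, rule_format, OF n(1) k(3)
          interlacing_imp_alternating(2)[OF e(1) g]] k(1) by (auto simp: dents_of_def)
  qed
  have "weighted_tilings zig_weight (dented k n L (e ` {..<Suc m}))
    = (\<Sum>g\<in>?G. (\<Prod>i<m. if even k \<and> g i = 0 then 1 / 2 else 1)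
           * weighted_tilings zig_weight (dented (Suc k) n L (dents_of (Suc k) (g ` {..<m}))))"
    by (rule dented_step_enum[OF n(1) k(2) e])
  also have "\<dots> = (\<Sum>g\<in>?G. (\<Prod>i<m. if g i = 0 then 1 / 2 else 1)
           * (if m = Suc r then ?c * fun_det (Suc r) (\<lambda>i j. even_basis j (real (g i))) else 0))"
    using k(1) IHg by (intro sum.cong) auto
  also have "\<dots> = (if m = Suc r then trap_const (Suc r) * fun_det (Suc r) (\<lambda>i j. odd_basis j (real (e (Suc i)) - 1 / 2)) else 0)"
  proof (cases "m = Suc r")
    case True
    have "(\<Sum>g\<in>?G. (\<Prod>i<m. if g i = 0 then 1 / 2 else 1) * (?c * fun_det (Suc r) (\<lambda>i j. even_basis j (real (g i)))))
        = ?c * (\<Sum>g\<in>?G. fun_det m (\<lambda>i j. (if g i = 0 then 1 / 2 else 1) * even_basis j (real (g i))))"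
      unfolding True[symmetric] fun_det_scale_rows sum_distrib_left by (simp only: mult_ac)
    also have "(\<Sum>g\<in>?G. fun_det m (\<lambda>i j. (if g i = 0 then 1 / 2 else 1) * even_basis j (real (g i))))
        = fun_det m (\<lambda>i j. \<Sum>f\<in>{e i..<e (Suc i)}. (if f = 0 then 1 / 2 else 1) * even_basis j (real f))"
      by (rule fun_det_sum_rows[symmetric]) simp
    also have "\<dots> = fun_det m (\<lambda>i j. cumulated_even j (e (Suc i)) - cumulated_even j (e i))"
      by (rule fun_det_cong) (use le in \<open>simp add: sum_even_basis\<close>)
    also have "\<dots> = fun_det m (\<lambda>i j. if i = 0 then cumulated_even j (e (Suc 0))
        else cumulated_even j (e (Suc i)) + (- 1) * cumulated_even j (e (Suc (i - 1))))"
      by (rule fun_det_cong) (auto simp: e0 cumulated_even_def)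
    also have "\<dots> = fun_det m (\<lambda>i j. cumulated_even j (e (Suc i)))"
      by (rule fun_det_add_previous_rows)
    also have "\<dots> = fun_det m (\<lambda>i j. 1 / (2 * real j + 1) * odd_basis j (real (e (Suc i)) - 1 / 2))"
    proof (rule fun_det_cong)
      fix i j assume "i < m"
      then have "e 0 < e (Suc i)" using strict_mono_onD[OF e(1), of 0 "Suc i"] by simp
      then show "cumulated_even j (e (Suc i)) = 1 / (2 * real j + 1) * odd_basis j (real (e (Suc i)) - 1 / 2)"
        by (simp add: cumulated_even_def)
    qed
    also have "\<dots> = (\<Prod>j<Suc r. 1 / (2 * real j + 1)) * fun_det (Suc r) (\<lambda>i j. odd_basis j (real (e (Suc i)) - 1 / 2))"
      unfolding fun_det_scale_cols True ..
    also have "?c * \<dots> = trap_const (Suc r) * fun_det (Suc r) (\<lambda>i j. odd_basis j (real (e (Suc i)) - 1 / 2))"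
    proof -
      have "?c * (\<Prod>j<Suc r. 1 / (2 * real j + 1)) = trap_const (Suc r)"
        unfolding trap_const_def prod.lessThan_Suc[of "\<lambda>i. 1 / fact (2 * i + 1)"] fact_odd_split prod_dividef
        by simp
      then show ?thesis by (simp only: mult.assoc[symmetric])
    qed
    finally show ?thesis using True by simp
  qed simp
  finally show "weighted_tilings zig_weight (dented k n L (e ` {..<Suc m}))
       = (if m = Suc r then trap_const (Suc r) * fun_det (Suc r) (\<lambda>i j. odd_basis j (real (e (Suc i)) - 1 / 2)) else 0)" .
qed

text \<open>Here the differences have no initial value 0. They form the minor that remains of a
  determinant with one more row when consecutive rows are subtracted: its first column is
  \<open>even_basis 0\<close>, constantly 1.\<close>

lemma odd_line_formula_Suc:
  assumes IH: "even_line_formula (Suc r)"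
  shows "odd_line_formula (Suc r)"
  unfolding odd_line_formula_def
proof (intro allI impI)
  fix n L k m' :: nat and e :: "nat \<Rightarrow> nat"
  assume n: "n \<le> L" "k + 2 * Suc r + 1 = 2 * n" and e': "strict_mono_on {..<m'} e" "e ` {..<m'} \<subseteq> {..<width k L}"
  have k: "odd k" "Suc k < 2 * n" "Suc k + 2 * Suc r = 2 * n" using n by presburger+
  show "weighted_tilings zig_weight (dented k n L (e ` {..<m'}))
       = (if m' = Suc (Suc r) then trap_const (Suc r) / (\<Prod>j<Suc r. 2 * real j + 2)
            * fun_det (Suc (Suc r)) (\<lambda>i j. even_basis j (real (e i))) else 0)"
  proof (cases m')
    case 0
    then show ?thesis using dented_no_dent[OF n(1), of k] k(2) by simp
  next
    case (Suc m)
    note e = e'[unfolded Suc]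
    let ?G = "PiE {..<m} (\<lambda>i. {e i..<e (Suc i)})"
    let ?c = "trap_const (Suc r)"
    have le: "e i \<le> e (Suc i)" if "i < m" for i
      using strict_mono_on_leD[OF e(1), of i "Suc i"] that by auto
    have IHg: "weighted_tilings zig_weight (dented (Suc k) n L (dents_of (Suc k) (g ` {..<m})))
        = (if m = Suc r then ?c * fun_det (Suc r) (\<lambda>i j. odd_basis j (real (g i) + 1 / 2)) else 0)" if g: "g \<in> ?G" for g
    proof -
      \<comment> \<open>The artificial dent 0 of the even line is put in front of the crossing
        positions, which move up by one.\<close>
      define g' where "g' = case_nat 0 (\<lambda>i. Suc (g i))"
      have "{..<Suc m} = insert 0 (Suc ` {..<m})" by (rule lessThan_Suc_eq_insert_0)
      then have im: "g' ` {..<Suc m} = dents_of (Suc k) (g ` {..<m})"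
        using k(1) by (simp add: g'_def dents_of_def image_image)
      have "g i < width (Suc k) L - 1" if "i < m" for i
      proof -
        have "g i < e (Suc i)" using PiE_mem[OF g, of i] that by simp
        moreover have "e (Suc i) < width k L" using e(2) that by auto
        moreover have "width k L \<le> Suc (width (Suc k) L - 1)" using k(1) by (simp add: width_def)
        ultimately show ?thesis by simp
      qed
      moreover have "0 < width (Suc k) L" using k(1) by (simp add: width_def)
      ultimately have range: "g' ` {..<Suc m} \<subseteq> {..<width (Suc k) L}"
        unfolding im using k(1) by (fastforce simp: dents_of_def)
      have "strict_mono_on {..<Suc m} g'"
      proof (rule strict_mono_onI)
        fix i j assume ij: "i \<in> {..<Suc m}" "j \<in> {..<Suc m}" "i < j"
        then show "g' i < g' j"
          using strict_mono_onD[OF interlacing_imp_alternating(2)[OF e(1) g], of "i - 1" "j - 1"]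
          by (cases i; cases j) (auto simp: g'_def)
      qed
      from IH[unfolded even_line_formula_def, rule_format, OF n(1) k(3) this range]
      show ?thesis unfolding im by (simp add: g'_def add.commute) 
    qed
    have "weighted_tilings zig_weight (dented k n L (e ` {..<Suc m}))
      = (\<Sum>g\<in>?G. (\<Prod>i<m. if even k \<and> g i = 0 then 1 / 2 else 1)
             * weighted_tilings zig_weight (dented (Suc k) n L (dents_of (Suc k) (g ` {..<m}))))"
      by (rule dented_step_enum[OF n(1) k(2) e])
    also have "\<dots> = (\<Sum>g\<in>?G. if m = Suc r then ?c * fun_det (Suc r) (\<lambda>i j. odd_basis j (real (g i) + 1 / 2)) else 0)"
      using k(1) IHg by (intro sum.cong) auto
    also have "\<dots> = (if m = Suc r then ?c / (\<Prod>j<Suc r. 2 * real j + 2)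
            * fun_det (Suc (Suc r)) (\<lambda>i j. even_basis j (real (e i))) else 0)"
    proof (cases "m = Suc r")
      case True
      have "(\<Sum>g\<in>?G. ?c * fun_det (Suc r) (\<lambda>i j. odd_basis j (real (g i) + 1 / 2)))
          = ?c * (\<Sum>g\<in>?G. fun_det m (\<lambda>i j. odd_basis j (real (g i) + 1 / 2)))"
        using True by (simp add: sum_distrib_left)
      also have "(\<Sum>g\<in>?G. fun_det m (\<lambda>i j. odd_basis j (real (g i) + 1 / 2)))
          = fun_det m (\<lambda>i j. \<Sum>f\<in>{e i..<e (Suc i)}. odd_basis j (real f + 1 / 2))"
        by (rule fun_det_sum_rows[symmetric]) simp
      also have "\<dots> = fun_det m (\<lambda>i j. 1 / (2 * real j + 2)
          * (even_basis (Suc j) (real (e (Suc i))) - even_basis (Suc j) (real (e i))))"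
        by (rule fun_det_cong) (use le in \<open>simp add: sum_odd_basis\<close>)
      also have "\<dots> = (\<Prod>j<m. 1 / (2 * real j + 2))
          * fun_det m (\<lambda>i j. even_basis (Suc j) (real (e (Suc i))) - even_basis (Suc j) (real (e i)))"
        by (rule fun_det_scale_cols)
      also have "fun_det m (\<lambda>i j. even_basis (Suc j) (real (e (Suc i))) - even_basis (Suc j) (real (e i)))
          = fun_det (Suc m) (\<lambda>i j. even_basis j (real (e i)))"
      proof -
        let ?f = "\<lambda>i j. even_basis j (real (e i))"
        have "fun_det (Suc m) ?f = fun_det (Suc m) (\<lambda>i j. if i = 0 then ?f 0 j else ?f i j + (- 1) * ?f (i - 1) j)"
          by (rule fun_det_add_previous_rows[symmetric])
        also have "\<dots> = fun_det m (\<lambda>i j. ?f (Suc i) (Suc j) - ?f i (Suc j))"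
          by (subst fun_det_first_col) (auto simp: even_basis_def)
        finally show ?thesis by simp
      qed
      finally show ?thesis using True by (simp add: prod_dividef)
    qed simp
    finally show ?thesis unfolding Suc by simp
  qed
qed

lemma odd_line_formula: "odd_line_formula r"
  by (induction r) (simp_all add: odd_line_formula_0 odd_line_formula_Suc even_line_formula_Suc)

lemma even_line_formula: "even_line_formula (Suc r)"
  by (rule even_line_formula_Suc[OF odd_line_formula])

definition dent_formula :: "nat set \<Rightarrow> real" where
  "dent_formula S = trap_const (card S) * (\<Prod>s\<in>S. real s + 1 / 2) * vdm S"

theorem weighted_tilings_dented:
  assumes n: "0 < n" "n \<le> L" and S: "S \<subseteq> {..<L}"
  shows "weighted_tilings zig_weight (dented 0 n L (insert 0 (Suc ` S))) = (if card S = n then dent_formula S else 0)"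
proof -
  have finS: "finite S" using S finite_subset by blast
  let ?m = "card S"
  obtain d where d: "bij_betw d {..<?m} S" "strict_mono_on {..<?m} d"
    using ex_bij_betw_strict_mono_card[OF finS] by blast
  define e where "e = case_nat 0 (\<lambda>i. Suc (d i))"
  have dS: "d ` {..<?m} = S" using d(1) by (rule bij_betw_imp_surj_on)
  have "{..<Suc ?m} = insert 0 (Suc ` {..<?m})" by (rule lessThan_Suc_eq_insert_0)
  then have "e ` {..<Suc ?m} = insert 0 (Suc ` d ` {..<?m})" by (simp add: e_def image_image)
  then have im: "e ` {..<Suc ?m} = insert 0 (Suc ` S)" unfolding dS .
  have range: "e ` {..<Suc ?m} \<subseteq> {..<width 0 L}" unfolding im using S by (auto simp: width_def)
  have mono: "strict_mono_on {..<Suc ?m} e"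
  proof (rule strict_mono_onI)
    fix i j assume ij: "i \<in> {..<Suc ?m}" "j \<in> {..<Suc ?m}" "i < j"
    then show "e i < e j"
      using strict_mono_onD[OF d(2), of "i - 1" "j - 1"] by (cases i; cases j) (auto simp: e_def)
  qed
  obtain r where r: "n = Suc r" using n by (cases n) auto
  have "weighted_tilings zig_weight (dented 0 n L (e ` {..<Suc ?m}))
       = (if ?m = n then trap_const n * fun_det n (\<lambda>i j. odd_basis j (real (e (Suc i)) - 1 / 2)) else 0)"
    using even_line_formula[of r, unfolded even_line_formula_def, rule_format, OF n(2) _ mono range] r
    by (simp add: e_def)
  moreover have "fun_det n (\<lambda>i j. odd_basis j (real (e (Suc i)) - 1 / 2)) = (\<Prod>s\<in>S. real s + 1 / 2) * vdm S"
    if "?m = n"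
  proof -
    have "odd_basis j (real (e (Suc i)) - 1 / 2) = (real (d i) + 1 / 2) * (\<Prod>t<j. sqc (d i) - sqc t)" for i j
      by (simp add: e_def odd_basis_def sqc_def add.commute)
    then have "fun_det n (\<lambda>i j. odd_basis j (real (e (Suc i)) - 1 / 2))
        = (\<Prod>i<n. real (d i) + 1 / 2) * (\<Prod>i<n. \<Prod>j<i. sqc (d i) - sqc (d j))"
      by (simp add: fun_det_scale_rows fun_det_Newton[of n "\<lambda>i. sqc (d i)" sqc])
    also have "(\<Prod>i<n. real (d i) + 1 / 2) = (\<Prod>s\<in>S. real s + 1 / 2)"
      using prod.reindex_bij_betw[OF d(1), of "\<lambda>s. real s + 1 / 2"] that by simp
    also have "(\<Prod>i<n. \<Prod>j<i. sqc (d i) - sqc (d j)) = vdm S"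
      using vdm_image[OF d(2)] dS that by simp
    finally show ?thesis .
  qed
  ultimately show ?thesis unfolding im by (simp add: dent_formula_def)
qed


section \<open>Quartered hexagons\<close>


lemma up_tri_in_tris_in:
  "up_tri i k \<in> tris_in P \<longleftrightarrow> P (real_of_int i + real_of_int k / 2) k
     \<and> P (real_of_int i + 1 + real_of_int k / 2) k \<and> P (real_of_int i + (real_of_int k + 1) / 2) (k + 1)"
proof -
  have "up_tri i k \<in> unit_triangles" by (auto simp: unit_triangles_def)
  then show ?thesis by (simp add: tris_in_def) (simp add: up_tri_def ucoord_def)
qed

lemma down_tri_in_tris_in:
  "down_tri i k \<in> tris_in P \<longleftrightarrow> P (real_of_int i + real_of_int k / 2) k
     \<and> P (real_of_int i + 1 + real_of_int k / 2) k \<and> P (real_of_int i + 1 + (real_of_int k - 1) / 2) (k - 1)"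
proof -
  have "down_tri i k \<in> unit_triangles" by (auto simp: unit_triangles_def)
  then show ?thesis by (simp add: tris_in_def) (simp add: down_tri_def ucoord_def)
qed

lemma tris_in_subset: "tris_in P \<subseteq> unit_triangles"
  by (auto simp: tris_in_def)

lemma region_eqI:
  assumes "R \<subseteq> unit_triangles" "R' \<subseteq> unit_triangles"
    and "\<And>i k. up_tri i k \<in> R \<longleftrightarrow> up_tri i k \<in> R'" "\<And>i k. down_tri i k \<in> R \<longleftrightarrow> down_tri i k \<in> R'"
  shows "R = R'"
proof (rule Set.set_eqI)
  fix t
  show "t \<in> R \<longleftrightarrow> t \<in> R'"
  proof (cases "t \<in> unit_triangles")
    case True
    then show ?thesis using assms(3,4) by (auto simp: unit_triangles_def)
  next
    case False
    then show ?thesis using assms(1,2) by blast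
  qed
qed

text \<open>\<open>- ((k + 1) div 2)\<close> is the first coordinate of the zigzag vertex on line
  \<open>k\<close>; since \<open>div\<close> rounds down, this holds below the axis as well.\<close>

lemma zigzag_le_iff: "zigzag k \<le> real_of_int i + real_of_int k / 2 \<longleftrightarrow> - ((k + 1) div 2) \<le> i"
proof (cases "even k")
  case True
  then obtain r where r: "k = 2 * r" by blast
  have "(k + 1) div 2 = r" using r by simp
  then show ?thesis using r by (simp add: zigzag_def) linarith
next
  case False
  then obtain r where r: "k = 2 * r + 1" by (elim oddE)
  have "(k + 1) div 2 = r + 1" using r by simp
  then show ?thesis using r by (simp add: zigzag_def field_simps) linarith
qed

definition trap :: "nat \<Rightarrow> nat \<Rightarrow> region" where
  "trap n L = tris_in (\<lambda>u k. 0 \<le> k \<and> k \<le> 2 * int n \<and> zigzag k \<le> u \<and> u \<le> real L - real_of_int k / 2)"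

lemma zigzag_le_iff_shift:
  "zigzag k \<le> real_of_int i + 1 + real_of_int k / 2 \<longleftrightarrow> - ((k + 1) div 2) \<le> i + 1"
  "zigzag (k + 1) \<le> real_of_int i + (real_of_int k + 1) / 2 \<longleftrightarrow> - ((k + 2) div 2) \<le> i"
  "zigzag (k - 1) \<le> real_of_int i + 1 + (real_of_int k - 1) / 2 \<longleftrightarrow> - (k div 2) \<le> i + 1"
  using zigzag_le_iff[of k "i + 1"] zigzag_le_iff[of "k + 1" i] zigzag_le_iff[of "k - 1" "i + 1"]
  by (simp_all add: add.assoc)

lemma up_tri_in_trap:
  "up_tri i k \<in> trap n L \<longleftrightarrow> 0 \<le> k \<and> k < 2 * int n \<and> - ((k + 1) div 2) \<le> i \<and> i + k < int L"
proof -
  have "real_of_int i + 1 + real_of_int k / 2 \<le> real L - real_of_int k / 2 \<longleftrightarrow> i + k < int L"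
    "real_of_int i + real_of_int k / 2 \<le> real L - real_of_int k / 2 \<longleftrightarrow> i + k \<le> int L"
    "real_of_int i + (real_of_int k + 1) / 2 \<le> real L - real_of_int (k + 1) / 2 \<longleftrightarrow> i + k < int L"
    by (simp_all add: field_simps, linarith+)
  then show ?thesis unfolding trap_def up_tri_in_tris_in zigzag_le_iff zigzag_le_iff_shift
    by simp linarith
qed

lemma down_tri_in_trap:
  "down_tri i k \<in> trap n L \<longleftrightarrow> 0 < k \<and> k \<le> 2 * int n \<and> - ((k + 1) div 2) \<le> i \<and> i + k < int L"
proof -
  have "real_of_int i + 1 + real_of_int k / 2 \<le> real L - real_of_int k / 2 \<longleftrightarrow> i + k < int L"
    "real_of_int i + real_of_int k / 2 \<le> real L - real_of_int k / 2 \<longleftrightarrow> i + k \<le> int L"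
    "real_of_int i + 1 + (real_of_int k - 1) / 2 \<le> real L - real_of_int (k - 1) / 2 \<longleftrightarrow> i + k \<le> int L"
    by (simp_all add: field_simps, linarith+)
  then show ?thesis unfolding trap_def down_tri_in_tris_in zigzag_le_iff zigzag_le_iff_shift
    by simp linarith
qed

lemma up_tri_in_up_triangle:
  "up_tri i k \<in> up_triangle p s \<longleftrightarrow> 0 \<le> k \<and> int p \<le> i \<and> i + k < int (p + s)"
proof -
  have "real p + real_of_int k / 2 \<le> real_of_int i + real_of_int k / 2 \<longleftrightarrow> int p \<le> i"
    "real p + real_of_int k / 2 \<le> real_of_int i + 1 + real_of_int k / 2 \<longleftrightarrow> int p \<le> i + 1"
    "real p + real_of_int (k + 1) / 2 \<le> real_of_int i + (real_of_int k + 1) / 2 \<longleftrightarrow> int p \<le> i"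
    "real_of_int i + real_of_int k / 2 \<le> real (p + s) - real_of_int k / 2 \<longleftrightarrow> i + k \<le> int (p + s)"
    "real_of_int i + 1 + real_of_int k / 2 \<le> real (p + s) - real_of_int k / 2 \<longleftrightarrow> i + k < int (p + s)"
    "real_of_int i + (real_of_int k + 1) / 2 \<le> real (p + s) - real_of_int (k + 1) / 2 \<longleftrightarrow> i + k < int (p + s)"
    by (simp_all add: field_simps, linarith+)
  then show ?thesis unfolding up_triangle_def up_tri_in_tris_in by simp linarith
qed

lemma down_tri_in_up_triangle:
  "down_tri i k \<in> up_triangle p s \<longleftrightarrow> 0 < k \<and> int p \<le> i \<and> i + k < int (p + s)"
proof -
  have "real p + real_of_int k / 2 \<le> real_of_int i + real_of_int k / 2 \<longleftrightarrow> int p \<le> i"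
    "real p + real_of_int k / 2 \<le> real_of_int i + 1 + real_of_int k / 2 \<longleftrightarrow> int p \<le> i + 1"
    "real p + real_of_int (k - 1) / 2 \<le> real_of_int i + 1 + (real_of_int k - 1) / 2 \<longleftrightarrow> int p \<le> i + 1"
    "real_of_int i + real_of_int k / 2 \<le> real (p + s) - real_of_int k / 2 \<longleftrightarrow> i + k \<le> int (p + s)"
    "real_of_int i + 1 + real_of_int k / 2 \<le> real (p + s) - real_of_int k / 2 \<longleftrightarrow> i + k < int (p + s)"
    "real_of_int i + 1 + (real_of_int k - 1) / 2 \<le> real (p + s) - real_of_int (k - 1) / 2 \<longleftrightarrow> i + k \<le> int (p + s)"
    by (simp_all add: field_simps, linarith+)
  then show ?thesis unfolding up_triangle_def down_tri_in_tris_in by simp linarith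
qed

definition half_triangle :: "nat \<Rightarrow> region" where
  "half_triangle s = tris_in (\<lambda>u k. u \<le> real s - real_of_int k / 2)"

lemma in_half_triangle:
  "up_tri i k \<in> half_triangle s \<longleftrightarrow> i + k < int s" "down_tri i k \<in> half_triangle s \<longleftrightarrow> i + k < int s"
proof -
  have *: "real_of_int i + real_of_int k / 2 \<le> real s - real_of_int k / 2 \<longleftrightarrow> i + k \<le> int s"
    "real_of_int i + 1 + real_of_int k / 2 \<le> real s - real_of_int k / 2 \<longleftrightarrow> i + k < int s"
    "real_of_int i + (real_of_int k + 1) / 2 \<le> real s - real_of_int (k + 1) / 2 \<longleftrightarrow> i + k < int s"
    "real_of_int i + 1 + (real_of_int k - 1) / 2 \<le> real s - real_of_int (k - 1) / 2 \<longleftrightarrow> i + k \<le> int s"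
    by (simp_all add: field_simps, linarith+)
  then show "up_tri i k \<in> half_triangle s \<longleftrightarrow> i + k < int s"
    "down_tri i k \<in> half_triangle s \<longleftrightarrow> i + k < int s"
    unfolding half_triangle_def up_tri_in_tris_in down_tri_in_tris_in by (simp_all, linarith+)
qed

text \<open>The reflection in the line \<open>k = 0\<close> in lattice coordinates:
  \<open>u = i + k/2\<close> is kept and \<open>k\<close> changes its sign.\<close>

definition flip :: "triangle \<Rightarrow> triangle" where
  "flip t = (\<lambda>(i, k). (i + k, - k)) ` t"

lemma flip_up: "flip (up_tri i k) = down_tri (i + k) (- k)"
  and flip_down: "flip (down_tri i k) = up_tri (i + k) (- k)"
  by (auto simp: flip_def up_tri_def down_tri_def)

lemma flip_flip: "flip (flip t) = t"
  by (simp add: flip_def image_image case_prod_unfold)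

lemma is_lozenge_flip:
  assumes "is_lozenge l" shows "is_lozenge (flip ` l)" "zig_weight (flip ` l) = zig_weight l"
proof -
  from assms obtain i k j h where l: "l = {up_tri i k, down_tri j h}"
    and adj: "(h = k \<and> j = i) \<or> (h = k + 1 \<and> (j = i \<or> j = i - 1))" unfolding is_lozenge_iff by blast
  have fl: "flip ` l = {up_tri (j + h) (- h), down_tri (i + k) (- k)}"
    unfolding l by (simp add: flip_up flip_down insert_commute)
  show "is_lozenge (flip ` l)" unfolding fl is_lozenge_pair_iff using adj by auto
  show "zig_weight (flip ` l) = zig_weight l" unfolding fl unfolding l zig_weight_pair using adj by auto
qed

lemma weighted_tilings_flip:
  "finite R \<Longrightarrow> weighted_tilings zig_weight (flip ` R) = weighted_tilings zig_weight R"
  using flip_flip is_lozenge_flip by (intro weighted_tilings_map) auto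

lemma finite_trap: "finite (trap n L)"
proof (rule finite_subset)
  let ?B = "{- 2 * int n..int L + 1} \<times> {0..2 * int n}"
  show "trap n L \<subseteq> (\<lambda>(i, k). up_tri i k) ` ?B \<union> (\<lambda>(i, k). down_tri i k) ` ?B"
  proof
    fix t assume t: "t \<in> trap n L"
    then have "t \<in> unit_triangles" using tris_in_subset by (auto simp: trap_def)
    then obtain i k where ik: "t = up_tri i k \<or> t = down_tri i k" by (auto simp: unit_triangles_def)
    then have "(i, k) \<in> ?B" using t up_tri_in_trap[of i k n L] down_tri_in_trap[of i k n L] by auto
    then show "t \<in> (\<lambda>(i, k). up_tri i k) ` ?B \<union> (\<lambda>(i, k). down_tri i k) ` ?B" using ik by force
  qed
qed auto

lemma in_zigzag_edges:
  assumes "snd w = snd v + 1"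
  shows "{v, w} \<in> zigzag_edges lo hi \<longleftrightarrow>
    lo \<le> snd v \<and> snd w \<le> hi \<and> ucoord v = zigzag (snd v) \<and> ucoord w = zigzag (snd w)"
proof
  assume "{v, w} \<in> zigzag_edges lo hi"
  then obtain v' w' where "{v, w} = {v', w'}" "snd w' = snd v' + 1" "lo \<le> snd v'" "snd w' \<le> hi"
    "ucoord v' = zigzag (snd v')" "ucoord w' = zigzag (snd w')" unfolding zigzag_edges_def by blast
  moreover from this have "v = v' \<and> w = w'" using assms by (auto simp: doubleton_eq_iff)
  ultimately show "lo \<le> snd v \<and> snd w \<le> hi \<and> ucoord v = zigzag (snd v) \<and> ucoord w = zigzag (snd w)" by simp
qed (use assms in \<open>unfold zigzag_edges_def, blast\<close>)

text \<open>The edges of the zigzag are bounded in height, but the last two assumptions put a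
  vertical lozenge of \<open>R\<close> on a line strictly between \<open>lo\<close> and
  \<open>hi\<close>, so both of its western sides are within the bounds.\<close>

lemma lozenge_weight_eq_zig_weight:
  assumes "is_lozenge l" "l \<subseteq> R"
    and "\<And>i k. up_tri i k \<in> R \<Longrightarrow> k < hi" "\<And>i k. down_tri i k \<in> R \<Longrightarrow> lo < k"
  shows "lozenge_weight (zigzag_edges lo hi) l = zig_weight l"
proof -
  have "({(i, k), (i, k + 1)} \<in> zigzag_edges lo hi \<and> {(i, k), (i + 1, k - 1)} \<in> zigzag_edges lo hi)
      \<longleftrightarrow> odd k \<and> 2 * i = - (k + 1)" if "l = {up_tri i k, down_tri i k}" for i k
  proof -
    have k: "lo < k" "k < hi" using assms(2-4) that by auto
    have 1: "{(i, k), (i, k + 1)} \<in> zigzag_edges lo hi \<longleftrightarrow>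
        ucoord (i, k) = zigzag k \<and> ucoord (i, k + 1) = zigzag (k + 1)"
      using in_zigzag_edges[of "(i, k + 1)" "(i, k)"] k by simp
    have 2: "{(i, k), (i + 1, k - 1)} \<in> zigzag_edges lo hi \<longleftrightarrow>
        ucoord (i + 1, k - 1) = zigzag (k - 1) \<and> ucoord (i, k) = zigzag k"
      using in_zigzag_edges[of "(i, k)" "(i + 1, k - 1)"] k by (simp add: insert_commute)
    show ?thesis
    proof (cases "even k")
      case True
      then show ?thesis unfolding 1 2 by (auto simp: ucoord_def zigzag_def field_simps)
    next
      case False
      have "real_of_int i + real_of_int k / 2 = - 1 / 2 \<longleftrightarrow> 2 * i = - (k + 1)"
        "real_of_int i + real_of_int (k + 1) / 2 = 0 \<longleftrightarrow> 2 * i = - (k + 1)"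
        "real_of_int (i + 1) + real_of_int (k - 1) / 2 = 0 \<longleftrightarrow> 2 * i = - (k + 1)"
        by (simp_all add: field_simps, linarith+)
      then show ?thesis using False unfolding 1 2 by (simp add: ucoord_def zigzag_def)
    qed
  qed
  then show ?thesis unfolding lozenge_weight_def zig_weight_def by (metis (no_types, lifting))
qed

text \<open>Once the bottom row of up-pointing triangles of a triangle is gone, vertical lozenges
  are forced line by line until the triangle is full. The half triangle of height
  \<open>2 * c\<close> at the zigzag behaves alike, but \<open>c\<close> of its forced lozenges sit
  at tips of the zigzag and have weight 1/2.\<close>

lemma trap_remove_triangles:
  fixes p s :: "'a \<Rightarrow> nat"
  assumes fin: "finite J" and c: "c \<le> n" "c \<le> L"
    and ps: "\<And>j. j \<in> J \<Longrightarrow> p j + s j \<le> L \<and> s j \<le> n"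
  shows "weighted_tilings zig_weight
      (trap n L - (\<lambda>q. up_tri (int q) 0) ` ({..<c} \<union> (\<Union>j\<in>J. {p j..<p j + s j}) \<union> S))
    = (1 / 2) ^ c * weighted_tilings zig_weight
      (trap n L - half_triangle c - (\<Union>j\<in>J. up_triangle (p j) (s j)) - (\<lambda>q. up_tri (int q) 0) ` S)"
proof -
  let ?u = "\<lambda>q. up_tri (int q) 0"
  let ?D = "{..<c} \<union> (\<Union>j\<in>J. {p j..<p j + s j})"
  let ?R = "trap n L - ?u ` (?D \<union> S)"
  \<comment> \<open>The forced vertical lozenges, given by the left end of their horizontal
    diagonal. The segment from \<open>(i, k)\<close> to \<open>(i + 1, k)\<close> lies in the
    triangle over \<open>p, ..., p + s\<close> iff \<open>p \<le> i\<close> and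
    \<open>i + k < p + s\<close>.\<close>
  define P where "P = {(i, k). 0 < k \<and> up_tri i k \<in> trap n L \<and>
      (i + k < int c \<or> (\<exists>j\<in>J. int (p j) \<le> i \<and> i + k < int (p j + s j)))}"
  have inu: "up_tri i k \<in> ?u ` X \<longleftrightarrow> k = 0 \<and> 0 \<le> i \<and> nat i \<in> X" for i k X
  proof -
    have "(\<exists>q\<in>X. i = int q) \<longleftrightarrow> 0 \<le> i \<and> nat i \<in> X"
    proof
      assume "0 \<le> i \<and> nat i \<in> X"
      then have "nat i \<in> X" "i = int (nat i)" by simp_all
      then show "\<exists>q\<in>X. i = int q" by blast
    qed auto
    then show ?thesis by (auto simp: image_iff)
  qed
  have inD: "nat i \<in> ?D \<longleftrightarrow> i < int c \<or> (\<exists>j\<in>J. int (p j) \<le> i \<and> i < int (p j + s j))" if "0 \<le> i" for i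
  proof -
    have "\<exists>q. i = int q" using that by (rule zero_le_imp_eq_int)
    then obtain q where q: "i = int q" by blast
    show ?thesis unfolding q by (simp del: of_nat_add)
  qed
  have ind: "down_tri i k \<notin> ?u ` X" for i k X by auto
  have finP: "finite P"
  proof (rule finite_subset)
    show "P \<subseteq> {- 2 * int n..int L} \<times> {0..2 * int n}" by (auto simp: P_def up_tri_in_trap)
  qed auto
  have forced: "weighted_tilings zig_weight ?R = (\<Prod>(i, k)\<in>P. zig_weight {up_tri i k, down_tri i k})
     * weighted_tilings zig_weight (?R - (\<Union>(i, k)\<in>P. {up_tri i k, down_tri i k}))"
  proof (rule weighted_tilings_forced_vertical[OF _ finP])
    show "finite ?R" using finite_trap by auto
  next
    fix i k assume "(i, k) \<in> P"
    then show "up_tri i k \<in> ?R \<and> down_tri i k \<in> ?R"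
      unfolding P_def Diff_iff inu using ind by (auto simp: up_tri_in_trap down_tri_in_trap)
  next
    fix i k assume ik: "(i, k) \<in> P" and up: "up_tri i (k - 1) \<in> ?R"
    have k: "0 < k" using ik by (simp add: P_def)
    have up1: "up_tri i (k - 1) \<in> trap n L" and up2: "\<not> (k = 1 \<and> 0 \<le> i \<and> nat i \<in> ?D \<union> S)"
      using up unfolding Diff_iff inu by auto
    have or: "i + k < int c \<or> (\<exists>j\<in>J. int (p j) \<le> i \<and> i + k < int (p j + s j))"
      using ik by (simp add: P_def)
    \<comment> \<open>Just above the base both lower neighbours are dents and hence absent from
      \<open>?R\<close>.\<close>
    have "k \<noteq> 1"
    proof
      assume k1: "k = 1"
      then have "0 \<le> i" using up1 by (simp add: up_tri_in_trap)
      moreover have "nat i \<in> ?D" unfolding inD[OF \<open>0 \<le> i\<close>] using or k1 by force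
      ultimately show False using up2 k1 by simp
    qed
    then show "(i, k - 1) \<in> P" using k or up1 by (auto simp: P_def)
  next
    fix i k assume ik: "(i, k) \<in> P" and up: "up_tri (i + 1) (k - 1) \<in> ?R"
    have k: "0 < k" using ik by (simp add: P_def)
    have up1: "up_tri (i + 1) (k - 1) \<in> trap n L" and up2: "\<not> (k = 1 \<and> 0 \<le> i + 1 \<and> nat (i + 1) \<in> ?D \<union> S)"
      using up unfolding Diff_iff inu by auto
    have or: "i + k < int c \<or> (\<exists>j\<in>J. int (p j) \<le> i \<and> i + k < int (p j + s j))"
      using ik by (simp add: P_def)
    have "k \<noteq> 1"
    proof
      assume k1: "k = 1"
      then have "0 \<le> i + 1" using up1 by (simp add: up_tri_in_trap)
      moreover have "nat (i + 1) \<in> ?D" unfolding inD[OF \<open>0 \<le> i + 1\<close>] using or k1 by force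
      ultimately show False using up2 k1 by simp
    qed
    then show "(i + 1, k - 1) \<in> P" using k or up1 by (auto simp: P_def)
  qed
  have rest: "?R - (\<Union>(i, k)\<in>P. {up_tri i k, down_tri i k})
      = trap n L - half_triangle c - (\<Union>j\<in>J. up_triangle (p j) (s j)) - ?u ` S" (is "?A = ?B")
  proof (rule region_eqI)
    show "?A \<subseteq> unit_triangles" "?B \<subseteq> unit_triangles" using tris_in_subset by (auto simp: trap_def)
    fix i k
    have upP: "up_tri i k \<in> (\<Union>(i, k)\<in>P. {up_tri i k, down_tri i k}) \<longleftrightarrow> (i, k) \<in> P"
      and downP: "down_tri i k \<in> (\<Union>(i, k)\<in>P. {up_tri i k, down_tri i k}) \<longleftrightarrow> (i, k) \<in> P" by auto
    have upT: "up_tri i k \<in> (\<Union>j\<in>J. up_triangle (p j) (s j)) \<longleftrightarrow>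
        0 \<le> k \<and> (\<exists>j\<in>J. int (p j) \<le> i \<and> i + k < int (p j + s j))"
      by (auto simp: up_tri_in_up_triangle)
    have downT: "down_tri i k \<in> (\<Union>j\<in>J. up_triangle (p j) (s j)) \<longleftrightarrow>
        0 < k \<and> (\<exists>j\<in>J. int (p j) \<le> i \<and> i + k < int (p j + s j))"
      by (auto simp: down_tri_in_up_triangle)
    show "up_tri i k \<in> ?A \<longleftrightarrow> up_tri i k \<in> ?B"
    proof (cases "up_tri i k \<in> trap n L")
      case True
      then have k: "0 \<le> k" "k = 0 \<Longrightarrow> 0 \<le> i" by (auto simp: up_tri_in_trap)
      show ?thesis
      proof (cases "k = 0")
        case k0: True
        then show ?thesis
          unfolding Diff_iff inu upP upT in_half_triangle using True k(2) inD[of i] by (auto simp: P_def)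
      next
        case False
        then show ?thesis
          unfolding Diff_iff inu upP upT in_half_triangle using True k(1) by (auto simp: P_def)
      qed
    qed simp
    show "down_tri i k \<in> ?A \<longleftrightarrow> down_tri i k \<in> ?B"
    proof (cases "down_tri i k \<in> trap n L")
      case True
      then have k: "0 < k" "k \<le> 2 * int n" "- ((k + 1) div 2) \<le> i" "i + k < int L"
        by (auto simp: down_tri_in_trap)
      have "up_tri i k \<in> trap n L"
        if "i + k < int c \<or> (\<exists>j\<in>J. int (p j) \<le> i \<and> i + k < int (p j + s j))"
      proof -
        have "k < 2 * int n" using that
        proof
          assume "i + k < int c"
          then show ?thesis using k(2,3) c(1) by linarith
        next
          assume "\<exists>j\<in>J. int (p j) \<le> i \<and> i + k < int (p j + s j)"
          then show ?thesis using ps k(1) by force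
        qed
        then show ?thesis using k by (simp add: up_tri_in_trap)
      qed
      then show ?thesis
        unfolding Diff_iff downP downT in_half_triangle using True k(1) ind by (auto simp: P_def)
    qed simp
  qed
  have weight: "(\<Prod>(i, k)\<in>P. zig_weight {up_tri i k, down_tri i k}) = (1 / 2) ^ c"
  proof -
    \<comment> \<open>The tip on line \<open>2 * r + 1\<close> is the vertex
      \<open>(- (r + 1), 2 * r + 1)\<close>. Its coordinates add up to \<open>r\<close>, so it
      belongs to a lozenge of the half triangle iff \<open>r < c\<close>.\<close>
    let ?Z = "\<lambda>x. odd (snd x) \<and> 2 * fst x = - (snd x + 1)"
    let ?z = "\<lambda>r. (- (int r + 1), 2 * int r + 1)"
    have "{x \<in> P. ?Z x} = ?z ` {..<c}"
    proof
      show "{x \<in> P. ?Z x} \<subseteq> ?z ` {..<c}"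
      proof
        fix x assume x: "x \<in> {x \<in> P. ?Z x}"
        then obtain r where r: "snd x = 2 * r + 1" by (auto elim: oddE)
        then have "fst x = - (r + 1)" using x by auto
        then have eq: "x = (- (r + 1), 2 * r + 1)" using r by (simp add: prod_eq_iff)
        have "0 \<le> r" "r < int c" using x unfolding eq by (auto simp: P_def)
        then show "x \<in> ?z ` {..<c}" unfolding eq by (intro image_eqI[of _ _ "nat r"]) auto
      qed
      show "?z ` {..<c} \<subseteq> {x \<in> P. ?Z x}"
        using c by (auto simp: P_def up_tri_in_trap)
    qed
    then have "card {x \<in> P. ?Z x} = c" by (simp add: card_image inj_on_def)
    moreover have "(\<Prod>(i, k)\<in>P. zig_weight {up_tri i k, down_tri i k}) = (\<Prod>x\<in>P. if ?Z x then 1 / 2 else 1)"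
      by (rule prod.cong) (auto simp: zig_weight_pair)
    ultimately show ?thesis using prod.inter_filter[OF finP, of "\<lambda>_. 1 / 2 :: real" ?Z] by simp
  qed
  show ?thesis using forced unfolding rest weight .
qed


section \<open>Trapezoids as stacks of strips\<close>

lemma strip_unit: "strip r m \<in> unit_triangles"
  by (auto simp: strip_def unit_triangles_def)

lemma up_tri_in_strip_image:
  "up_tri i k \<in> strip r ` X \<longleftrightarrow> k = int r \<and> (\<exists>j. 2 * j \<in> X \<and> i = int j - int (r div 2) - 1)"
proof
  assume "up_tri i k \<in> strip r ` X"
  then obtain m where m: "m \<in> X" "up_tri i k = strip r m" by auto
  then have "even m" by (auto simp: strip_def split: if_splits)
  then obtain j where "m = 2 * j" by blast
  then show "k = int r \<and> (\<exists>j. 2 * j \<in> X \<and> i = int j - int (r div 2) - 1)"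
    using m by (auto simp: strip_even)
next
  assume "k = int r \<and> (\<exists>j. 2 * j \<in> X \<and> i = int j - int (r div 2) - 1)"
  then obtain j where "2 * j \<in> X" "up_tri i k = strip r (2 * j)" by (auto simp: strip_even)
  then show "up_tri i k \<in> strip r ` X" by blast
qed

lemma down_tri_in_strip_image:
  "down_tri i k \<in> strip r ` X \<longleftrightarrow> k = int r + 1 \<and> (\<exists>j. 2 * j + 1 \<in> X \<and> i = int j - int (r div 2) - 1)"
proof
  assume "down_tri i k \<in> strip r ` X"
  then obtain m where m: "m \<in> X" "down_tri i k = strip r m" by auto
  then have "odd m" by (auto simp: strip_def split: if_splits)
  then obtain j where "m = 2 * j + 1" by (elim oddE)
  then show "k = int r + 1 \<and> (\<exists>j. 2 * j + 1 \<in> X \<and> i = int j - int (r div 2) - 1)"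
    using m strip_odd[of r j] by auto
next
  assume "k = int r + 1 \<and> (\<exists>j. 2 * j + 1 \<in> X \<and> i = int j - int (r div 2) - 1)"
  then obtain j where "2 * j + 1 \<in> X" "down_tri i k = strip r (2 * j + 1)"
    unfolding strip_odd by auto
  then show "down_tri i k \<in> strip r ` X" by blast
qed

lemma in_full_strip:
  assumes "r div 2 < L"
  shows "up_tri i k \<in> full_strip r L \<longleftrightarrow> k = int r \<and> - ((k + 1) div 2) \<le> i \<and> i + k < int L"
    and "down_tri i k \<in> full_strip r L \<longleftrightarrow> k = int r + 1 \<and> - ((k + 1) div 2) \<le> i \<and> i + k < int L"
proof -
  define q where "q = r div 2"
  have r: "r = (if even r then 2 * q else 2 * q + 1)" by (simp add: q_def)
  have rint: "int r = (if even r then 2 * int q else 2 * int q + 1)" using r by (metis of_nat_Suc of_nat_mult of_nat_numeral Suc_eq_plus1 add.commute)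
  have ex: "(\<exists>j. A j \<and> i = int j - int q - 1) \<longleftrightarrow> - int q - 1 \<le> i \<and> A (nat (i + int q + 1))" for A :: "nat \<Rightarrow> bool"
  proof
    assume "- int q - 1 \<le> i \<and> A (nat (i + int q + 1))"
    then show "\<exists>j. A j \<and> i = int j - int q - 1" by (intro exI[of _ "nat (i + int q + 1)"]) auto
  qed auto
  have "up_tri i k \<in> full_strip r L \<longleftrightarrow> k = int r \<and>
      (\<exists>j. (2 * j < 2 * width r L - 1 \<and> (even r \<longrightarrow> j \<noteq> 0)) \<and> i = int j - int q - 1)"
    unfolding full_strip_def up_tri_in_strip_image q_def by auto
  also have "\<dots> \<longleftrightarrow> k = int r \<and> - ((k + 1) div 2) \<le> i \<and> i + k < int L"
    unfolding ex using assms rint unfolding q_def[symmetric]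
    by (cases "even r") (auto simp: width_def q_def[symmetric] nat_less_iff)
  finally show "up_tri i k \<in> full_strip r L \<longleftrightarrow> k = int r \<and> - ((k + 1) div 2) \<le> i \<and> i + k < int L" .
  have "down_tri i k \<in> full_strip r L \<longleftrightarrow> k = int r + 1 \<and>
      (\<exists>j. 2 * j + 1 < 2 * width r L - 1 \<and> i = int j - int q - 1)"
    unfolding full_strip_def down_tri_in_strip_image q_def by auto
  also have "\<dots> \<longleftrightarrow> k = int r + 1 \<and> - ((k + 1) div 2) \<le> i \<and> i + k < int L"
    unfolding ex using assms rint unfolding q_def[symmetric]
    by (cases "even r") (auto simp: width_def q_def[symmetric] nat_less_iff)
  finally show "down_tri i k \<in> full_strip r L \<longleftrightarrow> k = int r + 1 \<and> - ((k + 1) div 2) \<le> i \<and> i + k < int L" .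
qed

lemma trap_eq_upper_strips:
  assumes "n \<le> L"
  shows "trap n L = upper_strips 0 n L"
proof (rule region_eqI)
  show "trap n L \<subseteq> unit_triangles" using tris_in_subset by (auto simp: trap_def)
  show "upper_strips 0 n L \<subseteq> unit_triangles" using upper_strips_mem strip_unit by blast
  fix i k
  have "up_tri i k \<in> upper_strips 0 n L \<longleftrightarrow> (\<exists>r<2 * n. up_tri i k \<in> full_strip r L)"
    by (auto simp: upper_strips_def)
  also have "\<dots> \<longleftrightarrow> (\<exists>r<2 * n. k = int r \<and> - ((k + 1) div 2) \<le> i \<and> i + k < int L)"
    using in_full_strip(1)[of _ L i k] assms by (intro ex_cong1 conj_cong) auto
  also have "\<dots> \<longleftrightarrow> up_tri i k \<in> trap n L"
    unfolding up_tri_in_trap by (auto intro: exI[of _ "nat k"])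
  finally show "up_tri i k \<in> trap n L \<longleftrightarrow> up_tri i k \<in> upper_strips 0 n L" ..
  have "down_tri i k \<in> upper_strips 0 n L \<longleftrightarrow> (\<exists>r<2 * n. down_tri i k \<in> full_strip r L)"
    by (auto simp: upper_strips_def)
  also have "\<dots> \<longleftrightarrow> (\<exists>r<2 * n. k = int r + 1 \<and> - ((k + 1) div 2) \<le> i \<and> i + k < int L)"
    using in_full_strip(2)[of _ L i k] assms by (intro ex_cong1 conj_cong) auto
  also have "\<dots> \<longleftrightarrow> down_tri i k \<in> trap n L"
    unfolding down_tri_in_trap by (auto intro: exI[of _ "nat (k - 1)"])
  finally show "down_tri i k \<in> trap n L \<longleftrightarrow> down_tri i k \<in> upper_strips 0 n L" ..
qed

text \<open>For \<open>n = 0\<close> the region is empty and has one tiling, so the formula is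
  correct only if there are no dents; this is the purpose of the last assumption. Otherwise the
  bottom strip exists and the artificial dent is added to those from \<open>S\<close>.\<close>

lemma trap_formula:
  assumes S: "S \<subseteq> {..<L}" and n: "n \<le> L" and n0: "n = 0 \<Longrightarrow> S = {}"
  shows "weighted_tilings zig_weight (trap n L - (\<lambda>q. up_tri (int q) 0) ` S)
    = (if card S = n then dent_formula S else 0)"
proof (cases "n = 0")
  case True
  then have "trap n L = {}" using trap_eq_upper_strips[OF n] by (simp add: upper_strips_def)
  then show ?thesis using True n0 by (simp add: dent_formula_def trap_const_def vdm_def)
next
  case False
  have u: "up_tri (int q) 0 = strip 0 (2 * Suc q)" for q unfolding strip_even by simp
  let ?U = "(\<lambda>q. up_tri (int q) 0) ` S"
  have 1: "upper_strips 0 n L = full_strip 0 L \<union> upper_strips (Suc 0) n L"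
    by (rule upper_strips_Suc) (use False in simp)
  have 2: "upper_strips (Suc 0) n L \<inter> ?U = {}"
    unfolding u using upper_strips_mem[of _ "Suc 0" n L] by (fastforce simp: strip_eq_iff)
  have 3: "full_strip 0 L - ?U
      = strip 0 ` ({0..<2 * width 0 L - 1} - (\<lambda>e. 2 * e) ` insert 0 (Suc ` S))"
    unfolding u full_strip_def by (auto simp: strip_eq_iff image_iff)
  have "trap n L - ?U = (full_strip 0 L - ?U) \<union> upper_strips (Suc 0) n L"
    using 2 unfolding trap_eq_upper_strips[OF n] 1 by blast
  then have "trap n L - ?U = dented 0 n L (insert 0 (Suc ` S))" unfolding 3 dented_def .
  then show ?thesis using weighted_tilings_dented[OF _ n S] False by simp
qed

section \<open>Blocks of a sequence and the positions they cover\<close>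

lemma psum_0 [simp]: "psum t 0 = 0"
  by (simp add: psum_def)

lemma psum_Suc: "psum t (Suc i) = psum t i + entry t (Suc i)"
  by (simp add: psum_def)

lemma psum_pred: "0 < i \<Longrightarrow> psum t (i - 1) + entry t i = psum t i"
  using psum_Suc[of t "i - 1"] by simp

lemma psum_mono: "i \<le> j \<Longrightarrow> psum t i \<le> psum t j"
  unfolding psum_def by (rule sum_mono2) auto

lemma psum_beyond: "length t \<le> i \<Longrightarrow> psum t i = sum_list t"
proof -
  assume i: "length t \<le> i"
  have "psum t k = (\<Sum>j<k. if j < length t then t ! j else 0)" for k
    by (induction k) (auto simp: psum_Suc entry_def)
  then have "psum t i = (\<Sum>j<i. if j < length t then t ! j else 0)" .
  also have "\<dots> = (\<Sum>j<length t. t ! j)"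
    by (rule sum.mono_neutral_cong_right) (use i in auto)
  finally show ?thesis by (simp add: sum_list_sum_nth atLeast0LessThan)
qed

definition block_union :: "(nat \<Rightarrow> bool) \<Rightarrow> nat list \<Rightarrow> nat set" where
  "block_union P t = (\<Union>i\<in>{i \<in> {1..length t}. P i}. {psum t (i - 1)..<psum t i})"

lemma block_disjoint:
  assumes "q \<in> {psum t (i - 1)..<psum t i}" "q \<in> {psum t (j - 1)..<psum t j}"
  shows "i = j"
proof (rule ccontr)
  assume "i \<noteq> j"
  then consider "i < j" | "j < i" by linarith
  then show False
  proof cases
    case 1
    then have "psum t i \<le> psum t (j - 1)" by (intro psum_mono) simp
    then show ?thesis using assms by simp
  next
    case 2
    then have "psum t j \<le> psum t (i - 1)" by (intro psum_mono) simp
    then show ?thesis using assms by simp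
  qed
qed

lemma finite_block_union [simp]: "finite (block_union P t)"
  by (simp add: block_union_def)

lemma card_block_union: "card (block_union P t) = (\<Sum>i | i \<in> {1..length t} \<and> P i. entry t i)"
proof -
  have "card (block_union P t) = (\<Sum>i\<in>{i \<in> {1..length t}. P i}. card {psum t (i - 1)..<psum t i})"
    unfolding block_union_def
  proof (rule card_UN_disjoint)
    show "\<forall>i\<in>{i \<in> {1..length t}. P i}. \<forall>j\<in>{i \<in> {1..length t}. P i}. i \<noteq> j \<longrightarrow>
        {psum t (i - 1)..<psum t i} \<inter> {psum t (j - 1)..<psum t j} = {}"
      using block_disjoint[of _ t] by blast
  qed simp_all
  also have "\<dots> = (\<Sum>i\<in>{i \<in> {1..length t}. P i}. entry t i)"
  proof (rule sum.cong)
    fix i assume "i \<in> {i \<in> {1..length t}. P i}"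
    then have "psum t (i - 1) + entry t i = psum t i" by (intro psum_pred) auto
    then show "card {psum t (i - 1)..<psum t i} = entry t i" by simp
  qed simp
  finally show ?thesis by simp
qed

lemma card_odd_blocks: "card (block_union odd t) = odd_sum t"
  and card_even_blocks: "card (block_union even t) = even_sum t"
  by (simp_all add: card_block_union odd_sum_def even_sum_def)

lemma odd_even_blocks_disjoint: "block_union odd t \<inter> block_union even t = {}"
proof -
  have False if "q \<in> block_union odd t" "q \<in> block_union even t" for q
  proof -
    from that obtain i j where "odd i" "even j" "q \<in> {psum t (i - 1)..<psum t i}" "q \<in> {psum t (j - 1)..<psum t j}"
      unfolding block_union_def by blast
    then show False using block_disjoint by blast
  qed
  then show ?thesis by blast
qed

lemma odd_even_blocks_union: "block_union odd t \<union> block_union even t = {..<sum_list t}"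
proof
  have "psum t i \<le> sum_list t" for i
    using psum_mono[of i "max i (length t)" t] psum_beyond[of t "max i (length t)"] by simp
  then have "q < sum_list t" if "q \<in> block_union P t" for P q
    using that unfolding block_union_def by (fastforce intro: less_le_trans)
  then show "block_union odd t \<union> block_union even t \<subseteq> {..<sum_list t}" by blast
  show "{..<sum_list t} \<subseteq> block_union odd t \<union> block_union even t"
  proof
    fix q assume "q \<in> {..<sum_list t}"
    then have "q < psum t (length t)" by (simp add: psum_beyond)
    then obtain i where i: "i < length t" "psum t i \<le> q" "q < psum t (Suc i)"
      using ex_enclosing_index[of "psum t" q "length t"] by auto
    then have "q \<in> {psum t (Suc i - 1)..<psum t (Suc i)}" "Suc i \<in> {1..length t}" by auto
    then show "q \<in> block_union odd t \<union> block_union even t"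
      unfolding block_union_def by (cases "odd (Suc i)") blast+
  qed
qed

lemma odd_sum_add_even_sum: "odd_sum t + even_sum t = sum_list t"
  using card_Un_disjoint[OF _ _ odd_even_blocks_disjoint[of t]]
  by (simp add: odd_even_blocks_union card_odd_blocks card_even_blocks)

lemma entry_le_sums:
  "odd i \<Longrightarrow> entry t i \<le> odd_sum t" "even i \<Longrightarrow> entry t i \<le> even_sum t"
proof -
  have "entry t i \<le> (\<Sum>i | i \<in> {1..length t} \<and> P i. entry t i)" if "P i" for P :: "nat \<Rightarrow> bool"
  proof (cases "i \<in> {1..length t}")
    case True
    then show ?thesis using that by (intro member_le_sum) auto
  qed (auto simp: entry_def)
  then show "odd i \<Longrightarrow> entry t i \<le> odd_sum t" "even i \<Longrightarrow> entry t i \<le> even_sum t"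
    by (auto simp: odd_sum_def even_sum_def)
qed

lemma half_triangle_0: "trap n L - half_triangle 0 = trap n L"
proof (rule region_eqI)
  show "trap n L - half_triangle 0 \<subseteq> unit_triangles" "trap n L \<subseteq> unit_triangles"
    using tris_in_subset by (auto simp: trap_def)
  fix i k
  show "up_tri i k \<in> trap n L - half_triangle 0 \<longleftrightarrow> up_tri i k \<in> trap n L"
    "down_tri i k \<in> trap n L - half_triangle 0 \<longleftrightarrow> down_tri i k \<in> trap n L"
    by (auto simp: up_tri_in_trap down_tri_in_trap in_half_triangle)
qed

text \<open>A quartered hexagon is a trapezoid of height \<open>2 * even_sum t\<close> from which
  the triangles over the even blocks are removed, without a half triangle (\<open>c = 0\<close>).
  Its number of dents is automatically the required one, so a single value of
  \<open>dent_formula\<close> remains; this is how \<open>Q'\<close> gets into the final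
  product.\<close>

theorem Q'_eq: "Q' t = dent_formula (block_union even t)"
proof -
  let ?n = "even_sum t" and ?L = "sum_list t"
  let ?J = "{i \<in> {1..length t}. even i}"
  have Le: "odd_sum t + even_sum t = ?L" by (rule odd_sum_add_even_sum)
  have "{1..length t div 2} = (\<lambda>i. i div 2) ` ?J"
  proof
    show "{1..length t div 2} \<subseteq> (\<lambda>i. i div 2) ` ?J"
    proof
      fix i assume "i \<in> {1..length t div 2}"
      then show "i \<in> (\<lambda>i. i div 2) ` ?J" by (intro image_eqI[of _ _ "2 * i"]) auto
    qed
    show "(\<lambda>i. i div 2) ` ?J \<subseteq> {1..length t div 2}" by (auto elim!: evenE)
  qed
  then have un: "(\<Union>i\<in>{1..length t div 2}. up_triangle (psum t (2 * i - 1)) (entry t (2 * i)))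
      = (\<Union>i\<in>?J. up_triangle (psum t (i - 1)) (entry t i))" by auto
  have R: "Q_region t = trap ?n ?L - (\<Union>i\<in>?J. up_triangle (psum t (i - 1)) (entry t i))"
    unfolding Q_region_def un trap_def Le ..
  have "Q' t = weighted_tilings zig_weight (Q_region t)"
    unfolding Q'_def tiling_sum_eq
    by (rule weighted_tilings_cong, rule lozenge_weight_eq_zig_weight)
      (auto simp: R up_tri_in_trap down_tri_in_trap)
  also have "\<dots> = weighted_tilings zig_weight
      (trap ?n ?L - (\<lambda>q. up_tri (int q) 0) ` ({..<0} \<union> (\<Union>i\<in>?J. {psum t (i - 1)..<psum t (i - 1) + entry t i}) \<union> {}))"
  proof (subst trap_remove_triangles)
    fix i assume i: "i \<in> ?J"
    have "psum t i \<le> psum t (length t)" by (rule psum_mono) (use i in auto)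
    then show "psum t (i - 1) + entry t i \<le> ?L \<and> entry t i \<le> ?n"
      using i psum_pred[of i t] psum_beyond[of t "length t"] entry_le_sums by auto
  qed (simp_all add: R half_triangle_0)
  also have "{..<0} \<union> (\<Union>i\<in>?J. {psum t (i - 1)..<psum t (i - 1) + entry t i}) \<union> {} = block_union even t"
    unfolding block_union_def using psum_pred[of _ t] by auto
  also have "weighted_tilings zig_weight (trap ?n ?L - (\<lambda>q. up_tri (int q) 0) ` block_union even t)
      = dent_formula (block_union even t)"
  proof (subst trap_formula)
    show "block_union even t \<subseteq> {..<?L}" using odd_even_blocks_union[of t] by auto
    show "?n \<le> ?L" using Le by simp
    show "block_union even t = {}" if "?n = 0"
      using card_even_blocks[of t] that by simp
  qed (simp add: card_even_blocks)
  finally show ?thesis .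
qed


section \<open>Cutting the region along the horizontal axis\<close>


definition mirror_blocks :: "nat \<Rightarrow> (nat \<Rightarrow> bool) \<Rightarrow> nat list \<Rightarrow> nat set" where
  "mirror_blocks L P t = (\<Union>j\<in>{j \<in> {1..length t}. P j}. {L - psum t j..<L - psum t (j - 1)})"

lemma psum_le_sum_list: "psum t i \<le> sum_list t"
  using psum_mono[of i "max i (length t)" t] psum_beyond[of t "max i (length t)"] by simp

lemma mirror_blocks_eq:
  assumes "sum_list t \<le> L"
  shows "mirror_blocks L P t = (\<lambda>q. L - 1 - q) ` block_union P t"
proof -
  have "{L - psum t j..<L - psum t (j - 1)} = (\<lambda>q. L - 1 - q) ` {psum t (j - 1)..<psum t j}" for j
  proof
    have "psum t j \<le> L" using psum_le_sum_list[of t j] assms by simp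
    then show "{L - psum t j..<L - psum t (j - 1)} \<subseteq> (\<lambda>q. L - 1 - q) ` {psum t (j - 1)..<psum t j}"
      by (intro subsetI, rule_tac x = "L - 1 - x" in image_eqI) auto
    show "(\<lambda>q. L - 1 - q) ` {psum t (j - 1)..<psum t j} \<subseteq> {L - psum t j..<L - psum t (j - 1)}"
      using \<open>psum t j \<le> L\<close> by auto
  qed
  then show ?thesis by (simp add: mirror_blocks_def block_union_def image_UN)
qed

lemma mirror_inj:
  fixes L :: nat assumes "X \<subseteq> {..<L}" shows "inj_on (\<lambda>q. L - 1 - q) X"
proof (rule inj_onI)
  fix x y assume "x \<in> X" "y \<in> X" "L - 1 - x = L - 1 - y"
  moreover from this have "x < L" "y < L" using assms by auto
  ultimately show "x = y" by simp
qed

lemma block_union_subset: "block_union P t \<subseteq> {..<sum_list t}"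
  unfolding block_union_def using psum_le_sum_list[of t] by (fastforce intro: less_le_trans)

lemma mirror_blocks_facts:
  assumes L: "sum_list t \<le> L"
  shows "card (mirror_blocks L odd t) = odd_sum t" "card (mirror_blocks L even t) = even_sum t"
    and "mirror_blocks L odd t \<inter> mirror_blocks L even t = {}"
    and "mirror_blocks L odd t \<union> mirror_blocks L even t = {L - sum_list t..<L}"
    and "finite (mirror_blocks L P t)"
proof -
  let ?f = "\<lambda>q. L - 1 - q"
  have inj: "inj_on ?f {..<sum_list t}" by (rule mirror_inj) (use L in auto)
  show "card (mirror_blocks L odd t) = odd_sum t" "card (mirror_blocks L even t) = even_sum t"
    unfolding mirror_blocks_eq[OF L]
    using card_image[OF inj_on_subset[OF inj block_union_subset]] card_odd_blocks card_even_blocks by auto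
  show "mirror_blocks L odd t \<inter> mirror_blocks L even t = {}"
    unfolding mirror_blocks_eq[OF L]
    using inj_on_image_Int[OF inj block_union_subset block_union_subset, of odd even] odd_even_blocks_disjoint[of t]
    by simp
  have "?f ` {..<sum_list t} = {L - sum_list t..<L}"
  proof
    show "{L - sum_list t..<L} \<subseteq> ?f ` {..<sum_list t}"
      using L by (intro subsetI, rule_tac x = "L - 1 - x" in image_eqI) auto
  qed (use L in auto)
  then show "mirror_blocks L odd t \<union> mirror_blocks L even t = {L - sum_list t..<L}"
    unfolding mirror_blocks_eq[OF L] by (simp add: image_Un[symmetric] odd_even_blocks_union)
  show "finite (mirror_blocks L P t)" unfolding mirror_blocks_eq[OF L] by simp
qed

definition upper_dents :: "nat \<Rightarrow> nat list \<Rightarrow> nat list \<Rightarrow> nat set" where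
  "upper_dents L a b = block_union odd a \<union> mirror_blocks L odd b"

text \<open>The block from \<open>L\<close> to \<open>L + z\<close> belongs to the triangle that
  completes the lower part, after reflection, to a trapezoid with base \<open>L + z\<close>.\<close>

definition lower_dents :: "nat \<Rightarrow> nat \<Rightarrow> nat list \<Rightarrow> nat list \<Rightarrow> nat set" where
  "lower_dents L z a b = block_union even a \<union> mirror_blocks L even b \<union> {L..<L + z}"

lemma dents_facts:
  assumes L: "L = g + sum_list a + sum_list b"
  shows "finite (upper_dents L a b)" "finite (lower_dents L z a b)"
    and "upper_dents L a b \<inter> lower_dents L z a b = {}"
    and "upper_dents L a b \<union> lower_dents L z a b = {..<sum_list a} \<union> {sum_list a + g..<L + z}"
    and "card (upper_dents L a b) = odd_sum a + odd_sum b"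
    and "card (lower_dents L z a b) = even_sum a + even_sum b + z"
    and "upper_dents L a b \<subseteq> {..<L}" "lower_dents L z a b \<subseteq> {..<L + z}"
proof -
  have bL: "sum_list b \<le> L" and Lb: "L - sum_list b = sum_list a + g" using L by auto
  note mf = mirror_blocks_facts[OF bL]
  have sub: "block_union P a \<subseteq> {..<sum_list a}" "mirror_blocks L odd b \<subseteq> {sum_list a + g..<L}"
    "mirror_blocks L even b \<subseteq> {sum_list a + g..<L}" for P
    using block_union_subset mf(4) Lb by auto
  show fin: "finite (upper_dents L a b)" "finite (lower_dents L z a b)"
    using mf(5) by (simp_all add: upper_dents_def lower_dents_def)
  have sep: "block_union P a \<inter> {sum_list a + g..<L} = {}" "block_union P a \<inter> {L..<L + z} = {}"
    "{sum_list a + g..<L} \<inter> {L..<L + z} = {}" for P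
    using sub(1)[of P] L by auto
  show "upper_dents L a b \<inter> lower_dents L z a b = {}"
    unfolding upper_dents_def lower_dents_def
    using odd_even_blocks_disjoint[of a] mf(3) sub sep by blast
  have "upper_dents L a b \<union> lower_dents L z a b = (block_union odd a \<union> block_union even a)
      \<union> (mirror_blocks L odd b \<union> mirror_blocks L even b) \<union> {L..<L + z}"
    unfolding upper_dents_def lower_dents_def by blast
  also have "\<dots> = {..<sum_list a} \<union> {sum_list a + g..<L + z}"
    unfolding odd_even_blocks_union mf(4) Lb using L by auto
  finally show un: "upper_dents L a b \<union> lower_dents L z a b = {..<sum_list a} \<union> {sum_list a + g..<L + z}" .
  have "block_union odd a \<inter> mirror_blocks L odd b = {}" using sub sep by blast
  then show "card (upper_dents L a b) = odd_sum a + odd_sum b"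
    unfolding upper_dents_def using mf by (simp add: card_Un_disjoint card_odd_blocks)
  have "block_union even a \<inter> mirror_blocks L even b = {}"
    "(block_union even a \<union> mirror_blocks L even b) \<inter> {L..<L + z} = {}" using sub sep by blast+
  then show "card (lower_dents L z a b) = even_sum a + even_sum b + z"
    unfolding lower_dents_def using mf by (simp add: card_Un_disjoint card_even_blocks)
  show "upper_dents L a b \<subseteq> {..<L}" unfolding upper_dents_def using sub L by fastforce
  have "{..<sum_list a} \<union> {sum_list a + g..<L + z} \<subseteq> {..<L + z}" using L by auto
  then show "lower_dents L z a b \<subseteq> {..<L + z}" using un by blast
qed

lemma inj_flip: "inj flip"
  by (rule injI) (metis flip_flip)

lemma mem_flip_image: "up_tri i k \<in> flip ` R \<longleftrightarrow> down_tri (i + k) (- k) \<in> R"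
  "down_tri i k \<in> flip ` R \<longleftrightarrow> up_tri (i + k) (- k) \<in> R"
proof -
  have "t \<in> flip ` R \<longleftrightarrow> flip t \<in> R" for t by (metis flip_flip image_iff)
  then show "up_tri i k \<in> flip ` R \<longleftrightarrow> down_tri (i + k) (- k) \<in> R"
    "down_tri i k \<in> flip ` R \<longleftrightarrow> up_tri (i + k) (- k) \<in> R" by (simp_all add: flip_up flip_down)
qed

lemma flip_image_unit: "R \<subseteq> unit_triangles \<Longrightarrow> flip ` R \<subseteq> unit_triangles"
  unfolding unit_triangles_def using flip_up flip_down by blast

lemma flip_up_triangle: "flip ` up_triangle p s = down_triangle p s"
proof (rule region_eqI)
  show "flip ` up_triangle p s \<subseteq> unit_triangles"
    by (rule flip_image_unit) (auto simp: up_triangle_def tris_in_def)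
  show "down_triangle p s \<subseteq> unit_triangles" by (auto simp: down_triangle_def tris_in_def)
  fix i k
  have *: "real p - real_of_int k / 2 \<le> real_of_int i + real_of_int k / 2 \<longleftrightarrow> int p \<le> i + k"
    "real p - real_of_int k / 2 \<le> real_of_int i + 1 + real_of_int k / 2 \<longleftrightarrow> int p \<le> i + 1 + k"
    "real p - real_of_int (k + 1) / 2 \<le> real_of_int i + (real_of_int k + 1) / 2 \<longleftrightarrow> int p \<le> i + 1 + k"
    "real p - real_of_int (k - 1) / 2 \<le> real_of_int i + 1 + (real_of_int k - 1) / 2 \<longleftrightarrow> int p \<le> i + k"
    "real_of_int i + real_of_int k / 2 \<le> real (p + s) + real_of_int k / 2 \<longleftrightarrow> i \<le> int (p + s)"
    "real_of_int i + 1 + real_of_int k / 2 \<le> real (p + s) + real_of_int k / 2 \<longleftrightarrow> i < int (p + s)"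
    "real_of_int i + (real_of_int k + 1) / 2 \<le> real (p + s) + real_of_int (k + 1) / 2 \<longleftrightarrow> i \<le> int (p + s)"
    "real_of_int i + 1 + (real_of_int k - 1) / 2 \<le> real (p + s) + real_of_int (k - 1) / 2 \<longleftrightarrow> i < int (p + s)"
    by (simp_all add: field_simps, linarith+)
  show "up_tri i k \<in> flip ` up_triangle p s \<longleftrightarrow> up_tri i k \<in> down_triangle p s"
    unfolding mem_flip_image down_tri_in_up_triangle unfolding down_triangle_def up_tri_in_tris_in *
    by linarith
  show "down_tri i k \<in> flip ` up_triangle p s \<longleftrightarrow> down_tri i k \<in> down_triangle p s"
    unfolding mem_flip_image up_tri_in_up_triangle unfolding down_triangle_def down_tri_in_tris_in *
    by linarith
qed

text \<open>The bend of the eastern boundary at \<open>[L + z/2; -z]\<close> is the apex of a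
  triangle of side \<open>z\<close> over the eastern end of the longer base. Removing it cuts off
  all that lies beyond the line through \<open>[L; 0]\<close> and the bend.\<close>

lemma W1_lower_eq:
  "W1_lower x y z a b = flip ` (trap (y + z + even_sum a + even_sum b) (W1_base x y a b + z)
     - up_triangle (W1_base x y a b) z)"
proof -
  define n where "n = y + z + even_sum a + even_sum b"
  define L where "L = W1_base x y a b"
  have W: "W1_lower x y z a b = tris_in (\<lambda>u k. - (2 * int n) \<le> k \<and> k \<le> 0 \<and> zigzag k \<le> u \<and>
      u \<le> real L - real_of_int k / 2 \<and> u \<le> real (L + z) + real_of_int k / 2)"
    by (simp add: W1_lower_def W1_south_def n_def L_def)
  have "W1_lower x y z a b = flip ` (trap n (L + z) - up_triangle L z)" unfolding W
  proof (rule region_eqI)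
    show "flip ` (trap n (L + z) - up_triangle L z) \<subseteq> unit_triangles"
      by (rule flip_image_unit) (auto simp: trap_def tris_in_def)
    fix i k
    have *: "real_of_int i + real_of_int k / 2 \<le> real L - real_of_int k / 2 \<longleftrightarrow> i + k \<le> int L"
      "real_of_int i + 1 + real_of_int k / 2 \<le> real L - real_of_int k / 2 \<longleftrightarrow> i + k < int L"
      "real_of_int i + (real_of_int k + 1) / 2 \<le> real L - real_of_int (k + 1) / 2 \<longleftrightarrow> i + k < int L"
      "real_of_int i + 1 + (real_of_int k - 1) / 2 \<le> real L - real_of_int (k - 1) / 2 \<longleftrightarrow> i + k \<le> int L"
      "real_of_int i + real_of_int k / 2 \<le> real (L + z) + real_of_int k / 2 \<longleftrightarrow> i \<le> int (L + z)"
      "real_of_int i + 1 + real_of_int k / 2 \<le> real (L + z) + real_of_int k / 2 \<longleftrightarrow> i < int (L + z)"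
      "real_of_int i + (real_of_int k + 1) / 2 \<le> real (L + z) + real_of_int (k + 1) / 2 \<longleftrightarrow> i \<le> int (L + z)"
      "real_of_int i + 1 + (real_of_int k - 1) / 2 \<le> real (L + z) + real_of_int (k - 1) / 2 \<longleftrightarrow> i < int (L + z)"
      by (simp_all add: field_simps, linarith+)
    obtain r where r: "(k + 1) div 2 = (if even k then r else r + 1)" "(k + 2) div 2 = r + 1" "k div 2 = r"
      "(- k + 1) div 2 = - r" "k = (if even k then 2 * r else 2 * r + 1)"
    proof (cases "even k")
      case True
      then obtain r where "k = 2 * r" by blast
      then show ?thesis by (intro that[of r]) auto
    next
      case False
      then obtain r where "k = 2 * r + 1" by (elim oddE)
      then show ?thesis by (intro that[of r]) auto
    qed
    show "up_tri i k \<in> tris_in (\<lambda>u k. - (2 * int n) \<le> k \<and> k \<le> 0 \<and> zigzag k \<le> u \<and>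
        u \<le> real L - real_of_int k / 2 \<and> u \<le> real (L + z) + real_of_int k / 2)
      \<longleftrightarrow> up_tri i k \<in> flip ` (trap n (L + z) - up_triangle L z)"
      unfolding mem_flip_image Diff_iff down_tri_in_trap down_tri_in_up_triangle
      unfolding up_tri_in_tris_in * zigzag_le_iff zigzag_le_iff_shift r(1-4)
      using r(5) by (cases "even k") auto
    show "down_tri i k \<in> tris_in (\<lambda>u k. - (2 * int n) \<le> k \<and> k \<le> 0 \<and> zigzag k \<le> u \<and>
        u \<le> real L - real_of_int k / 2 \<and> u \<le> real (L + z) + real_of_int k / 2)
      \<longleftrightarrow> down_tri i k \<in> flip ` (trap n (L + z) - up_triangle L z)"
      unfolding mem_flip_image Diff_iff up_tri_in_trap up_tri_in_up_triangle
      unfolding down_tri_in_tris_in * zigzag_le_iff zigzag_le_iff_shift r(1-4)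
      using r(5) by (cases "even k") auto
  qed (auto simp: tris_in_def)
  then show ?thesis by (simp add: n_def L_def)
qed

lemma W1_upper_eq:
  "W1_upper x y a b = trap (y + odd_sum a + odd_sum b) (W1_base x y a b) - half_triangle (entry a 1)"
  by (simp add: W1_upper_def trap_def half_triangle_def W1_north_def)


section \<open>The two parts of the region and the sum over the crossings\<close>

lemma tris_in_opposite_disjoint:
  assumes "\<And>u k. P u k \<Longrightarrow> 0 \<le> k" "\<And>u k. P' u k \<Longrightarrow> k \<le> 0"
  shows "tris_in P \<inter> tris_in P' = {}"
proof -
  have False if "t \<in> tris_in P" "t \<in> tris_in P'" for t
  proof -
    have "snd v = 0" if "v \<in> t" for v
      using \<open>t \<in> tris_in P\<close> \<open>t \<in> tris_in P'\<close> that assms(1,2)[of "ucoord v" "snd v"]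
      unfolding tris_in_def by force
    moreover obtain i k where "t = up_tri i k \<or> t = down_tri i k"
      using \<open>t \<in> tris_in P\<close> by (auto simp: tris_in_def unit_triangles_def)
    ultimately have "snd (i, k) = 0" "snd (i, k + 1) = 0 \<or> snd (i + 1, k - 1) = 0"
      using up_tri_vertices[of i k] down_tri_vertices[of i k] by blast+
    then show False by simp
  qed
  then show ?thesis by blast
qed

lemma up_tri_0_in_dented_trap:
  "up_tri (int q) 0 \<in> trap n L - half_triangle c - (\<Union>(p, s)\<in>J. up_triangle p s)
     \<longleftrightarrow> 0 < n \<and> q < L \<and> q \<notin> {..<c} \<union> (\<Union>(p, s)\<in>J. {p..<p + s})"
proof -
  have "up_tri (int q) 0 \<in> (\<Union>(p, s)\<in>J. up_triangle p s) \<longleftrightarrow> q \<in> (\<Union>(p, s)\<in>J. {p..<p + s})"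
    by (simp add: up_tri_in_up_triangle case_prod_unfold del: of_nat_add)
  then show ?thesis unfolding Diff_iff Un_iff by (auto simp: up_tri_in_trap in_half_triangle)
qed

text \<open>Pairs of left end point and side. The first block of \<open>a\<close> is absent because
  it belongs to the half triangle at the zigzag.\<close>

definition upper_triangles :: "nat \<Rightarrow> nat list \<Rightarrow> nat list \<Rightarrow> (nat \<times> nat) set" where
  "upper_triangles L a b = (\<lambda>i. (psum a (i - 1), entry a i)) ` {i \<in> {2..length a}. odd i}
     \<union> (\<lambda>j. (L - psum b j, entry b j)) ` {j \<in> {1..length b}. odd j}"

definition lower_triangles :: "nat \<Rightarrow> nat \<Rightarrow> nat list \<Rightarrow> nat list \<Rightarrow> (nat \<times> nat) set" where
  "lower_triangles L z a b = (\<lambda>i. (psum a (i - 1), entry a i)) ` {i \<in> {1..length a}. even i}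
     \<union> (\<lambda>j. (L - psum b j, entry b j)) ` {j \<in> {1..length b}. even j} \<union> {(L, z)}"

lemma triangles_bounds:
  assumes L: "sum_list a + sum_list b \<le> L"
  shows "(p, s) \<in> upper_triangles L a b \<Longrightarrow> p + s \<le> L \<and> s \<le> odd_sum a + odd_sum b"
    and "(p, s) \<in> lower_triangles L z a b \<Longrightarrow> p + s \<le> L + z \<and> s \<le> z + even_sum a + even_sum b"
proof -
  have A: "psum a (i - 1) + entry a i \<le> L" if "0 < i" for i
    using psum_pred[OF that, of a] psum_le_sum_list[of a i] L by simp
  have B: "L - psum b j + entry b j \<le> L" if "0 < j" for j
    using psum_pred[OF that, of b] psum_le_sum_list[of b j] L by simp
  show "p + s \<le> L \<and> s \<le> odd_sum a + odd_sum b" if mem: "(p, s) \<in> upper_triangles L a b"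
    using mem unfolding upper_triangles_def
  proof (elim UnE imageE)
    fix i assume "(p, s) = (psum a (i - 1), entry a i)" "i \<in> {i \<in> {2..length a}. odd i}"
    then show ?thesis using A[of i] entry_le_sums(1)[of i a] by simp
  next
    fix j assume "(p, s) = (L - psum b j, entry b j)" "j \<in> {j \<in> {1..length b}. odd j}"
    then show ?thesis using B[of j] entry_le_sums(1)[of j b] by simp
  qed
  show "p + s \<le> L + z \<and> s \<le> z + even_sum a + even_sum b" if mem: "(p, s) \<in> lower_triangles L z a b"
    using mem unfolding lower_triangles_def
  proof (elim UnE imageE)
    fix i assume "(p, s) = (psum a (i - 1), entry a i)" "i \<in> {i \<in> {1..length a}. even i}"
    then show ?thesis using A[of i] entry_le_sums(2)[of i a] by simp
  next
    fix j assume "(p, s) = (L - psum b j, entry b j)" "j \<in> {j \<in> {1..length b}. even j}"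
    then show ?thesis using B[of j] entry_le_sums(2)[of j b] by simp
  qed simp
qed

lemma mirror_block_eq:
  assumes "sum_list b \<le> L" "0 < j"
  shows "{L - psum b j..<L - psum b j + entry b j} = {L - psum b j..<L - psum b (j - 1)}"
proof -
  have "L - psum b j + entry b j = L - psum b (j - 1)"
    using psum_pred[OF assms(2), of b] psum_le_sum_list[of b j] assms(1) by linarith
  then show ?thesis by (simp only:)
qed

lemma upper_triangles_dents:
  assumes L: "sum_list b \<le> L"
  shows "{..<entry a 1} \<union> (\<Union>(p, s)\<in>upper_triangles L a b. {p..<p + s}) = upper_dents L a b"
proof -
  have "(\<Union>(p, s)\<in>upper_triangles L a b. {p..<p + s})
      = (\<Union>i\<in>{i \<in> {2..length a}. odd i}. {psum a (i - 1)..<psum a (i - 1) + entry a i})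
        \<union> (\<Union>j\<in>{j \<in> {1..length b}. odd j}. {L - psum b j..<L - psum b j + entry b j})"
    unfolding upper_triangles_def by auto
  also have "(\<Union>j\<in>{j \<in> {1..length b}. odd j}. {L - psum b j..<L - psum b j + entry b j}) = mirror_blocks L odd b"
    unfolding mirror_blocks_def using mirror_block_eq[OF L] by (intro SUP_cong) auto
  also have "(\<Union>i\<in>{i \<in> {2..length a}. odd i}. {psum a (i - 1)..<psum a (i - 1) + entry a i})
      = (\<Union>i\<in>{i \<in> {2..length a}. odd i}. {psum a (i - 1)..<psum a i})"
    using psum_pred[of _ a] by (intro SUP_cong) auto
  finally have un: "(\<Union>(p, s)\<in>upper_triangles L a b. {p..<p + s})
      = (\<Union>i\<in>{i \<in> {2..length a}. odd i}. {psum a (i - 1)..<psum a i}) \<union> mirror_blocks L odd b" .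
  have "block_union odd a = {..<entry a 1} \<union> (\<Union>i\<in>{i \<in> {2..length a}. odd i}. {psum a (i - 1)..<psum a i})"
  proof (cases "a = []")
    case True
    then show ?thesis by (simp add: block_union_def entry_def)
  next
    case False
    then have "{i \<in> {1..length a}. odd i} = insert 1 {i \<in> {2..length a}. odd i}"
    proof -
      have "1 \<le> length a" using False by (simp add: Suc_le_eq)
      then have "{1..length a} = insert 1 {2..length a}" by auto
      then show ?thesis by auto
    qed
    moreover have "{psum a (1 - 1)..<psum a 1} = {..<entry a 1}" using psum_Suc[of a 0] by auto
    ultimately show ?thesis unfolding block_union_def by simp
  qed
  then show ?thesis unfolding un upper_dents_def by blast
qed

lemma lower_triangles_dents:
  assumes L: "sum_list b \<le> L"
  shows "{..<0} \<union> (\<Union>(p, s)\<in>lower_triangles L z a b. {p..<p + s}) = lower_dents L z a b"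
proof -
  have "(\<Union>(p, s)\<in>lower_triangles L z a b. {p..<p + s})
      = (\<Union>i\<in>{i \<in> {1..length a}. even i}. {psum a (i - 1)..<psum a (i - 1) + entry a i})
        \<union> (\<Union>j\<in>{j \<in> {1..length b}. even j}. {L - psum b j..<L - psum b j + entry b j}) \<union> {L..<L + z}"
    unfolding lower_triangles_def by auto
  also have "(\<Union>j\<in>{j \<in> {1..length b}. even j}. {L - psum b j..<L - psum b j + entry b j}) = mirror_blocks L even b"
    unfolding mirror_blocks_def using mirror_block_eq[OF L] by (intro SUP_cong) auto
  also have "(\<Union>i\<in>{i \<in> {1..length a}. even i}. {psum a (i - 1)..<psum a (i - 1) + entry a i}) = block_union even a"
    unfolding block_union_def using psum_pred[of _ a] by (intro SUP_cong) auto
  finally show ?thesis by (simp add: lower_dents_def)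
qed

lemma W1_region_eq:
  assumes L: "L = x + y + sum_list a + sum_list b"
  shows "W1_region x y z a b =
    (trap (y + odd_sum a + odd_sum b) L - half_triangle (entry a 1)
       - (\<Union>(p, s)\<in>upper_triangles L a b. up_triangle p s))
    \<union> flip ` (trap (y + z + even_sum a + even_sum b) (L + z) - half_triangle 0
       - (\<Union>(p, s)\<in>lower_triangles L z a b. up_triangle p s))"
proof -
  have base: "W1_base x y a b = L" by (simp add: W1_base_def L)
  let ?Ao = "\<Union>i\<in>{i \<in> {2..length a}. odd i}. up_triangle (psum a (i - 1)) (entry a i)"
  let ?Bo = "\<Union>j\<in>{j \<in> {1..length b}. odd j}. up_triangle (L - psum b j) (entry b j)"
  let ?Ae = "\<Union>i\<in>{i \<in> {1..length a}. even i}. up_triangle (psum a (i - 1)) (entry a i)"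
  let ?Be = "\<Union>j\<in>{j \<in> {1..length b}. even j}. up_triangle (L - psum b j) (entry b j)"
  let ?Wu = "W1_upper x y a b" and ?Wl = "W1_lower x y z a b"
  let ?T = "trap (y + z + even_sum a + even_sum b) (L + z)"
  have "2 \<le> i" if "even i" "1 \<le> i" for i :: nat using that by presburger
  then have "{i \<in> {2..length a}. even i} = {i \<in> {1..length a}. even i}" by fastforce
  then have Ae: "flip ` ?Ae = (\<Union>i\<in>{i \<in> {2..length a}. even i}. down_triangle (psum a (i - 1)) (entry a i))"
    by (simp add: image_UN flip_up_triangle)
  have Be: "flip ` ?Be = (\<Union>j\<in>{j \<in> {1..length b}. even j}. down_triangle (L - psum b j) (entry b j))"
    by (simp add: image_UN flip_up_triangle)
  have 1: "(\<Union>i\<in>{2..length a}. if even i then down_triangle (psum a (i - 1)) (entry a i)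
      else up_triangle (psum a (i - 1)) (entry a i)) = ?Ao \<union> flip ` ?Ae"
    unfolding Ae by auto
  have 2: "(\<Union>j\<in>{1..length b}. if odd j then up_triangle (L - psum b j) (entry b j)
      else down_triangle (L - psum b j) (entry b j)) = ?Bo \<union> flip ` ?Be"
    unfolding Be by auto
  have Wl: "?Wl \<subseteq> tris_in (\<lambda>u k. k \<le> 0)" and Wu: "?Wu \<subseteq> tris_in (\<lambda>u k. 0 \<le> k)"
    by (auto simp: W1_lower_def W1_upper_def tris_in_def)
  have up: "up_triangle p s \<subseteq> tris_in (\<lambda>u k. 0 \<le> k)" and down: "down_triangle p s \<subseteq> tris_in (\<lambda>u k. k \<le> 0)" for p s
    by (auto simp: up_triangle_def down_triangle_def tris_in_def)
  have opp: "tris_in (\<lambda>u k. 0 \<le> k) \<inter> tris_in (\<lambda>u k. k \<le> 0) = {}"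
    by (rule tris_in_opposite_disjoint) auto
  have d1: "?Wl \<inter> (?Ao \<union> ?Bo) = {}" using Wl up opp by blast
  have d2: "?Wu \<inter> (flip ` ?Ae \<union> flip ` ?Be) = {}" unfolding Ae Be using Wu down opp by blast
  have "W1_region x y z a b = (?Wu \<union> ?Wl) - (?Ao \<union> flip ` ?Ae) - (?Bo \<union> flip ` ?Be)"
    unfolding W1_region_def base 1 2 ..
  also have "\<dots> = (?Wu - (?Ao \<union> ?Bo)) \<union> (?Wl - (flip ` ?Ae \<union> flip ` ?Be))"
  proof -
    have gen: "(X \<union> Y) - (C \<union> E) - (D \<union> F) = (X - (C \<union> D)) \<union> (Y - (E \<union> F))"
      if "Y \<inter> (C \<union> D) = {}" "X \<inter> (E \<union> F) = {}" for X Y C D E F :: region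
      using that by blast
    show ?thesis by (rule gen[OF d1 d2])
  qed
  also have "?Ao \<union> ?Bo = (\<Union>(p, s)\<in>upper_triangles L a b. up_triangle p s)"
    unfolding upper_triangles_def by (simp add: case_prod_unfold)
  also have "?Wl - (flip ` ?Ae \<union> flip ` ?Be) = flip ` (?T - up_triangle L z - (?Ae \<union> ?Be))"
    unfolding W1_lower_eq base by (simp only: image_set_diff[OF inj_flip] image_Un)
  also have "?T - up_triangle L z - (?Ae \<union> ?Be)
      = ?T - half_triangle 0 - (\<Union>(p, s)\<in>lower_triangles L z a b. up_triangle p s)"
  proof -
    have un: "(\<Union>(p, s)\<in>lower_triangles L z a b. up_triangle p s) = up_triangle L z \<union> (?Ae \<union> ?Be)"
      unfolding lower_triangles_def by (simp add: case_prod_unfold)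
    have gen: "X - Y - Z = X - (Y \<union> Z)" for X Y Z :: region by blast
    show ?thesis unfolding half_triangle_0 un by (rule gen)
  qed
  finally show ?thesis unfolding W1_upper_eq base .
qed

text \<open>The upper trapezoid requires \<open>nu\<close> dents, the lower one \<open>nl\<close>;
  given the ferns, both conditions say that \<open>y\<close> vertical lozenges cross the axis. The
  region itself has the half triangle removed, while \<open>dent_formula\<close> counts its forced
  lozenges with \<open>(1/2) ^ c\<close>; the power of 2 compensates for that.\<close>

theorem M_W1_eq:
  assumes L: "L = x + y + sum_list a + sum_list b"
  shows "M_W1 x y z a b = 2 ^ entry a 1 *
    (\<Sum>S | S \<subseteq> {sum_list a..<sum_list a + (x + y)} \<and> card S = y.
       dent_formula (upper_dents L a b \<union> S) * dent_formula (lower_dents L z a b \<union> S))"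
proof -
  define c where "c = entry a 1"
  define nu where "nu = y + odd_sum a + odd_sum b"
  define nl where "nl = y + z + even_sum a + even_sum b"
  let ?ud = "upper_dents L a b" and ?ld = "lower_dents L z a b"
  let ?gap = "{sum_list a..<sum_list a + (x + y)}"
  define Ru where "Ru = trap nu L - half_triangle c - (\<Union>(p, s)\<in>upper_triangles L a b. up_triangle p s)"
  define Rl where "Rl = trap nl (L + z) - half_triangle 0 - (\<Union>(p, s)\<in>lower_triangles L z a b. up_triangle p s)"
  let ?u = "\<lambda>q. up_tri (int q) 0" and ?d = "\<lambda>q. down_tri (int q) 0"
  have bL: "sum_list b \<le> L" and abL: "sum_list a + sum_list b \<le> L" using L by auto
  note df = dents_facts[of L "x + y" a b, OF L]
  have region: "W1_region x y z a b = flip ` Rl \<union> Ru"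
    unfolding W1_region_eq[OF L] Ru_def Rl_def nu_def nl_def c_def by (rule Un_commute)
  have trap_u: "t \<in> trap nu L" if "t \<in> Ru" for t using that by (simp add: Ru_def)
  have trap_l: "t \<in> trap nl (L + z)" if "t \<in> Rl" for t using that by (simp add: Rl_def)
  have up_u: "0 \<le> k \<and> k < 2 * int nu \<and> - ((k + 1) div 2) \<le> i" if "up_tri i k \<in> Ru" for i k
    using trap_u[OF that] by (simp add: up_tri_in_trap)
  have down_u: "0 < k" if "down_tri i k \<in> Ru" for i k
    using trap_u[OF that] by (simp add: down_tri_in_trap)
  have up_l: "k < 0" if "up_tri i k \<in> flip ` Rl" for i k
    using trap_l that unfolding mem_flip_image by (force simp: down_tri_in_trap)
  have down_l: "k \<le> 0 \<and> - 2 * int nl < k" if "down_tri i k \<in> flip ` Rl" for i k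
    using trap_l that unfolding mem_flip_image by (force simp: up_tri_in_trap)
  have fin: "finite Ru" "finite Rl" using finite_trap by (auto simp: Ru_def Rl_def)
  have unit: "Ru \<subseteq> unit_triangles" "flip ` Rl \<subseteq> unit_triangles"
    using flip_image_unit[of Rl] by (auto simp: Ru_def Rl_def trap_def tris_in_def)
  have disj: "flip ` Rl \<inter> Ru = {}"
  proof (rule equals0I)
    fix t assume t: "t \<in> flip ` Rl \<inter> Ru"
    then obtain i k where "t = up_tri i k \<or> t = down_tri i k" using unit by (auto simp: unit_triangles_def)
    then show False
    proof
      assume "t = up_tri i k"
      then show False using t up_u[of i k] up_l[of i k] by auto
    next
      assume "t = down_tri i k"
      then show False using t down_u[of i k] down_l[of i k] by auto
    qed
  qed
  define A where "A = {q. ?u q \<in> Ru \<and> ?d q \<in> flip ` Rl}"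
  have u_mem: "?u q \<in> Ru \<longleftrightarrow> 0 < nu \<and> q < L \<and> q \<notin> ?ud" for q
    unfolding Ru_def up_tri_0_in_dented_trap unfolding c_def upper_triangles_dents[OF bL] ..
  have d_mem: "?d q \<in> flip ` Rl \<longleftrightarrow> 0 < nl \<and> q < L + z \<and> q \<notin> ?ld" for q
  proof -
    have "?d q \<in> flip ` Rl \<longleftrightarrow> ?u q \<in> Rl" by (simp add: mem_flip_image)
    also have "\<dots> \<longleftrightarrow> 0 < nl \<and> q < L + z \<and> q \<notin> ?ld"
      unfolding Rl_def up_tri_0_in_dented_trap unfolding lower_triangles_dents[OF bL] ..
    finally show ?thesis .
  qed
  have gap: "{..<L} - (?ud \<union> ?ld) = ?gap" unfolding df(4) using L by auto
  have A_eq: "A = (if 0 < nu \<and> 0 < nl then ?gap else {})"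
    unfolding A_def u_mem d_mem gap[symmetric] by auto
  have finA: "finite A" unfolding A_eq by simp
  have "M_W1 x y z a b = weighted_tilings zig_weight (flip ` Rl \<union> Ru)"
    unfolding M_W1_def tiling_sum_eq region
  proof (rule weighted_tilings_cong, rule lozenge_weight_eq_zig_weight)
    fix i k
    show "k < int (W1_north y a b)" if "up_tri i k \<in> flip ` Rl \<union> Ru"
      using that up_u[of i k] up_l[of i k] by (auto simp: W1_north_def nu_def)
    show "- int (W1_south y z a b) < k" if "down_tri i k \<in> flip ` Rl \<union> Ru"
      using that down_u[of i k] down_l[of i k] by (auto simp: W1_south_def nl_def)
  qed
  also have "\<dots> = (\<Sum>S\<in>Pow A. (\<Prod>q\<in>S. zig_weight {?u q, ?d q})
      * weighted_tilings zig_weight (flip ` Rl - ?d ` S) * weighted_tilings zig_weight (Ru - ?u ` S))"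
  proof (rule weighted_tilings_cut[OF _ fin(1) disj])
    show "finite (flip ` Rl)" using fin by simp
    show "inj_on ?u A" "inj_on ?d A" by (auto simp: inj_on_def)
    show "?d q \<in> flip ` Rl \<and> ?u q \<in> Ru \<and> is_lozenge {?u q, ?d q}" if "q \<in> A" for q
      using that by (simp add: A_def is_lozenge_pair_iff)
  next
    fix l assume l: "is_lozenge l" "l \<subseteq> flip ` Rl \<union> Ru" "l \<inter> flip ` Rl \<noteq> {}" "l \<inter> Ru \<noteq> {}"
    from l(1) obtain i k j h where eq: "l = {up_tri i k, down_tri j h}"
      and adj: "(h = k \<and> j = i) \<or> (h = k + 1 \<and> (j = i \<or> j = i - 1))" unfolding is_lozenge_iff by blast
    have "up_tri i k \<in> Ru \<and> down_tri j h \<in> flip ` Rl"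
    proof (rule ccontr)
      assume "\<not> (up_tri i k \<in> Ru \<and> down_tri j h \<in> flip ` Rl)"
      then have "up_tri i k \<in> flip ` Rl \<and> down_tri j h \<in> Ru" using l(2-4) eq disj by auto
      then show False using up_l[of i k] down_u[of j h] adj by auto
    qed
    then have *: "up_tri i k \<in> Ru" "down_tri j h \<in> flip ` Rl" by auto
    then have eqs: "k = 0" "h = 0" "j = i" "0 \<le> i" using up_u[of i k] down_l[of j h] adj by auto
    then have "nat i \<in> A" "l = {?u (nat i), ?d (nat i)}" using * eq by (auto simp: A_def)
    then show "\<exists>q\<in>A. l = {?u q, ?d q}" by blast
  qed
  also have "\<dots> = (\<Sum>S\<in>Pow A. 2 ^ c * (if card S = y
      then dent_formula (?ud \<union> S) * dent_formula (?ld \<union> S) else 0))"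
  proof (rule sum.cong)
    fix S assume "S \<in> Pow A"
    then have S: "S \<subseteq> A" by simp
    then have Sgap: "S \<subseteq> ?gap" and S0: "nu = 0 \<or> nl = 0 \<Longrightarrow> S = {}" unfolding A_eq by (auto split: if_splits)
    have finS: "finite S" using S finA finite_subset by blast
    have disjS: "?ud \<inter> S = {}" "?ld \<inter> S = {}" and SL: "S \<subseteq> {..<L}" using Sgap gap by blast+
    \<comment> \<open>The axis is an even line, where the zigzag has no western tip.\<close>
    have w: "(\<Prod>q\<in>S. zig_weight {?u q, ?d q}) = 1" by (simp add: zig_weight_pair)
    have "weighted_tilings zig_weight (trap nu L - ?u ` (?ud \<union> S))
      = (1 / 2) ^ c * weighted_tilings zig_weight (Ru - ?u ` S)"
    proof -
      have "weighted_tilings zig_weight (trap nu L - ?u ` ({..<c} \<union> (\<Union>q\<in>upper_triangles L a b. {fst q..<fst q + snd q}) \<union> S))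
        = (1 / 2) ^ c * weighted_tilings zig_weight
          (trap nu L - half_triangle c - (\<Union>q\<in>upper_triangles L a b. up_triangle (fst q) (snd q)) - ?u ` S)"
      proof (rule trap_remove_triangles)
        show "finite (upper_triangles L a b)" by (simp add: upper_triangles_def)
        show "c \<le> nu" using entry_le_sums(1)[of 1 a] by (simp add: c_def nu_def)
        have "psum a 1 = c" using psum_Suc[of a 0] by (simp add: c_def)
        then show "c \<le> L" using psum_le_sum_list[of a 1] abL by simp
        fix q assume "q \<in> upper_triangles L a b"
        then show "fst q + snd q \<le> L \<and> snd q \<le> nu"
          using triangles_bounds(1)[OF abL, of "fst q" "snd q"] by (simp add: nu_def)
      qed
      moreover have "{..<c} \<union> (\<Union>q\<in>upper_triangles L a b. {fst q..<fst q + snd q}) = ?ud"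
        using upper_triangles_dents[OF bL, of a] by (simp add: c_def case_prod_unfold)
      ultimately show ?thesis unfolding Ru_def by (simp add: case_prod_unfold)
    qed
    moreover have "weighted_tilings zig_weight (trap nu L - ?u ` (?ud \<union> S))
      = (if card (?ud \<union> S) = nu then dent_formula (?ud \<union> S) else 0)"
    proof (rule trap_formula)
      show "?ud \<union> S \<subseteq> {..<L}" using df(7) SL by blast
      show "nu \<le> L" using odd_sum_add_even_sum[of a] odd_sum_add_even_sum[of b] L by (simp add: nu_def)
      show "?ud \<union> S = {}" if "nu = 0"
        using that S0 df(1,5) by (simp add: nu_def)
    qed
    moreover have "card (?ud \<union> S) = odd_sum a + odd_sum b + card S"
      using card_Un_disjoint[OF df(1) finS disjS(1)] df(5) by simp
    ultimately have upper: "weighted_tilings zig_weight (Ru - ?u ` S)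
        = 2 ^ c * (if card S = y then dent_formula (?ud \<union> S) else 0)"
      by (simp add: nu_def field_simps)
    have "weighted_tilings zig_weight (trap nl (L + z) - ?u ` (?ld \<union> S))
      = (1 / 2) ^ 0 * weighted_tilings zig_weight (Rl - ?u ` S)"
    proof -
      have "weighted_tilings zig_weight (trap nl (L + z) - ?u ` ({..<0} \<union> (\<Union>q\<in>lower_triangles L z a b. {fst q..<fst q + snd q}) \<union> S))
        = (1 / 2) ^ 0 * weighted_tilings zig_weight
          (trap nl (L + z) - half_triangle 0 - (\<Union>q\<in>lower_triangles L z a b. up_triangle (fst q) (snd q)) - ?u ` S)"
      proof (rule trap_remove_triangles)
        show "finite (lower_triangles L z a b)" by (simp add: lower_triangles_def)
        fix q assume "q \<in> lower_triangles L z a b"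
        then show "fst q + snd q \<le> L + z \<and> snd q \<le> nl"
          using triangles_bounds(2)[OF abL, of "fst q" "snd q" z] by (simp add: nl_def)
      qed simp_all
      moreover have "{..<0} \<union> (\<Union>q\<in>lower_triangles L z a b. {fst q..<fst q + snd q}) = ?ld"
        using lower_triangles_dents[OF bL, of z a] by (simp add: case_prod_unfold)
      ultimately show ?thesis unfolding Rl_def by (simp add: case_prod_unfold)
    qed
    moreover have "weighted_tilings zig_weight (trap nl (L + z) - ?u ` (?ld \<union> S))
      = (if card (?ld \<union> S) = nl then dent_formula (?ld \<union> S) else 0)"
    proof (rule trap_formula)
      show "?ld \<union> S \<subseteq> {..<L + z}" using df(8) SL by fastforce
      show "nl \<le> L + z" using odd_sum_add_even_sum[of a] odd_sum_add_even_sum[of b] L by (simp add: nl_def)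
      show "?ld \<union> S = {}" if "nl = 0"
        using that S0 df(2)[of z] df(6)[of z] by (simp add: nl_def)
    qed
    moreover have "card (?ld \<union> S) = even_sum a + even_sum b + z + card S"
      using card_Un_disjoint[OF df(2) finS disjS(2)] df(6) by simp
    ultimately have lower: "weighted_tilings zig_weight (Rl - ?u ` S)
        = (if card S = y then dent_formula (?ld \<union> S) else 0)"
      by (auto simp: nl_def)
    have "?d ` S = flip ` ?u ` S" by (simp add: image_image flip_up)
    then have "weighted_tilings zig_weight (flip ` Rl - ?d ` S) = weighted_tilings zig_weight (Rl - ?u ` S)"
      using weighted_tilings_flip[of "Rl - ?u ` S"] fin(2) by (simp add: image_set_diff[OF inj_flip])
    then show "(\<Prod>q\<in>S. zig_weight {?u q, ?d q})
      * weighted_tilings zig_weight (flip ` Rl - ?d ` S) * weighted_tilings zig_weight (Ru - ?u ` S)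
      = 2 ^ c * (if card S = y then dent_formula (?ud \<union> S) * dent_formula (?ld \<union> S) else 0)"
      unfolding w upper lower by simp
  qed simp
  also have "\<dots> = 2 ^ c * (\<Sum>S | S \<in> Pow A \<and> card S = y. dent_formula (?ud \<union> S) * dent_formula (?ld \<union> S))"
    unfolding sum_distrib_left[symmetric]
    by (subst sum.inter_filter) (use finA in simp_all)
  \<comment> \<open>\<open>A\<close> is empty when one of the two parts has height 0, which is
    possible only for \<open>y = 0\<close>. Then the empty set is the only one on either
    side.\<close>
  also have "{S. S \<in> Pow A \<and> card S = y} = {S. S \<subseteq> ?gap \<and> card S = y}"
  proof (cases "y = 0")
    case True
    have "S = {}" if "S \<subseteq> ?gap" "card S = 0" for S
      using that finite_subset[OF that(1)] by simp
    moreover have "S = {}" if "S \<subseteq> A" "card S = 0" for S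
      using that finite_subset[OF that(1) finA] by simp
    ultimately show ?thesis using True by (auto simp del: card_eq_0_iff)
  next
    case False
    then show ?thesis unfolding A_eq by (simp add: nu_def nl_def)
  qed
  finally show ?thesis unfolding c_def .
qed


section \<open>Evaluation\<close>


lemma sqc_less_iff: "sqc s < sqc t \<longleftrightarrow> s < t"
proof -
  have "sqc t - sqc s = (real t - real s) * (real t + real s + 1)" by (rule sqc_diff)
  moreover have "real t + real s + 1 > 0" by simp
  ultimately have "0 < sqc t - sqc s \<longleftrightarrow> 0 < real t - real s" by (simp add: zero_less_mult_iff)
  then show ?thesis by simp
qed

text \<open>Absolute values make the mixed factors symmetric, so the order of \<open>x\<close>
  relative to the elements of \<open>A\<close> no longer matters.\<close>

lemma vdm_insert:
  assumes "finite A" "x \<notin> A"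
  shows "vdm (insert x A) = vdm A * (\<Prod>t\<in>A. \<bar>sqc x - sqc t\<bar>)"
proof -
  have low: "(\<Prod>t | t \<in> insert x A \<and> t < x. sqc x - sqc t) = (\<Prod>t\<in>A. if t < x then sqc x - sqc t else 1)"
  proof -
    have "{t. t \<in> insert x A \<and> t < x} = {t \<in> A. t < x}" by auto
    then show ?thesis using prod.inter_filter[OF assms(1), of "\<lambda>t. sqc x - sqc t" "\<lambda>t. t < x"] by simp
  qed
  have high: "(\<Prod>t | t \<in> insert x A \<and> t < s. sqc s - sqc t)
      = (if x < s then sqc s - sqc x else 1) * (\<Prod>t | t \<in> A \<and> t < s. sqc s - sqc t)" for s
  proof (cases "x < s")
    case True
    then have "{t. t \<in> insert x A \<and> t < s} = insert x {t. t \<in> A \<and> t < s}" by auto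
    then show ?thesis using assms True by simp
  next
    case False
    then have "{t. t \<in> insert x A \<and> t < s} = {t. t \<in> A \<and> t < s}" by auto
    then show ?thesis using False by simp
  qed
  have upper: "(\<Prod>s\<in>A. \<Prod>t | t \<in> insert x A \<and> t < s. sqc s - sqc t)
      = (\<Prod>s\<in>A. (if x < s then sqc s - sqc x else 1) * (\<Prod>t | t \<in> A \<and> t < s. sqc s - sqc t))"
    by (simp only: high)
  have "(if t < x then sqc x - sqc t else 1) * (if x < t then sqc t - sqc x else 1) = \<bar>sqc x - sqc t\<bar>"
    if "t \<in> A" for t
    using that assms(2) sqc_less_iff[of t x] sqc_less_iff[of x t] by (cases t x rule: linorder_cases) auto
  then have "(\<Prod>t\<in>A. \<bar>sqc x - sqc t\<bar>)
      = (\<Prod>t\<in>A. (if t < x then sqc x - sqc t else 1) * (if x < t then sqc t - sqc x else 1))" by simp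
  then show ?thesis
    unfolding vdm_def prod.insert[OF assms] low upper prod.distrib by (simp only: mult_ac)
qed

lemma vdm_pos: "finite A \<Longrightarrow> vdm A > 0"
  unfolding vdm_def by (intro prod_pos) (auto simp: sqc_less_iff)

lemma vdm_Un:
  assumes "finite B" "finite A" "A \<inter> B = {}"
  shows "vdm (A \<union> B) = vdm A * vdm B * (\<Prod>s\<in>B. \<Prod>t\<in>A. \<bar>sqc s - sqc t\<bar>)"
  using assms
proof (induction B rule: finite_induct)
  case empty
  then show ?case by (simp add: vdm_def)
next
  case (insert x B)
  have "vdm (A \<union> insert x B) = vdm (A \<union> B) * (\<Prod>t\<in>A \<union> B. \<bar>sqc x - sqc t\<bar>)"
    using vdm_insert[of "A \<union> B" x] insert by auto
  also have "(\<Prod>t\<in>A \<union> B. \<bar>sqc x - sqc t\<bar>) = (\<Prod>t\<in>A. \<bar>sqc x - sqc t\<bar>) * (\<Prod>t\<in>B. \<bar>sqc x - sqc t\<bar>)"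
    by (rule prod.union_disjoint) (use insert in auto)
  finally show ?case using insert vdm_insert[of B x] by (simp add: mult_ac)
qed

text \<open>In the product over ordered pairs every unordered pair occurs twice.\<close>

lemma vdm_square:
  assumes "finite A"
  shows "(vdm A)\<^sup>2 = (\<Prod>s\<in>A. \<Prod>t\<in>A - {s}. \<bar>sqc s - sqc t\<bar>)"
  using assms
proof (induction A rule: finite_induct)
  case empty
  then show ?case by (simp add: vdm_def)
next
  case (insert x A)
  let ?p = "\<Prod>t\<in>A. \<bar>sqc x - sqc t\<bar>"
  have x: "insert x A - {x} = A" using insert by auto
  have "(\<Prod>t\<in>insert x A - {s}. \<bar>sqc s - sqc t\<bar>) = \<bar>sqc x - sqc s\<bar> * (\<Prod>t\<in>A - {s}. \<bar>sqc s - sqc t\<bar>)"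
    if "s \<in> A" for s
  proof -
    have "insert x A - {s} = insert x (A - {s})" using that insert by auto
    then show ?thesis using insert by (simp add: abs_minus_commute)
  qed
  then have "(\<Prod>s\<in>A. \<Prod>t\<in>insert x A - {s}. \<bar>sqc s - sqc t\<bar>) = ?p * (\<Prod>s\<in>A. \<Prod>t\<in>A - {s}. \<bar>sqc s - sqc t\<bar>)"
    by (simp add: prod.distrib)
  then have "(\<Prod>s\<in>insert x A. \<Prod>t\<in>insert x A - {s}. \<bar>sqc s - sqc t\<bar>)
      = ?p * (?p * (\<Prod>s\<in>A. \<Prod>t\<in>A - {s}. \<bar>sqc s - sqc t\<bar>))"
    unfolding prod.insert[OF insert(1,2)] x by (simp only:)
  also have "\<dots> = (vdm (insert x A))\<^sup>2"
    unfolding vdm_insert[OF insert(1,2)] insert(3)[symmetric] by (simp only: power2_eq_square mult_ac)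
  finally show ?case ..
qed

lemma trap_const_pos: "trap_const n > 0"
  unfolding trap_const_def by (intro prod_pos) simp

lemma dent_formula_pos: "finite A \<Longrightarrow> dent_formula A > 0"
  unfolding dent_formula_def using trap_const_pos vdm_pos
  by (intro mult_pos_pos prod_pos) (auto intro: add_nonneg_pos)

lemma dent_formula_Un:
  assumes "finite A" "finite S" "A \<inter> S = {}"
  shows "dent_formula (A \<union> S) = trap_const (card A + card S) / trap_const (card A) * dent_formula A
     * ((\<Prod>s\<in>S. (real s + 1 / 2) * (\<Prod>t\<in>A. \<bar>sqc s - sqc t\<bar>)) * vdm S)"
proof -
  have "trap_const (card A) \<noteq> 0" using trap_const_pos[of "card A"] by simp
  then show ?thesis
    unfolding dent_formula_def card_Un_disjoint[OF assms] vdm_Un[OF assms(2,1,3)]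
      prod.union_disjoint[OF assms] prod.distrib by simp
qed

text \<open>The change of the two normalising constants when \<open>y\<close> crossings join
  \<open>p\<close> dents above and \<open>q\<close> dents below.\<close>

definition crossing_const :: "nat \<Rightarrow> nat \<Rightarrow> nat \<Rightarrow> real" where
  "crossing_const p q y = trap_const (p + y) / trap_const p * (trap_const (q + y) / trap_const q)"

text \<open>The factors between \<open>S\<close> and the dents above combine with those between
  \<open>S\<close> and the dents below to a product over \<open>A \<union> B\<close>. As this union
  is an initial and a final block of positions, the part depending on \<open>S\<close> does not see
  how the ferns are divided into triangles.\<close>

lemma dent_formula_product:
  assumes fin: "finite A" "finite B" and disj: "A \<inter> B = {}"
    and un: "A \<union> B = {..<a} \<union> {a + N..<a + N + c}" and S: "S \<subseteq> {a..<a + N}"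
  shows "dent_formula (A \<union> S) * dent_formula (B \<union> S) =
    dent_formula A * dent_formula B * crossing_const (card A) (card B) (card S)
      * ((\<Prod>s\<in>S. gap_weight a N c s) * (vdm S)\<^sup>2)"
proof -
  have finS: "finite S" using S finite_subset by blast
  have "(A \<union> B) \<inter> S = {}" unfolding un using S by auto
  then have AS: "A \<inter> S = {}" "B \<inter> S = {}" by auto
  have "gap_weight a N c s = (real s + 1 / 2) * (\<Prod>t\<in>A. \<bar>sqc s - sqc t\<bar>)
      * ((real s + 1 / 2) * (\<Prod>t\<in>B. \<bar>sqc s - sqc t\<bar>))" if s: "s \<in> S" for s
  proof -
    have "(\<Prod>t\<in>A. \<bar>sqc s - sqc t\<bar>) * (\<Prod>t\<in>B. \<bar>sqc s - sqc t\<bar>) = (\<Prod>t\<in>A \<union> B. \<bar>sqc s - sqc t\<bar>)"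
      by (rule prod.union_disjoint[symmetric, OF fin disj])
    also have "\<dots> = (\<Prod>t\<in>{..<a}. \<bar>sqc s - sqc t\<bar>) * (\<Prod>t\<in>{a + N..<a + N + c}. \<bar>sqc s - sqc t\<bar>)"
      unfolding un by (rule prod.union_disjoint) auto
    also have "(\<Prod>t\<in>{..<a}. \<bar>sqc s - sqc t\<bar>) = (\<Prod>t\<in>{..<a}. sqc s - sqc t)"
    proof (rule prod.cong)
      fix t assume "t \<in> {..<a}"
      then have "sqc t < sqc s" using s S by (auto simp: sqc_less_iff)
      then show "\<bar>sqc s - sqc t\<bar> = sqc s - sqc t" by simp
    qed simp
    also have "(\<Prod>t\<in>{a + N..<a + N + c}. \<bar>sqc s - sqc t\<bar>) = (\<Prod>t\<in>{a + N..<a + N + c}. sqc t - sqc s)"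
    proof (rule prod.cong)
      fix t assume "t \<in> {a + N..<a + N + c}"
      then have "sqc s < sqc t" using s S by (auto simp: sqc_less_iff)
      then show "\<bar>sqc s - sqc t\<bar> = sqc t - sqc s" by simp
    qed simp
    finally show ?thesis by (simp add: gap_weight_def sqc_def power2_eq_square mult_ac)
  qed
  then have "(\<Prod>s\<in>S. gap_weight a N c s) = (\<Prod>s\<in>S. (real s + 1 / 2) * (\<Prod>t\<in>A. \<bar>sqc s - sqc t\<bar>))
      * (\<Prod>s\<in>S. (real s + 1 / 2) * (\<Prod>t\<in>B. \<bar>sqc s - sqc t\<bar>))"
    by (simp add: prod.distrib[symmetric])
  then show ?thesis
    unfolding dent_formula_Un[OF fin(1) finS AS(1)] dent_formula_Un[OF fin(2) finS AS(2)]
      crossing_const_def power2_eq_square by (simp only: mult_ac)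
qed

theorem M_W1_formula:
  assumes L: "L = x + y + sum_list a + sum_list b"
  shows "M_W1 x y z a b = 2 ^ entry a 1 * dent_formula (upper_dents L a b) * dent_formula (lower_dents L z a b)
    * crossing_const (odd_sum a + odd_sum b) (even_sum a + even_sum b + z) y
    * selberg_sum y (sum_list a) (x + y) (sum_list b + z)"
proof -
  note df = dents_facts[of L "x + y" a b, OF L]
  have un: "upper_dents L a b \<union> lower_dents L z a b
      = {..<sum_list a} \<union> {sum_list a + (x + y)..<sum_list a + (x + y) + (sum_list b + z)}"
    unfolding df(4) using L by (simp add: add_ac)
  show ?thesis
    unfolding M_W1_eq[OF L] selberg_sum_def sum_distrib_left
  proof (rule sum.cong)
    fix S assume "S \<in> {S. S \<subseteq> {sum_list a..<sum_list a + (x + y)} \<and> card S = y}"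
    then have S: "S \<subseteq> {sum_list a..<sum_list a + (x + y)}" "card S = y" by auto
    show "2 ^ entry a 1 * (dent_formula (upper_dents L a b \<union> S) * dent_formula (lower_dents L z a b \<union> S))
      = 2 ^ entry a 1 * dent_formula (upper_dents L a b) * dent_formula (lower_dents L z a b)
        * crossing_const (odd_sum a + odd_sum b) (even_sum a + even_sum b + z) y
        * ((\<Prod>s\<in>S. gap_weight (sum_list a) (x + y) (sum_list b + z) s) * (vdm S)\<^sup>2)"
      unfolding dent_formula_product[OF df(1,2,3) un S(1)] df(5,6) S(2) by (simp only: mult_ac)
  qed simp
qed

section \<open>Values of the sum without crossings and with a full gap\<close>

lemma selberg_sum_0: "selberg_sum 0 a N c = 1"
proof -
  have "{S. S \<subseteq> {a..<a + N} \<and> card S = 0} = {{}}"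
    using finite_subset[OF _ finite_atLeastLessThan] by (auto simp: card_eq_0_iff)
  then show ?thesis by (simp add: selberg_sum_def vdm_def)
qed

lemma crossing_const_0: "crossing_const p q 0 = 1"
  using trap_const_pos[of p] trap_const_pos[of q] by (simp add: crossing_const_def)

corollary M_W1_no_crossing:
  "L = x + sum_list a + sum_list b \<Longrightarrow>
    M_W1 x 0 z a b = 2 ^ entry a 1 * dent_formula (upper_dents L a b) * dent_formula (lower_dents L z a b)"
  by (subst M_W1_formula[of L]) (simp_all add: selberg_sum_0 crossing_const_0)

text \<open>The factors \<open>\<bar>s - t\<bar>\<close> give \<open>s! * (M - 1 - s)!\<close>. The
  factors \<open>s + t + 1\<close> give the run from \<open>s + 1\<close> to \<open>M + s\<close>
  without \<open>2 * s + 1\<close>, the one for the omitted \<open>t = s\<close>.\<close>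

lemma prod_sqc_diff_punctured:
  assumes "s < M"
  shows "(\<Prod>t\<in>{..<M} - {s}. \<bar>sqc s - sqc t\<bar>) = fact (M - 1 - s) * fact (M + s) / (2 * real s + 1)"
proof -
  have "(\<Prod>t\<in>{..<Suc s + k} - {s}. \<bar>sqc s - sqc t\<bar>) = fact k * fact (Suc s + k + s) / (2 * real s + 1)" for k
  proof (induction k)
    case 0
    have "{..<Suc s + 0} - {s} = {..<s}" by auto
    then have "(\<Prod>t\<in>{..<Suc s + 0} - {s}. \<bar>sqc s - sqc t\<bar>) = (\<Prod>t\<in>{..<s}. sqc s - sqc t)"
      using sqc_less_iff[of _ s] by (auto intro!: prod.cong simp: less_imp_le)
    also have "\<dots> = fact (2 * s)" by (simp add: prod_sqc_diff pochhammer_fact)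
    also have "\<dots> = fact (Suc (2 * s)) / (2 * real s + 1)" by (simp add: field_simps)
    also have "Suc (2 * s) = Suc s + 0 + s" by simp
    finally show ?case by (simp only: fact_0 mult_1)
  next
    case (Suc k)
    have "{..<Suc s + Suc k} - {s} = insert (Suc s + k) ({..<Suc s + k} - {s})" by auto
    moreover have "\<bar>sqc s - sqc (Suc s + k)\<bar> = real (Suc k) * real (Suc (Suc s + k + s))"
      using sqc_diff[of "Suc s + k" s] sqc_less_iff[of s "Suc s + k"] by (simp add: algebra_simps)
    ultimately have "(\<Prod>t\<in>{..<Suc s + Suc k} - {s}. \<bar>sqc s - sqc t\<bar>)
        = real (Suc k) * real (Suc (Suc s + k + s)) * (fact k * fact (Suc s + k + s) / (2 * real s + 1))"
      using Suc by simp
    moreover have "fact (Suc k) = real (Suc k) * fact k"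
      "fact (Suc s + Suc k + s) = real (Suc (Suc s + k + s)) * fact (Suc s + k + s)"
      using fact_Suc[of "Suc s + k + s", where ?'a = real] by simp_all
    ultimately show ?case by (simp only: times_divide_eq_right mult_ac)
  qed
  from this[of "M - Suc s"] show ?thesis using assms by simp
qed

text \<open>A gap of length \<open>y\<close> has a single subset of size \<open>y\<close>. The
  squared Vandermonde product completes the weight to a product over all other positions, and one of
  the two factors \<open>2 * s + 1\<close> in \<open>4 * sqc s\<close> cancels.\<close>

lemma selberg_sum_full:
  "selberg_sum y a y c = (\<Prod>s\<in>{a..<a + y}. (2 * real s + 1) / 4 * (fact (a + y + c - 1 - s) * fact (a + y + c + s)))"
proof -
  let ?S = "{a..<a + y}" and ?M = "a + y + c"
  have "{S. S \<subseteq> ?S \<and> card S = y} = {?S}"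
    using card_subset_eq[of ?S] by auto
  then have "selberg_sum y a y c = (\<Prod>s\<in>?S. gap_weight a y c s * (\<Prod>t\<in>?S - {s}. \<bar>sqc s - sqc t\<bar>))"
    by (simp add: selberg_sum_def vdm_square prod.distrib)
  also have "\<dots> = (\<Prod>s\<in>?S. (2 * real s + 1) / 4 * (fact (?M - 1 - s) * fact (?M + s)))"
  proof (rule prod.cong)
    fix s assume s: "s \<in> ?S"
    have 1: "(\<Prod>t\<in>{..<a}. sqc s - sqc t) = (\<Prod>t\<in>{..<a}. \<bar>sqc s - sqc t\<bar>)"
      using s sqc_less_iff[of _ s] by (intro prod.cong) (auto simp: less_imp_le)
    have 2: "(\<Prod>t\<in>{a + y..<?M}. sqc t - sqc s) = (\<Prod>t\<in>{a + y..<?M}. \<bar>sqc s - sqc t\<bar>)"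
    proof (rule prod.cong)
      fix t assume "t \<in> {a + y..<?M}"
      then have "sqc s < sqc t" using s by (auto simp: sqc_less_iff)
      then show "sqc t - sqc s = \<bar>sqc s - sqc t\<bar>" by simp
    qed simp
    have split: "{..<?M} - {s} = ({..<a} \<union> {a + y..<?M}) \<union> (?S - {s})" using s by auto
    have "(\<Prod>t\<in>{..<?M} - {s}. \<bar>sqc s - sqc t\<bar>)
        = (\<Prod>t\<in>{..<a} \<union> {a + y..<?M}. \<bar>sqc s - sqc t\<bar>) * (\<Prod>t\<in>?S - {s}. \<bar>sqc s - sqc t\<bar>)"
      unfolding split by (rule prod.union_disjoint) auto
    also have "(\<Prod>t\<in>{..<a} \<union> {a + y..<?M}. \<bar>sqc s - sqc t\<bar>)
        = (\<Prod>t\<in>{..<a}. \<bar>sqc s - sqc t\<bar>) * (\<Prod>t\<in>{a + y..<?M}. \<bar>sqc s - sqc t\<bar>)"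
      by (rule prod.union_disjoint) auto
    finally have "gap_weight a y c s * (\<Prod>t\<in>?S - {s}. \<bar>sqc s - sqc t\<bar>)
        = sqc s * (\<Prod>t\<in>{..<?M} - {s}. \<bar>sqc s - sqc t\<bar>)"
      unfolding gap_weight_def 1 2 by (simp only: mult_ac)
    also have "\<dots> = sqc s * (fact (?M - 1 - s) * fact (?M + s) / (2 * real s + 1))"
      using prod_sqc_diff_punctured[of s ?M] s by simp
    also have "\<dots> = (2 * real s + 1) / 4 * (fact (?M - 1 - s) * fact (?M + s))"
    proof -
      have "sqc s = (2 * real s + 1) * (2 * real s + 1) / 4"
        by (simp add: sqc_def power2_eq_square field_simps)
      moreover have "2 * real s + 1 \<noteq> 0" by linarith
      moreover have "v * (f / r) = r / 4 * f" if "v = r * r / 4" "r \<noteq> 0" for v f r :: real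
        unfolding that(1) using that(2) by simp
      ultimately show ?thesis by blast
    qed
    finally show "gap_weight a y c s * (\<Prod>t\<in>?S - {s}. \<bar>sqc s - sqc t\<bar>)
        = (2 * real s + 1) / 4 * (fact (?M - 1 - s) * fact (?M + s))" .
  qed simp
  finally show ?thesis .
qed

lemma prod_shift_ratio:
  fixes f :: "nat \<Rightarrow> real"
  assumes "\<And>i. f i \<noteq> 0"
  shows "(\<Prod>i<m + k. f i) / (\<Prod>i<m. f i) = (\<Prod>i<k. f (m + i))"
proof -
  have "(\<Prod>i<m + k. f i) = (\<Prod>i<m. f i) * (\<Prod>i<k. f (m + i))"
    by (induction k) (simp_all add: mult_ac)
  then show ?thesis using assms by (simp add: prod_zero_iff)
qed

text \<open>The odd numbers \<open>2 * s + 1\<close> of the gap form a quotient of double factorials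
  and the two runs of factorials form quotients of values of \<open>H_fn\<close>. The 1/4 for each
  position becomes the power \<open>-2y\<close> of 2 in the theorem.\<close>

lemma selberg_sum_full_H:
  "selberg_sum y a y c = (1 / 4) ^ y * (odd_fact (a + y) / odd_fact a)
     * ((H_fn (2 * a + c + 2 * y) * H_fn (c + y)) / (H_fn (2 * a + c + y) * H_fn c))"
proof -
  have "selberg_sum y a y c
      = (\<Prod>i<y. (2 * real (a + i) + 1) / 4 * (fact (a + y + c - 1 - (a + i)) * fact (a + y + c + (a + i))))"
    unfolding selberg_sum_full
    by (rule prod.reindex_bij_witness[of _ "\<lambda>i. a + i" "\<lambda>s. s - a"]) auto
  also have "\<dots> = (1 / 4) ^ y * (\<Prod>i<y. real (2 * (a + i) + 1)) * (\<Prod>i<y. fact (c + (y - Suc i)))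
      * (\<Prod>i<y. fact (2 * a + c + y + i))"
  proof -
    have "(2 * real (a + i) + 1) / 4 * (fact (a + y + c - 1 - (a + i)) * fact (a + y + c + (a + i)))
        = 1 / 4 * real (2 * (a + i) + 1) * fact (c + (y - Suc i)) * (fact (2 * a + c + y + i) :: real)"
      if "i < y" for i
    proof -
      have eqs: "a + y + c - 1 - (a + i) = c + (y - Suc i)" "a + y + c + (a + i) = 2 * a + c + y + i"
        using that by auto
      show ?thesis unfolding eqs by simp
    qed
    then have "(\<Prod>i<y. (2 * real (a + i) + 1) / 4 * (fact (a + y + c - 1 - (a + i)) * fact (a + y + c + (a + i))))
        = (\<Prod>i<y. 1 / 4 * real (2 * (a + i) + 1) * fact (c + (y - Suc i)) * fact (2 * a + c + y + i))"
      by (intro prod.cong) simp_all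
    then show ?thesis by (simp only: prod.distrib prod_constant card_lessThan)
  qed
  also have "(\<Prod>i<y. fact (c + (y - Suc i))) = (\<Prod>i<y. fact (c + i) :: real)"
    by (rule prod.nat_diff_reindex)
  also have "\<dots> = H_fn (c + y) / H_fn c"
    unfolding H_fn_def by (rule prod_shift_ratio[symmetric]) simp
  also have "(\<Prod>i<y. fact (2 * a + c + y + i)) = H_fn (2 * a + c + y + y) / H_fn (2 * a + c + y)"
    unfolding H_fn_def by (rule prod_shift_ratio[symmetric]) simp
  also have "(\<Prod>i<y. real (2 * (a + i) + 1)) = odd_fact (a + y) / odd_fact a"
    unfolding odd_fact_def by (rule prod_shift_ratio[symmetric]) simp
  also have "2 * a + c + y + y = 2 * a + c + 2 * y" by simp
  finally show ?thesis by (simp add: mult_ac)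
qed

text \<open>At an odd argument \<open>H_2\<close> is the product of the factorials of the smaller
  odd numbers, so the normalisation of the trapezoids is what the theorem writes with
  \<open>H_2\<close>.\<close>

lemma trap_const_H2: "trap_const n = 1 / H2_fn (2 * n + 1)"
proof -
  have "H2_fn (2 * n + 1) = (\<Prod>i = 1..n. fact (2 * n + 1 - 2 * i))" by (simp add: H2_fn_def)
  also have "\<dots> = (\<Prod>i = 1..n. fact (2 * (n - i) + 1))"
  proof (rule prod.cong)
    fix i assume "i \<in> {1..n}"
    then have "2 * n + 1 - 2 * i = 2 * (n - i) + 1" by auto
    then show "fact (2 * n + 1 - 2 * i) = (fact (2 * (n - i) + 1) :: real)" by (rule arg_cong)
  qed simp
  also have "\<dots> = (\<Prod>i<n. fact (2 * i + 1))"
    by (rule prod.reindex_bij_witness[of _ "\<lambda>i. n - i" "\<lambda>i. n - i"]) (auto simp del: fact_Suc)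
  finally show ?thesis by (simp add: trap_const_def prod_dividef)
qed

section \<open>The sequences of the two quartered hexagons\<close>

lemma mem_block_union:
  "q \<in> block_union P t \<longleftrightarrow> (\<exists>i\<ge>1. P i \<and> i \<le> length t \<and> psum t (i - 1) \<le> q \<and> q < psum t i)"
  by (auto simp: block_union_def)

lemma mem_mirror_blocks:
  "q \<in> mirror_blocks L P t \<longleftrightarrow> (\<exists>j\<ge>1. P j \<and> j \<le> length t \<and> L - psum t j \<le> q \<and> q < L - psum t (j - 1))"
  by (auto simp: mirror_blocks_def)

text \<open>Entries beyond the end of a sequence are 0, so a nonempty block is a genuine one. This
  covers the padding when a length has the wrong parity.\<close>

lemma block_index_le:
  assumes "1 \<le> i" "psum t (i - 1) < psum t i" shows "i \<le> length t"
proof (rule ccontr)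
  assume "\<not> i \<le> length t"
  then have "psum t (i - 1) = psum t i" by (simp add: psum_beyond)
  then show False using assms by simp
qed

lemma psum_take: "psum t i = sum_list (take i t)"
proof (induction i)
  case (Suc i)
  then show ?case by (cases "i < length t") (auto simp: psum_Suc entry_def take_Suc_conv_app_nth)
qed simp

lemma sum_list_entries: "sum_list (map (entry t) [1..<Suc k]) = psum t k"
  by (induction k) (simp_all add: psum_Suc)

lemma take_entries: "i < K \<Longrightarrow> take i (map (entry t) [1..<K]) = map (entry t) [1..<Suc i]"
  by (simp add: take_map)

text \<open>Both sequences consist of entries of \<open>a\<close>, one long middle entry and
  reversed entries of \<open>b\<close>; the partial sums are computed from the left end up to the
  middle and from the right end after it.\<close>

lemma psum_middle:
  "i \<le> length u \<Longrightarrow> psum (u @ [v] @ rev w) i = sum_list (take i u)"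
  "j \<le> length w \<Longrightarrow> psum (u @ [v] @ rev w) (length u + Suc (length w) - j)
     = sum_list u + v + (sum_list w - sum_list (take j w))"
proof -
  show "i \<le> length u \<Longrightarrow> psum (u @ [v] @ rev w) i = sum_list (take i u)" by (simp add: psum_take)
  assume j: "j \<le> length w"
  have "psum (u @ [v] @ rev w) (length u + Suc (length w) - j)
      = sum_list u + v + sum_list (take (length w - j) (rev w))"
    using j by (simp add: psum_take Suc_diff_le)
  also have "take (length w - j) (rev w) = rev (drop j w)" using j by (simp add: take_rev)
  also have "sum_list (rev (drop j w)) = sum_list w - sum_list (take j w)"
    using append_take_drop_id[of j w] sum_list_append[of "take j w" "drop j w"] by simp
  finally show "psum (u @ [v] @ rev w) (length u + Suc (length w) - j)
     = sum_list u + v + (sum_list w - sum_list (take j w))" .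
qed

text \<open>The leading 0 raises the indices of the blocks of \<open>a\<close> by one, so its odd
  blocks become even ones. As \<open>\<mu>\<close> and \<open>\<nu>\<close> are even, the middle
  entry, in which the blocks \<open>\<mu>\<close> and \<open>\<nu>\<close> merge with the gap, has
  the odd index \<open>\<mu> + 1\<close>, and block \<open>j\<close> of \<open>b\<close> gets the
  index \<open>\<mu> + \<nu> + 1 - j\<close>, which is even iff \<open>j\<close> is odd.\<close>

lemma block_union_t_plus:
  assumes L: "L = x + y + sum_list a + sum_list b"
  shows "block_union even (t_plus x y a b) = upper_dents L a b"
proof -
  define \<mu> where "\<mu> = 2 * ((seq_length a + 1) div 2)"
  define \<nu> where "\<nu> = 2 * ((seq_length b + 1) div 2)"
  let ?t = "t_plus x y a b"
  have \<mu>: "even \<mu>" "2 \<le> \<mu>" "length a \<le> \<mu>" and \<nu>: "even \<nu>" "2 \<le> \<nu>" "length b \<le> \<nu>"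
    by (auto simp: \<mu>_def \<nu>_def seq_length_def)
  let ?u = "0 # map (entry a) [1..<\<mu>]" and ?w = "map (entry b) [1..<\<nu>]"
  let ?v = "entry a \<mu> + x + y + entry b \<nu>"
  have t: "?t = ?u @ [?v] @ rev ?w" by (simp add: t_plus_def Let_def \<mu>_def \<nu>_def)
  have len: "length ?u = \<mu>" "length ?w = \<nu> - 1" "length ?t = \<mu> + \<nu>" using \<mu> \<nu> unfolding t by auto
  have sums: "sum_list ?u + ?v + sum_list ?w = L"
  proof -
    have "sum_list ?u = psum a (\<mu> - 1)" "sum_list ?w = psum b (\<nu> - 1)"
      using sum_list_entries[of a "\<mu> - 1"] sum_list_entries[of b "\<nu> - 1"] \<mu> \<nu> by simp_all
    then show ?thesis
      using psum_pred[of \<mu> a] psum_pred[of \<nu> b] psum_beyond[OF \<mu>(3)] psum_beyond[OF \<nu>(3)] \<mu>(2) \<nu>(2) L by simp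
  qed
  have P1: "psum ?t i = psum a (i - 1)" if "i \<le> \<mu>" for i
  proof (cases i)
    case (Suc i')
    then have "i' < \<mu>" using that by simp
    have "psum ?t i = sum_list (take i ?u)" unfolding t using psum_middle(1)[of i ?u ?v ?w] that len(1) by simp
    also have "\<dots> = sum_list (take i' (map (entry a) [1..<\<mu>]))" using Suc by simp
    also have "\<dots> = psum a i'" using take_entries[OF \<open>i' < \<mu>\<close>] sum_list_entries[of a i'] by simp
    finally show ?thesis using Suc by simp
  qed simp
  have P2: "psum ?t (\<mu> + \<nu> - j) = L - psum b j" if "j < \<nu>" for j
  proof -
    have "sum_list (take j ?w) = psum b j" using take_entries[OF that, of b] sum_list_entries[of b j] by simp
    moreover have "length ?u + Suc (length ?w) - j = \<mu> + \<nu> - j" using len \<nu> by simp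
    moreover have "sum_list (take j ?w) \<le> sum_list ?w"
      using append_take_drop_id[of j ?w] sum_list_append[of "take j ?w" "drop j ?w"] by simp
    ultimately show ?thesis using psum_middle(2)[of j ?w ?u ?v] that len(2) sums unfolding t by simp
  qed
  show ?thesis
  proof (rule Set.set_eqI, rule iffI)
    fix q assume "q \<in> block_union even ?t"
    then obtain i where i: "1 \<le> i" "even i" "i \<le> \<mu> + \<nu>" "psum ?t (i - 1) \<le> q" "q < psum ?t i"
      unfolding mem_block_union len(3) by blast
    show "q \<in> upper_dents L a b"
    proof (cases "i \<le> \<mu>")
      case True
      then have q: "psum a (i - 1 - 1) \<le> q" "q < psum a (i - 1)" using P1[of "i - 1"] P1[of i] i by auto
      have "1 \<le> i - 1" "odd (i - 1)" using i(1,2) by presburger+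
      moreover from this have "i - 1 \<le> length a" using block_index_le[of "i - 1" a] q by simp
      ultimately have "q \<in> block_union odd a" unfolding mem_block_union using q by blast
      then show ?thesis by (simp add: upper_dents_def)
    next
      case False
      define j where "j = \<mu> + \<nu> + 1 - i"
      have "i \<noteq> \<mu> + 1" using i(2) \<mu>(1) by auto
      then have j: "1 \<le> j" "j < \<nu>" "i = \<mu> + \<nu> - (j - 1)" "i - 1 = \<mu> + \<nu> - j"
        "i + j = \<mu> + \<nu> + 1" using False i(3) by (auto simp: j_def)
      have "odd (i + j)" unfolding j(5) using \<mu>(1) \<nu>(1) by simp
      then have odd: "odd j" using i(2) by simp
      have q: "L - psum b j \<le> q" "q < L - psum b (j - 1)"
        using P2[of j] P2[of "j - 1"] j i(4,5) by auto
      then have "psum b (j - 1) < psum b j" by linarith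
      then have "j \<le> length b" using block_index_le j(1) by blast
      then have "q \<in> mirror_blocks L odd b" unfolding mem_mirror_blocks using q odd j(1) by blast
      then show ?thesis by (simp add: upper_dents_def)
    qed
  next
    fix q assume "q \<in> upper_dents L a b"
    then consider "q \<in> block_union odd a" | "q \<in> mirror_blocks L odd b" unfolding upper_dents_def by blast
    then show "q \<in> block_union even ?t"
    proof cases
      case 1
      then obtain i where i: "1 \<le> i" "odd i" "i \<le> length a" "psum a (i - 1) \<le> q" "q < psum a i"
        unfolding mem_block_union by blast
      then have "i \<le> \<mu>" "i \<noteq> \<mu>" using \<mu> by auto
      then have "i < \<mu>" by simp
      then have "psum ?t (Suc i - 1) \<le> q" "q < psum ?t (Suc i)" "Suc i \<le> \<mu> + \<nu>"
        using P1[of i] P1[of "Suc i"] i by auto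
      then show ?thesis unfolding mem_block_union len(3) using i(2) by (intro exI[of _ "Suc i"]) auto
    next
      case 2
      then obtain j where j: "1 \<le> j" "odd j" "j \<le> length b" "L - psum b j \<le> q" "q < L - psum b (j - 1)"
        unfolding mem_mirror_blocks by blast
      then have "j \<le> \<nu>" "j \<noteq> \<nu>" using \<nu> by auto
      then have "j < \<nu>" by simp
      define i where "i = \<mu> + \<nu> - (j - 1)"
      have i: "1 \<le> i" "i \<le> \<mu> + \<nu>" "i - 1 = \<mu> + \<nu> - j" using j(1) \<open>j < \<nu>\<close> by (auto simp: i_def)
      have "i + j = \<mu> + \<nu> + 1" using j(1) \<open>j < \<nu>\<close> by (auto simp: i_def)
      then have "odd (i + j)" using \<mu>(1) \<nu>(1) by simp
      then have "even i" using j(2) by simp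
      moreover have "psum ?t (i - 1) \<le> q" "q < psum ?t i"
        using P2[of j] P2[of "j - 1"] j \<open>j < \<nu>\<close> i(3) by (auto simp: i_def)
      ultimately show ?thesis unfolding mem_block_union len(3) using i by blast
    qed
  qed
qed

text \<open>Without a leading 0 the blocks of \<open>a\<close> keep their indices. The final
  \<open>z\<close> is the last block, with the even index \<open>\<mu> + \<nu> + 2\<close>, and puts
  block \<open>j\<close> of \<open>b\<close> at \<open>\<mu> + \<nu> + 2 - j\<close>, of the same
  parity as \<open>j\<close>. The middle entry again has the odd index
  \<open>\<mu> + 1\<close>.\<close>

lemma block_union_t_minus:
  assumes L: "L = x + y + sum_list a + sum_list b"
  shows "block_union even (t_minus x y z a b) = lower_dents L z a b"
proof -
  define \<mu> where "\<mu> = 2 * (seq_length a div 2)"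
  define \<nu> where "\<nu> = 2 * (seq_length b div 2)"
  let ?t = "t_minus x y z a b"
  have \<mu>: "even \<mu>" "length a \<le> \<mu> + 1" and \<nu>: "even \<nu>" "length b \<le> \<nu> + 1"
    by (auto simp: \<mu>_def \<nu>_def seq_length_def)
  let ?u = "map (entry a) [1..<\<mu> + 1]" and ?w = "z # map (entry b) [1..<\<nu> + 1]"
  let ?v = "entry a (\<mu> + 1) + x + y + entry b (\<nu> + 1)"
  have t: "?t = ?u @ [?v] @ rev ?w" by (simp add: t_minus_def Let_def \<mu>_def \<nu>_def)
  have len: "length ?u = \<mu>" "length ?w = \<nu> + 1" "length ?t = \<mu> + \<nu> + 2" unfolding t by auto
  have sums: "sum_list ?u + ?v + sum_list ?w = L + z"
  proof -
    have "sum_list ?u = psum a \<mu>" "sum_list ?w = z + psum b \<nu>"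
      using sum_list_entries[of a \<mu>] sum_list_entries[of b \<nu>] by simp_all
    then show ?thesis
      using psum_Suc[of a \<mu>] psum_Suc[of b \<nu>] psum_beyond[OF \<mu>(2)] psum_beyond[OF \<nu>(2)] L by simp
  qed
  have P1: "psum ?t i = psum a i" if "i \<le> \<mu>" for i
  proof -
    have "psum ?t i = sum_list (take i ?u)" unfolding t using psum_middle(1)[of i ?u ?v ?w] that len(1) by simp
    also have "\<dots> = psum a i" using take_entries[of i "\<mu> + 1" a] sum_list_entries[of a i] that by simp
    finally show ?thesis .
  qed
  have P2: "psum ?t (\<mu> + \<nu> + 2 - Suc j) = L - psum b j" if "j \<le> \<nu>" for j
  proof -
    have take: "sum_list (take (Suc j) ?w) = z + psum b j"
      using take_entries[of j "\<nu> + 1" b] sum_list_entries[of b j] that by simp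
    moreover have "length ?u + Suc (length ?w) - Suc j = \<mu> + \<nu> + 2 - Suc j" using len by simp
    moreover have "sum_list (take (Suc j) ?w) \<le> sum_list ?w"
      using append_take_drop_id[of "Suc j" ?w] sum_list_append[of "take (Suc j) ?w" "drop (Suc j) ?w"] by simp
    ultimately show ?thesis using psum_middle(2)[of "Suc j" ?w ?u ?v] that len(2) sums unfolding t by simp
  qed
  have P3: "psum ?t (\<mu> + \<nu> + 2) = L + z"
    using psum_middle(2)[of 0 ?w ?u ?v] len(1,2) sums unfolding t by simp
  show ?thesis
  proof (rule Set.set_eqI, rule iffI)
    fix q assume "q \<in> block_union even ?t"
    then obtain i where i: "1 \<le> i" "even i" "i \<le> \<mu> + \<nu> + 2" "psum ?t (i - 1) \<le> q" "q < psum ?t i"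
      unfolding mem_block_union len(3) by blast
    consider "i \<le> \<mu>" | "\<mu> < i" "i < \<mu> + \<nu> + 2" | "i = \<mu> + \<nu> + 2" using i(3) by linarith
    then show "q \<in> lower_dents L z a b"
    proof cases
      case 1
      then have q: "psum a (i - 1) \<le> q" "q < psum a i" using P1[of "i - 1"] P1[of i] i by auto
      then have "i \<le> length a" using block_index_le[of i a] i(1) by simp
      then have "q \<in> block_union even a" unfolding mem_block_union using q i(1,2) by blast
      then show ?thesis by (simp add: lower_dents_def)
    next
      case 2
      define j where "j = \<mu> + \<nu> + 2 - i"
      have "i \<noteq> \<mu> + 1" using i(2) \<mu>(1) by auto
      then have j: "1 \<le> j" "j \<le> \<nu>" "i = \<mu> + \<nu> + 2 - Suc (j - 1)" "i - 1 = \<mu> + \<nu> + 2 - Suc j" "i + j = \<mu> + \<nu> + 2"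
        using 2 by (auto simp: j_def)
      have "even (i + j)" unfolding j(5) using \<mu>(1) \<nu>(1) by simp
      then have even: "even j" using i(2) by simp
      have q: "L - psum b j \<le> q" "q < L - psum b (j - 1)"
        using P2[of j] P2[of "j - 1"] j(1,2) i(4,5) unfolding j(3)[symmetric] j(4)[symmetric] by auto
      then have "psum b (j - 1) < psum b j" by linarith
      then have "j \<le> length b" using block_index_le j(1) by blast
      then have "q \<in> mirror_blocks L even b" unfolding mem_mirror_blocks using q even j(1) by blast
      then show ?thesis by (simp add: lower_dents_def)
    next
      case 3
      then have "L \<le> q" "q < L + z" using P2[of 0] P3 i(4,5) by auto
      then show ?thesis by (simp add: lower_dents_def)
    qed
  next
    fix q assume "q \<in> lower_dents L z a b"
    then consider "q \<in> block_union even a" | "q \<in> mirror_blocks L even b" | "L \<le> q" "q < L + z"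
      unfolding lower_dents_def by auto
    then show "q \<in> block_union even ?t"
    proof cases
      case 1
      then obtain i where i: "1 \<le> i" "even i" "i \<le> length a" "psum a (i - 1) \<le> q" "q < psum a i"
        unfolding mem_block_union by blast
      then have "i \<le> \<mu> + 1" "i \<noteq> \<mu> + 1" using \<mu> by auto
      then have "i \<le> \<mu>" by simp
      then have "psum ?t (i - 1) \<le> q" "q < psum ?t i" "i \<le> \<mu> + \<nu> + 2"
        using P1[of i] P1[of "i - 1"] i by auto
      then show ?thesis unfolding mem_block_union len(3) using i(1,2) by blast
    next
      case 2
      then obtain j where j: "1 \<le> j" "even j" "j \<le> length b" "L - psum b j \<le> q" "q < L - psum b (j - 1)"
        unfolding mem_mirror_blocks by blast
      then have "j \<le> \<nu> + 1" "j \<noteq> \<nu> + 1" using \<nu> by auto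
      then have "j \<le> \<nu>" by simp
      define i where "i = \<mu> + \<nu> + 2 - j"
      have i: "1 \<le> i" "i \<le> \<mu> + \<nu> + 2" "i - 1 = \<mu> + \<nu> + 2 - Suc j" "i = \<mu> + \<nu> + 2 - Suc (j - 1)" "i + j = \<mu> + \<nu> + 2"
        using j(1) \<open>j \<le> \<nu>\<close> by (auto simp: i_def)
      have "even (i + j)" unfolding i(5) using \<mu>(1) \<nu>(1) by simp
      then have "even i" using j(2) by simp
      moreover have "psum ?t (i - 1) \<le> q" "q < psum ?t i"
        using P2[of j] P2[of "j - 1"] j \<open>j \<le> \<nu>\<close> unfolding i(3)[symmetric] i(4)[symmetric] by auto
      ultimately show ?thesis unfolding mem_block_union len(3) using i(1,2) by blast
    next
      case 3
      then have "psum ?t (\<mu> + \<nu> + 2 - 1) \<le> q" "q < psum ?t (\<mu> + \<nu> + 2)" using P2[of 0] P3 by auto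
      then show ?thesis unfolding mem_block_union len(3) using \<mu>(1) \<nu>(1)
        by (intro exI[of _ "\<mu> + \<nu> + 2"]) auto
    qed
  qed
qed

text \<open>The region with parameters \<open>x + y, 0, z\<close> has the same base as the given
  one, hence the same dents and the same power of 2. The quotient of the other two regions supplies
  the crossing constant and the sum for a gap of length \<open>y\<close>, and \<open>r\<close>
  extends that gap to length \<open>x + y\<close>.\<close>

theorem theorem2p6:
  fixes x y z :: nat and a b :: "nat list"
  shows
    "let sa = sum_list a; sb = sum_list b;
         oa = odd_sum a; ea = even_sum a; ob = odd_sum b; eb = even_sum b;
         r = (T_fn (real (x + 1)) (2*sa + sb + 2*y + z - 1) y
               * V_fn (real (2*x + 2*sa + 1)) (sb + 2*y + z) y)
             / (T_fn 1 (2*sa + sb + 2*y + z - 1) y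
               * V_fn (real (2*sa + 1)) (sb + 2*y + z) y)
     in M_W1 x y z a b
          = M_W1 (x + y) 0 z a b * M_W1 0 y z a b / M_W1 y 0 z a b * r
      \<and> M_W1 (x + y) 0 z a b * M_W1 0 y z a b / M_W1 y 0 z a b * r
          = 2 powi (- 2 * int y + int (entry a 1))
            * Q' (t_plus x y a b) * Q' (t_minus x y z a b)
            * (odd_fact (sa + y) / odd_fact sa)
            * ((H2_fn (2*oa + 2*ob + 1) * H2_fn (2*ea + 2*eb + 2*z + 1))
               / (H2_fn (2*oa + 2*ob + 2*y + 1) * H2_fn (2*ea + 2*eb + 2*y + 2*z + 1)))
            * ((H_fn (2*sa + sb + 2*y + z) * H_fn (sb + y + z))
               / (H_fn (2*sa + sb + y + z) * H_fn (sb + z)))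
            * r"
proof -
  define sa where "sa = sum_list a"
  define sb where "sb = sum_list b"
  define p where "p = odd_sum a + odd_sum b"
  define q where "q = even_sum a + even_sum b + z"
  define N where "N = T_fn (real (x + 1)) (2*sa + sb + 2*y + z - 1) y * V_fn (real (2*x + 2*sa + 1)) (sb + 2*y + z) y"
  define D where "D = T_fn 1 (2*sa + sb + 2*y + z - 1) y * V_fn (real (2*sa + 1)) (sb + 2*y + z) y"
  define Z where "Z = selberg_sum y sa y (sb + z)"
  define U where "U = dent_formula (upper_dents (x + y + sa + sb) a b)"
  define V where "V = dent_formula (lower_dents (x + y + sa + sb) z a b)"
  define C where "C = crossing_const p q y"
  have D: "D > 0" using T_V_pos[of 0 "2*sa + sb + 2*y + z - 1" y sa "sb + 2*y + z"] by (simp add: D_def)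
  have ratio: "selberg_sum y sa (x + y) (sb + z) = Z * (N / D)"
  proof -
    have eqs: "2*sa + (sb + z) + 2*y - 1 = 2*sa + sb + 2*y + z - 1" "sb + z + 2*y = sb + 2*y + z" by simp_all
    have "selberg_sum y sa (x + y) (sb + z) * D = Z * N"
      using selberg_sum_ratio[of y sa x "sb + z"] unfolding N_def D_def Z_def eqs by (simp only:)
    then show ?thesis using D by (simp add: field_simps)
  qed
  have M1: "M_W1 x y z a b = 2 ^ entry a 1 * U * V * C * (Z * (N / D))"
    unfolding ratio[symmetric] U_def V_def C_def p_def q_def sa_def sb_def by (rule M_W1_formula) simp
  have M2: "M_W1 (x + y) 0 z a b = 2 ^ entry a 1 * U * V"
    unfolding U_def V_def sa_def sb_def by (rule M_W1_no_crossing) simp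
  \<comment> \<open>Both bases have length \<open>y + sa + sb\<close>, so the dent factors cancel
    and only the contribution of the crossings remains.\<close>
  have M3: "M_W1 0 y z a b / M_W1 y 0 z a b = C * Z"
  proof -
    have "dent_formula (upper_dents (y + sa + sb) a b) > 0" "dent_formula (lower_dents (y + sa + sb) z a b) > 0"
      using dents_facts(1,2)[of "y + sa + sb" y a b] unfolding sa_def sb_def by (simp_all add: dent_formula_pos)
    then show ?thesis
      using M_W1_formula[of "y + sa + sb" 0 y a b z] M_W1_no_crossing[of "y + sa + sb" y a b z]
      unfolding C_def Z_def p_def q_def sa_def sb_def by simp
  qed
  have Qs: "Q' (t_plus x y a b) = U" "Q' (t_minus x y z a b) = V"
    unfolding Q'_eq U_def V_def sa_def sb_def by (simp_all add: block_union_t_plus block_union_t_minus)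
  have C: "C = (H2_fn (2*odd_sum a + 2*odd_sum b + 1) * H2_fn (2*even_sum a + 2*even_sum b + 2*z + 1))
       / (H2_fn (2*odd_sum a + 2*odd_sum b + 2*y + 1) * H2_fn (2*even_sum a + 2*even_sum b + 2*y + 2*z + 1))"
    unfolding C_def crossing_const_def trap_const_H2 p_def q_def by (simp add: algebra_simps)
  have Z: "Z = (1 / 4) ^ y * (odd_fact (sa + y) / odd_fact sa)
     * ((H_fn (2*sa + sb + 2*y + z) * H_fn (sb + y + z)) / (H_fn (2*sa + sb + y + z) * H_fn (sb + z)))"
    unfolding Z_def selberg_sum_full_H by (simp add: add_ac)
  have pow: "2 powi (- 2 * int y + int (entry a 1)) = (2 ^ entry a 1 * (1 / 4) ^ y :: real)"
  proof -
    have "- 2 * int y + int (entry a 1) = - int (2 * y) + int (entry a 1)" by simp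
    then have "2 powi (- 2 * int y + int (entry a 1)) = (2 :: real) powi (- int (2 * y) + int (entry a 1))"
      by (rule arg_cong)
    also have "\<dots> = 2 powi (- int (2 * y)) * 2 powi int (entry a 1)"
      by (rule power_int_add) simp
    also have "\<dots> = inverse (2 ^ (2 * y)) * 2 ^ entry a 1"
      by (simp only: power_int_minus power_int_of_nat)
    also have "inverse (2 ^ (2 * y)) = ((1 / 4) ^ y :: real)"
      by (simp add: power_mult power_one_over inverse_eq_divide)
    finally show ?thesis by simp
  qed
  have mid: "M_W1 (x + y) 0 z a b * M_W1 0 y z a b / M_W1 y 0 z a b = 2 ^ entry a 1 * U * V * (C * Z)"
    unfolding M3[symmetric] M2 by simp
  show ?thesis
    unfolding Let_def sa_def[symmetric] sb_def[symmetric] N_def[symmetric] D_def[symmetric] mid M1 Qs pow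
    using C Z by (simp add: mult_ac)
qed

end
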